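(* Let $h_0>0$ be such that there is a constant $C_0>0$ with $\|\hat q_h\|_{BV(\Omega)}\le C_0$ for every $h\in(0,h_0]$ and every optimal control $\hat q_h$ of (P$_{\rm cd}$). For $h\in(0,h_0]$ let $(\hat u_h,\hat q_h,\hat z_h)$ be the optimal triple of (P$_{\rm cd}$) and let $(\bar u,\bar q,\bar z)$ be the optimal triple of (P). Then there holds $$\|\bar z-\hat z_h\|_{W^{1,\infty}(\Omega)}\le Ch$$ with a constant $C>0$ independent of $h$.
   Context: Continuous problem (P). Let $\Omega=(0,1)$, $V=H^1_0(\Omega)$, and let $Q=BV(\Omega)$ be the space of all $q\in L^1(\Omega)$ whose distributional derivative $q'$ is a finite signed Radon measure on $\Omega$, normed by $\|q\|_{BV(\Omega)}=\|q\|_{L^1(\Omega)}+\|q'\|_{\mathcal M(\Omega)}$, where $\|\cdot\|_{\mathcal M(\Omega)}$ is the total variation norm on the space $\mathcal M(\Omega)$ of finite signed Radon measures on $\Omega$. Fix $\alpha>0$, $u_d\in L^\infty(\Omega)$, $a\in C^{0,1}(\bar\Omega)$ with $a(x)\ge\nu>0$ on $\bar\Omega$, and $d_0\in L^\infty(\Omega)$ with $d_0\ge 0$ a.e. Let $\mathfrak a(v,w)=(av',w')_{L^2(\Omega)}+(d_0v,w)_{L^2(\Omega)}$ for $v,w\in V$. For $q\in Q$ let $Sq\in V$ be the unique solution of $\mathfrak a(Sq,w)=(q,w)_{L^2(\Omega)}$ for all $w\in V$. Problem (P) is $\min_{q\in Q}j(q)$ with $j(q)=\frac12\|Sq-u_d\|_{L^2(\Omega)}^2+\alpha\|q'\|_{\mathcal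 M(\Omega)}$. It has a unique solution $\bar q$; $\bar u=S\bar q$ is the optimal state and the adjoint state $\bar z\in V$ is the solution of $\mathfrak a(w,\bar z)=(w,\bar u-u_d)_{L^2(\Omega)}$ for all $w\in V$. The optimal triple is $(\bar u,\bar q,\bar z)$. Piecewise constant control discretization (P$_{\rm cd}$). Take a partition $0=x_0<x_1<\dots<x_l=1$, $l>1$, with mesh width $h=\max_i (x_i-x_{i-1})$. Let $V_h\subset V$ be the space of continuous functions on $[0,1]$ that vanish at $0$ and $1$ and are affine on each $(x_{i-1},x_i)$, and let $Q_h\subset BV(\Omega)$ be the space of functions that are constant on each $(x_{i-1},x_i)$. For $q\in Q$ let $S_hq\in V_h$ be the unique solution of $\mathfrak a(S_hq,w_h)=(q,w_h)_{L^2(\Omega)}$ for all $w_h\in V_h$. Problem (P$_{\rm cd}$) is $\min_{q_h\in Q_h}j_h(q_h)$ with $j_h(q_h)=\frac12\|S_hq_h-u_d\|_{L^2(\Omega)}^2+\alpha\|q_h'\|_{\mathcal M(\Omega)}$. An optimal triple $(\hat u_h,\hat q_h,\hat z_h)$ consists of an optimal control $\hat q_h\in Q_h$, the optimal state $\hat u_h=S_h\hat q_h$ and the adjoint state $\hat z_h\in V_h$ solving $\mathfrak a(w_h,\hat z_h)=(w_h,\hat u_h-u_d)_{L^2(\Omega)}$ for all $w_h\in V_h$. "$h\in(0,h_0]$" refers to all partitions with mesh width $h\le h_0$; the constants do not depend on the partition. *)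

theory Defs
  imports "HOL-Analysis.Analysis" "HOL-Library.Disjoint_Sets" "HOL-Probability.Essential_Supremum"
begin

text \<open>
  Elements of Lebesgue, Sobolev and BV spaces are represented by functions
  \<open>real \<Rightarrow> real\<close>; only their values on \<open>\<Omega> = (0,1)\<close> matter (for the finite element
  space \<open>Vh_space\<close> and for the coefficient \<open>a\<close>, those on \<open>[0,1]\<close>). No quotient by equality almost
  everywhere is taken, so membership predicates hold for every representative.
\<close>

abbreviation Omega :: "real set" where
  "Omega \<equiv> {0<..<1}"

abbreviation Om :: "real measure" where
  "Om \<equiv> lebesgue_on Omega"

definition L1_norm :: "(real \<Rightarrow> real) \<Rightarrow> real" where
  "L1_norm f = (\<integral>x. \<bar>f x\<bar> \<partial>Om)"

definition in_L2 :: "(real \<Rightarrow> real) \<Rightarrow> bool" where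
  "in_L2 f \<longleftrightarrow> f \<in> borel_measurable Om \<and> integrable Om (\<lambda>x. (f x)\<^sup>2)"

definition L2_inner :: "(real \<Rightarrow> real) \<Rightarrow> (real \<Rightarrow> real) \<Rightarrow> real" where
  "L2_inner f g = (\<integral>x. f x * g x \<partial>Om)"

definition L2_norm :: "(real \<Rightarrow> real) \<Rightarrow> real" where
  "L2_norm f = sqrt (L2_inner f f)"

definition Linf_norm :: "(real \<Rightarrow> real) \<Rightarrow> ereal" where
  "Linf_norm f = esssup Om (\<lambda>x. ereal \<bar>f x\<bar>)"

definition in_Linf :: "(real \<Rightarrow> real) \<Rightarrow> bool" where
  "in_Linf f \<longleftrightarrow> f \<in> borel_measurable Om \<and> Linf_norm f < \<infinity>"

definition test_function :: "(real \<Rightarrow> real) \<Rightarrow> bool" where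
  "test_function \<phi> \<longleftrightarrow>
     (\<forall>n x. ((deriv ^^ n) \<phi>) differentiable (at x)) \<and>
     (\<exists>K. compact K \<and> K \<subseteq> Omega \<and> (\<forall>x. x \<notin> K \<longrightarrow> \<phi> x = 0))"

definition locally_integrable :: "(real \<Rightarrow> real) \<Rightarrow> bool" where
  "locally_integrable f \<longleftrightarrow>
     (\<forall>K. compact K \<and> K \<subseteq> Omega \<longrightarrow> set_integrable lebesgue K f)"

definition is_weak_deriv :: "(real \<Rightarrow> real) \<Rightarrow> (real \<Rightarrow> real) \<Rightarrow> bool" where
  "is_weak_deriv v g \<longleftrightarrow>
     locally_integrable v \<and> locally_integrable g \<and>
     (\<forall>\<phi>. test_function \<phi> \<longrightarrow> L2_inner v (deriv \<phi>) = - L2_inner g \<phi>)"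

text \<open>Any two weak derivatives agree almost everywhere on \<open>\<Omega>\<close>, so the choice is immaterial.\<close>

definition weak_deriv :: "(real \<Rightarrow> real) \<Rightarrow> real \<Rightarrow> real" where
  "weak_deriv v = (SOME g. is_weak_deriv v g)"

definition in_H1 :: "(real \<Rightarrow> real) \<Rightarrow> bool" where
  "in_H1 v \<longleftrightarrow> in_L2 v \<and> (\<exists>g. is_weak_deriv v g \<and> in_L2 g)"

definition H1_norm :: "(real \<Rightarrow> real) \<Rightarrow> real" where
  "H1_norm v = sqrt ((L2_norm v)\<^sup>2 + (L2_norm (weak_deriv v))\<^sup>2)"

definition H10 :: "(real \<Rightarrow> real) set" where
  "H10 = {v. in_H1 v \<and>
     (\<exists>\<phi>. (\<forall>n. test_function (\<phi> n)) \<and> (\<lambda>n. H1_norm (\<lambda>x. v x - \<phi> n x)) \<longlonglongrightarrow> 0)}"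

definition W1inf_norm :: "(real \<Rightarrow> real) \<Rightarrow> ereal" where
  "W1inf_norm v =
     (if \<exists>g. is_weak_deriv v g then max (Linf_norm v) (Linf_norm (weak_deriv v)) else \<infinity>)"

text \<open>
  A finite signed measure is a real-valued set function, countably additive on the Borel subsets
  of \<open>\<Omega>\<close>; on this domain every such measure is Radon. Its values on other sets are irrelevant.
\<close>

definition Borel_Omega :: "real set set" where
  "Borel_Omega = sets (restrict_space borel Omega)"

definition signed_measure :: "(real set \<Rightarrow> real) \<Rightarrow> bool" where
  "signed_measure \<mu> \<longleftrightarrow> \<mu> {} = 0 \<and>
     (\<forall>A :: nat \<Rightarrow> real set. range A \<subseteq> Borel_Omega \<longrightarrow> disjoint_family A \<longrightarrow>
        (\<lambda>n. \<mu> (A n)) sums \<mu> (\<Union>n. A n))"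

definition total_variation :: "(real set \<Rightarrow> real) \<Rightarrow> real" where
  "total_variation \<mu> =
     (SUP \<A> \<in> {\<A>. finite \<A> \<and> \<A> \<subseteq> Borel_Omega \<and> partition_on Omega \<A>}. \<Sum>A\<in>\<A>. \<bar>\<mu> A\<bar>)"

definition measure_difference ::
    "(real set \<Rightarrow> real) \<Rightarrow> real measure \<Rightarrow> real measure \<Rightarrow> bool" where
  "measure_difference \<mu> P N \<longleftrightarrow>
     finite_measure P \<and> sets P = Borel_Omega \<and> finite_measure N \<and> sets N = Borel_Omega \<and>
     (\<forall>A\<in>Borel_Omega. \<mu> A = measure P A - measure N A)"

text \<open>
  The integral against \<open>\<mu>\<close> is the difference of the integrals against \<open>P\<close> and \<open>N\<close> for any
  decomposition \<open>\<mu> = P - N\<close> into finite measures. One exists by the Jordan decomposition theorem,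
  and the integral of a bounded function does not depend on which one is used.
\<close>

definition is_measure_deriv :: "(real \<Rightarrow> real) \<Rightarrow> (real set \<Rightarrow> real) \<Rightarrow> bool" where
  "is_measure_deriv q \<mu> \<longleftrightarrow> signed_measure \<mu> \<and>
     (\<exists>P N. measure_difference \<mu> P N \<and>
        (\<forall>\<phi>. test_function \<phi> \<longrightarrow>
           L2_inner q (deriv \<phi>) = - ((\<integral>x. \<phi> x \<partial>P) - (\<integral>x. \<phi> x \<partial>N))))"

definition BV :: "(real \<Rightarrow> real) set" where
  "BV = {q. integrable Om q \<and> (\<exists>\<mu>. is_measure_deriv q \<mu>)}"

text \<open>The derivative is determined on all Borel subsets of \<open>\<Omega>\<close>, hence so is its total variation.\<close>

definition deriv_TV :: "(real \<Rightarrow> real) \<Rightarrow> real" where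
  "deriv_TV q = total_variation (SOME \<mu>. is_measure_deriv q \<mu>)"

definition BV_norm :: "(real \<Rightarrow> real) \<Rightarrow> real" where
  "BV_norm q = L1_norm q + deriv_TV q"

definition bilin :: "(real \<Rightarrow> real) \<Rightarrow> (real \<Rightarrow> real) \<Rightarrow> (real \<Rightarrow> real) \<Rightarrow> (real \<Rightarrow> real) \<Rightarrow> real" where
  "bilin a d0 v w =
     L2_inner (\<lambda>x. a x * weak_deriv v x) (weak_deriv w) + L2_inner (\<lambda>x. d0 x * v x) w"

text \<open>
  State and adjoint equations, posed in a space \<open>W\<close> of trial and test functions:
  \<open>W = H10\<close> for the continuous problem, \<open>W = Vh_space x l\<close> for the discrete one.
\<close>

definition is_state ::
    "(real \<Rightarrow> real) set \<Rightarrow> (real \<Rightarrow> real) \<Rightarrow> (real \<Rightarrow> real) \<Rightarrow> (real \<Rightarrow> real) \<Rightarrow> (real \<Rightarrow> real) \<Rightarrow> bool"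
  where
  "is_state W a d0 q u \<longleftrightarrow> u \<in> W \<and> (\<forall>w\<in>W. bilin a d0 u w = L2_inner q w)"

definition is_adjoint ::
    "(real \<Rightarrow> real) set \<Rightarrow> (real \<Rightarrow> real) \<Rightarrow> (real \<Rightarrow> real) \<Rightarrow> (real \<Rightarrow> real) \<Rightarrow> (real \<Rightarrow> real)
      \<Rightarrow> (real \<Rightarrow> real) \<Rightarrow> bool"
  where
  "is_adjoint W a d0 ud u z \<longleftrightarrow>
     z \<in> W \<and> (\<forall>w\<in>W. bilin a d0 w z = L2_inner w (\<lambda>x. u x - ud x))"

text \<open>The state is unique up to equality almost everywhere on \<open>\<Omega>\<close>.\<close>

definition solution_op ::
    "(real \<Rightarrow> real) set \<Rightarrow> (real \<Rightarrow> real) \<Rightarrow> (real \<Rightarrow> real) \<Rightarrow> (real \<Rightarrow> real) \<Rightarrow> real \<Rightarrow> real"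
  where
  "solution_op W a d0 q = (SOME u. is_state W a d0 q u)"

definition cost ::
    "(real \<Rightarrow> real) set \<Rightarrow> (real \<Rightarrow> real) \<Rightarrow> (real \<Rightarrow> real) \<Rightarrow> (real \<Rightarrow> real) \<Rightarrow> real
      \<Rightarrow> (real \<Rightarrow> real) \<Rightarrow> real"
  where
  "cost W a d0 ud \<alpha> q =
     1 / 2 * (L2_norm (\<lambda>x. solution_op W a d0 q x - ud x))\<^sup>2 + \<alpha> * deriv_TV q"

definition optimal_control ::
    "(real \<Rightarrow> real) set \<Rightarrow> (real \<Rightarrow> real) set \<Rightarrow> (real \<Rightarrow> real) \<Rightarrow> (real \<Rightarrow> real) \<Rightarrow> (real \<Rightarrow> real) \<Rightarrow> real
      \<Rightarrow> (real \<Rightarrow> real) \<Rightarrow> bool"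
  where
  "optimal_control W Q a d0 ud \<alpha> q \<longleftrightarrow>
     q \<in> Q \<and> (\<forall>p\<in>Q. cost W a d0 ud \<alpha> q \<le> cost W a d0 ud \<alpha> p)"

definition optimal_triple ::
    "(real \<Rightarrow> real) set \<Rightarrow> (real \<Rightarrow> real) set \<Rightarrow> (real \<Rightarrow> real) \<Rightarrow> (real \<Rightarrow> real) \<Rightarrow> (real \<Rightarrow> real) \<Rightarrow> real
      \<Rightarrow> (real \<Rightarrow> real) \<Rightarrow> (real \<Rightarrow> real) \<Rightarrow> (real \<Rightarrow> real) \<Rightarrow> bool"
  where
  "optimal_triple W Q a d0 ud \<alpha> u q z \<longleftrightarrow>
     optimal_control W Q a d0 ud \<alpha> q \<and> is_state W a d0 q u \<and> is_adjoint W a d0 ud u z"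

text \<open>Nodes \<open>x 0, \<dots>, x l\<close>; the remaining values of \<open>x\<close> are irrelevant.\<close>

definition grid :: "(nat \<Rightarrow> real) \<Rightarrow> nat \<Rightarrow> bool" where
  "grid x l \<longleftrightarrow> l > 1 \<and> x 0 = 0 \<and> x l = 1 \<and> (\<forall>i<l. x i < x (Suc i))"

definition mesh_width :: "(nat \<Rightarrow> real) \<Rightarrow> nat \<Rightarrow> real" where
  "mesh_width x l = Max ((\<lambda>i. x i - x (i - 1)) ` {1..l})"

definition Vh_space :: "(nat \<Rightarrow> real) \<Rightarrow> nat \<Rightarrow> (real \<Rightarrow> real) set" where
  "Vh_space x l = {v. continuous_on {0..1} v \<and> v 0 = 0 \<and> v 1 = 0 \<and>
     (\<forall>i\<in>{1..l}. \<exists>m c. \<forall>t\<in>{x (i - 1)<..<x i}. v t = m * t + c)}"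

definition Qh_space :: "(nat \<Rightarrow> real) \<Rightarrow> nat \<Rightarrow> (real \<Rightarrow> real) set" where
  "Qh_space x l = {q. \<forall>i\<in>{1..l}. \<exists>c. \<forall>t\<in>{x (i - 1)<..<x i}. q t = c}"

end

theory Submission
  imports Defs "HOL-Real_Asymp.Real_Asymp"
begin

text \<open>
  The error \<open>z - zh\<close> of the adjoint states is the sum of an interpolation error, which is of first
  order because \<open>z'\<close> is Lipschitz continuous (\<open>solution_regularity\<close>), and of a discrete function that
  is controlled by the interpolation error and by the distance \<open>E\<close> of the states \<open>u\<close> and \<open>uh\<close> in
  \<open>L2\<close> (\<open>adjoint_energy_error\<close>). The heart of the matter is therefore \<open>E \<le> C h\<close> (\<open>state_error\<close>).

  Let \<open>\<Pi> q\<close> be the step function of the cell averages of \<open>q\<close>. The optimality conditions of both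
  problems are variational inequalities (\<open>variational_inequality\<close>). Test the continuous one with
  \<open>qh\<close>, the discrete one with \<open>\<Pi> q\<close>, and add them. Averaging does not increase the total variation
  (\<open>deriv_TV_step_avg\<close>), so the total variations drop out and
  \<open>(qh - q, z) + (\<Pi> q - qh, zh) \<ge> 0\<close> remains. With the state and adjoint equations the left hand
  side becomes \<open>- E\<^sup>2\<close> plus three residuals, each of them bounded by \<open>C (h\<^sup>2 + h E)\<close>:
  the residual of the discrete state on the interpolation error of \<open>z\<close> is small since the derivative
  of the former is constant on each cell, while that of the latter has mean zero there
  (\<open>residual_1\<close>); the interpolation error of \<open>u\<close> is only paired with the errors of the adjoint
  equation (\<open>residual_2\<close>); and \<open>\<Pi> q - q\<close> is of order \<open>h\<close> in \<open>L1\<close> and orthogonal to step functions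
  (\<open>residual_3\<close>). From \<open>E\<^sup>2 \<le> C (h\<^sup>2 + h E)\<close> follows \<open>E \<le> C h\<close>.

  The step from the energy norm to the maximum norm of the derivative is special to one dimension
  (\<open>adjoint_derivative_sup_error\<close>). Derivatives of finite element functions are arbitrary mean-free
  step functions, so the error equation says that \<open>a (z - zh)'\<close> plus a primitive of a small right hand
  side has the same average on all cells. This common average is the integral over \<open>\<Omega>\<close>, hence
  of order \<open>h\<close> by the energy estimate, and it determines the slope of the discrete part on each cell.

  The spaces are made accessible by one-dimensional representations. Functions in \<open>H10\<close> are the
  primitives of mean-free square integrable functions (\<open>in_H10_imp_rep\<close>, \<open>H10_rep_imp_in_H10\<close>), and
  functions of bounded variation are constants plus distribution functions of their derivatives
  (\<open>is_measure_deriv_rep\<close>); both rest on the fact that test functions determine integrable functions,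
  which in turn needs a supply of smooth functions with compact support. The cost of a comparison
  control is only determined if its state exists, so the solvability of the state equation
  (\<open>state_exists\<close>, by shooting) and of its discretization (\<open>discrete_state_exists\<close>) is part of the
  proof.
\<close>

section \<open>Smooth functions and test functions\<close>

definition smooth :: "(real \<Rightarrow> real) \<Rightarrow> bool" where
  "smooth f \<longleftrightarrow> (\<forall>n x. ((deriv ^^ n) f) differentiable (at x))"

text \<open>Instead of tracking formulas for the iterated derivatives, it suffices to exhibit a class of
  functions that contains a derivative of each of its members.\<close>

lemma smooth_coinduct:
  assumes "f \<in> S" and S: "\<And>g. g \<in> S \<Longrightarrow> \<exists>g'\<in>S. \<forall>x. (g has_real_derivative g' x) (at x)"
  shows "smooth f"
proof -
  have dS: "deriv g \<in> S" if "g \<in> S" for g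
  proof -
    from S[OF that] obtain g' where g': "g' \<in> S" "\<forall>x. (g has_real_derivative g' x) (at x)" by blast
    then have "deriv g = g'" by (intro ext DERIV_imp_deriv) auto
    with g' show ?thesis by simp
  qed
  have "(deriv ^^ n) f \<in> S" for n
    by (induction n) (simp_all add: assms(1) dS)
  then show ?thesis
    unfolding smooth_def by (meson S real_differentiable_def)
qed

lemma smooth_deriv: "smooth f \<Longrightarrow> smooth (deriv f)"
  unfolding smooth_def by (metis comp_apply funpow_Suc_right)

lemma smooth_has_deriv: "smooth f \<Longrightarrow> (f has_real_derivative deriv f x) (at x)"
  unfolding smooth_def by (metis DERIV_deriv_iff_real_differentiable funpow_0)

lemma smooth_isCont: "smooth f \<Longrightarrow> isCont f x"
  using smooth_has_deriv DERIV_isCont by blast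

lemma smooth_continuous_on: "smooth f \<Longrightarrow> continuous_on A f"
  by (simp add: continuous_at_imp_continuous_on smooth_isCont)

text \<open>Differentiation maps the algebra generated by the smooth functions into itself, so
  \<open>smooth_coinduct\<close> shows that all of its members are smooth.\<close>

inductive smooth_algebra :: "(real \<Rightarrow> real) \<Rightarrow> bool" where
  base: "smooth f \<Longrightarrow> smooth_algebra f"
| add: "smooth_algebra f \<Longrightarrow> smooth_algebra g \<Longrightarrow> smooth_algebra (\<lambda>x. f x + g x)"
| mult: "smooth_algebra f \<Longrightarrow> smooth_algebra g \<Longrightarrow> smooth_algebra (\<lambda>x. f x * g x)"

lemma smooth_algebra_smooth:
  assumes "smooth_algebra f"
  shows "smooth f"
proof (rule smooth_coinduct[where S = "Collect smooth_algebra"])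
  show "\<exists>g'\<in>Collect smooth_algebra. \<forall>x. (g has_real_derivative g' x) (at x)"
    if "g \<in> Collect smooth_algebra" for g
  proof -
    from that have "smooth_algebra g" by simp
    then show ?thesis
    proof induction
      case (base f)
      then show ?case
        by (intro bexI[of _ "deriv f"])
          (auto intro: smooth_has_deriv smooth_deriv smooth_algebra.base)
    next
      case (add f g)
      then obtain f' g' where "smooth_algebra f'" "\<forall>x. (f has_real_derivative f' x) (at x)"
        "smooth_algebra g'" "\<forall>x. (g has_real_derivative g' x) (at x)" by blast
      then show ?case
        by (intro bexI[of _ "\<lambda>x. f' x + g' x"])
          (simp_all add: smooth_algebra.add DERIV_add)
    next
      case (mult f g)
      then obtain f' g' where "smooth_algebra f'" "\<forall>x. (f has_real_derivative f' x) (at x)"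
        "smooth_algebra g'" "\<forall>x. (g has_real_derivative g' x) (at x)" by blast
      with mult show ?case
        by (intro bexI[of _ "\<lambda>x. f' x * g x + f x * g' x"])
          (simp_all add: smooth_algebra.add smooth_algebra.mult, auto intro!: derivative_eq_intros)
    qed
  qed
qed (use assms in simp)

lemma smooth_add: "smooth f \<Longrightarrow> smooth g \<Longrightarrow> smooth (\<lambda>x. f x + g x)"
  by (rule smooth_algebra_smooth) (simp add: smooth_algebra.add smooth_algebra.base)

lemma smooth_mult: "smooth f \<Longrightarrow> smooth g \<Longrightarrow> smooth (\<lambda>x. f x * g x)"
  by (rule smooth_algebra_smooth) (simp add: smooth_algebra.mult smooth_algebra.base)

lemma smooth_const: "smooth (\<lambda>x. c)"
  by (rule smooth_coinduct[where S = "range (\<lambda>c x. c)"]) (auto intro!: exI[of _ "0::real"])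

lemma smooth_antiderivative:
  assumes "smooth f" "\<And>x. (F has_real_derivative f x) (at x)"
  shows "smooth F"
proof (rule smooth_coinduct[where S = "insert F (Collect smooth)"])
  show "\<exists>g'\<in>insert F (Collect smooth). \<forall>x. (g has_real_derivative g' x) (at x)"
    if "g \<in> insert F (Collect smooth)" for g
    using that
  proof
    assume "g = F"
    with assms show ?thesis by (intro bexI[of _ f]) auto
  next
    assume "g \<in> Collect smooth"
    then show ?thesis
      by (intro bexI[of _ "deriv g"]) (auto intro: smooth_has_deriv smooth_deriv)
  qed
qed simp

lemma smooth_linear: "smooth (\<lambda>x. c * x)"
  by (rule smooth_antiderivative[OF smooth_const[of c]]) (auto intro!: derivative_eq_intros)

lemma smooth_affine_comp:
  assumes "smooth f"
  shows "smooth (\<lambda>x. f (a * x + b))"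
proof (rule smooth_coinduct[where S = "{\<lambda>x. c * g (a * x + b) | c g. smooth g}"])
  show "(\<lambda>x. f (a * x + b)) \<in> {\<lambda>x. c * g (a * x + b) | c g. smooth g}"
    using assms by (intro CollectI exI[of _ 1] exI[of _ f]) auto
next
  fix h assume "h \<in> {\<lambda>x. c * g (a * x + b) | c g. smooth g}"
  then obtain c g where h: "h = (\<lambda>x. c * g (a * x + b))" and g: "smooth g" by blast
  have "(h has_real_derivative (c * a) * deriv g (a * x + b)) (at x)" for x
  proof -
    have "((\<lambda>x. g (a * x + b)) has_real_derivative deriv g (a * x + b) * a) (at x)"
      by (rule DERIV_chain2[OF smooth_has_deriv[OF g]]) (auto intro!: derivative_eq_intros)
    from DERIV_cmult[OF this, of c] show ?thesis by (simp add: h mult_ac)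
  qed
  then show "\<exists>g'\<in>{\<lambda>x. c * g (a * x + b) | c g. smooth g}. \<forall>x. (h has_real_derivative g' x) (at x)"
    using smooth_deriv[OF g] by (intro bexI[of _ "\<lambda>x. (c * a) * deriv g (a * x + b)"]) auto
qed

lemma smooth_polynomial: "real_polynomial_function p \<Longrightarrow> smooth p"
proof (induction rule: real_polynomial_function.induct)
  case (linear f)
  then obtain c where "f = (\<lambda>x. x * c)"
    using real_bounded_linear by blast
  then show ?case using smooth_linear[of c] by (simp add: mult.commute)
qed (auto intro: smooth_const smooth_add smooth_mult)

text \<open>The standard function that is smooth on the whole line and flat on \<open>x \<le> 0\<close>; it tends to
  \<open>1\<close> at infinity, so that rescaled copies of it approximate the indicator of a half line.\<close>

definition flat_exp :: "real \<Rightarrow> real" where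
  "flat_exp x = (if x > 0 then exp (- inverse x) else 0)"

text \<open>All derivatives have the form \<open>P(1/x) exp(-1/x)\<close> with a polynomial \<open>P\<close>, and the
  exponential beats every such factor at the origin.\<close>

lemma smooth_flat_exp: "smooth flat_exp"
proof -
  let ?S = "{\<lambda>x. if x > 0 then poly P (inverse x) * exp (- inverse x) else 0 | P :: real poly. True}"
  have lim: "((\<lambda>y. poly P y * exp (- y)) \<longlongrightarrow> 0) at_top" for P :: "real poly"
  proof -
    have "((\<lambda>y. \<Sum>i\<le>degree P. coeff P i * (y ^ i / exp y)) \<longlongrightarrow> (\<Sum>i\<le>degree P. coeff P i * 0)) at_top"
      by (intro tendsto_intros tendsto_power_div_exp_0)
    then show ?thesis
      by (simp add: poly_altdef sum_distrib_left exp_minus divide_inverse mult_ac)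
  qed
  have *: "((\<lambda>x. if x > 0 then poly P (inverse x) * exp (- inverse x) else 0) has_real_derivative
      (if x > 0 then poly ([:0,0,1:] * (P - pderiv P)) (inverse x) * exp (- inverse x) else 0)) (at x)"
      (is "(?f has_real_derivative ?f' x) (at x)") for P :: "real poly" and x
  proof -
    consider "x > 0" | "x < 0" | "x = 0" by linarith
    then show ?thesis
    proof cases
      assume x: "x > 0"
      have "((\<lambda>x. poly P (inverse x) * exp (- inverse x)) has_real_derivative
          (poly (pderiv P) (inverse x) * (- (inverse x * 1 * inverse x))) * exp (- inverse x)
          + exp (- inverse x) * (inverse x * 1 * inverse x) * poly P (inverse x)) (at x)"
        using x by (auto intro!: derivative_eq_intros DERIV_chain2[OF poly_DERIV])
      then have "((\<lambda>x. poly P (inverse x) * exp (- inverse x)) has_real_derivative ?f' x) (at x)"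
        using x by (simp add: algebra_simps)
      then show ?thesis
        by (rule has_field_derivative_transform_within_open[of _ _ _ "{0<..}"]) (use x in auto)
    next
      assume x: "x < 0"
      have "((\<lambda>x. 0) has_real_derivative ?f' x) (at x)" using x by simp
      then show ?thesis
        by (rule has_field_derivative_transform_within_open[of _ _ _ "{..<0}"]) (use x in auto)
    next
      assume x: "x = 0"
      have r: "((\<lambda>h. inverse h * poly P (inverse h) * exp (- inverse h)) \<longlongrightarrow> 0) (at_right 0)"
        using filterlim_compose[OF lim[of "[:0,1:] * P"] filterlim_inverse_at_top_right] by simp
      have "((\<lambda>h. (?f (0 + h) - ?f 0) / h) \<longlongrightarrow> 0) (at_right 0)"
        by (rule Lim_transform_eventually[OF r])
          (auto simp: eventually_at_filter divide_inverse mult_ac)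
      moreover have "((\<lambda>h. (?f (0 + h) - ?f 0) / h) \<longlongrightarrow> 0) (at_left 0)"
        by (rule tendsto_eventually) (auto simp: eventually_at_filter)
      ultimately have "((\<lambda>h. (?f (0 + h) - ?f 0) / h) \<longlongrightarrow> 0) (at 0)"
        by (simp add: filterlim_split_at)
      then show ?thesis using x by (simp add: DERIV_def)
    qed
  qed
  show ?thesis
  proof (rule smooth_coinduct[where S = ?S])
    show "flat_exp \<in> ?S"
      by (intro CollectI exI[of _ "[:1:]"]) (auto simp: flat_exp_def fun_eq_iff)
  next
    fix g assume "g \<in> ?S"
    then obtain P where "g = (\<lambda>x. if x > 0 then poly P (inverse x) * exp (- inverse x) else 0)"
      by blast
    then show "\<exists>g'\<in>?S. \<forall>x. (g has_real_derivative g' x) (at x)"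
      using *[of P]
      by (intro bexI[of _ "\<lambda>x. if x > 0 then poly ([:0,0,1:] * (P - pderiv P)) (inverse x) * exp (- inverse x) else 0"])
        blast+
  qed
qed

lemma flat_exp_bounds: "0 \<le> flat_exp x" "flat_exp x \<le> 1" "x > 0 \<Longrightarrow> 0 < flat_exp x"
  by (auto simp: flat_exp_def)

lemma flat_exp_tendsto_1: "(flat_exp \<longlongrightarrow> 1) at_top"
proof -
  have "((\<lambda>x::real. exp (- inverse x)) \<longlongrightarrow> exp (- 0)) at_top"
    by (intro tendsto_intros tendsto_inverse_0_at_top filterlim_ident)
  then show ?thesis
    by (simp add: Lim_transform_eventually[OF _ eventually_mono[OF eventually_gt_at_top[of 0]]]
        flat_exp_def)
qed

text \<open>One factor switches on behind the left end point of \<open>\<Omega>\<close>, the other one switches off before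
  the right end point; rescaling moves both transitions to the boundary as \<open>n\<close> grows.\<close>

definition cutoff :: "nat \<Rightarrow> real \<Rightarrow> real" where
  "cutoff n x = flat_exp (real (Suc n) * x + (- 1)) * flat_exp (- real (Suc n) * x + real n)"

lemma smooth_cutoff: "smooth (cutoff n)"
  unfolding cutoff_def by (intro smooth_mult smooth_affine_comp smooth_flat_exp)

lemma cutoff_bounds: "0 \<le> cutoff n x" "cutoff n x \<le> 1"
  unfolding cutoff_def by (auto intro!: mult_nonneg_nonneg mult_le_one flat_exp_bounds)

lemma cutoff_eq_0: "x \<notin> {1 / Suc n .. 1 - 1 / Suc n} \<Longrightarrow> cutoff n x = 0"
proof -
  assume "x \<notin> {1 / Suc n .. 1 - 1 / Suc n}"
  then have "real (Suc n) * x < 1 \<or> real n < real (Suc n) * x"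
    by (auto simp: divide_simps algebra_simps not_le)
  then have "real (Suc n) * x + (- 1) \<le> 0 \<or> - real (Suc n) * x + real n \<le> 0"
    by linarith
  then show ?thesis by (auto simp: cutoff_def flat_exp_def)
qed

lemma cutoff_tendsto_1:
  assumes "x \<in> Omega"
  shows "(\<lambda>n. cutoff n x) \<longlonglongrightarrow> 1"
proof -
  have "filterlim (\<lambda>n. real (Suc n) * x + (- 1)) at_top sequentially"
    "filterlim (\<lambda>n. - real (Suc n) * x + real n) at_top sequentially"
    using assms by real_asymp+
  from this[THEN filterlim_compose[OF flat_exp_tendsto_1]] show ?thesis
    unfolding cutoff_def using tendsto_mult by fastforce
qed

lemma cutoff_pos:
  assumes "1 / Suc n < x" "x < 1 - 1 / Suc n"
  shows "0 < cutoff n x"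
proof -
  have "real (Suc n) * x + (- 1) > 0" "- real (Suc n) * x + real n > 0"
    using assms by (auto simp: field_simps)
  then show ?thesis unfolding cutoff_def by (intro mult_pos_pos flat_exp_bounds)
qed

lemma test_functionI:
  assumes "smooth \<phi>" "compact K" "K \<subseteq> Omega" "\<And>x. x \<notin> K \<Longrightarrow> \<phi> x = 0"
  shows "test_function \<phi>"
  using assms unfolding test_function_def smooth_def by blast

lemma test_smooth: "test_function \<phi> \<Longrightarrow> smooth \<phi>"
  unfolding test_function_def smooth_def by blast

lemma test_support:
  assumes "test_function \<phi>"
  obtains s t where "0 < s" "s \<le> t" "t < 1" "\<forall>x. x \<notin> {s..t} \<longrightarrow> \<phi> x = 0"
proof -
  from assms obtain K where K: "compact K" "K \<subseteq> Omega" "\<forall>x. x \<notin> K \<longrightarrow> \<phi> x = 0"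
    unfolding test_function_def by blast
  show ?thesis
  proof (cases "K = {}")
    case True
    then show ?thesis using K that[of "1/2" "1/2"] by auto
  next
    case False
    obtain s where s: "s \<in> K" "\<forall>x\<in>K. s \<le> x" using compact_attains_inf[OF K(1) False] by blast
    obtain t where t: "t \<in> K" "\<forall>x\<in>K. x \<le> t" using compact_attains_sup[OF K(1) False] by blast
    show ?thesis
      by (rule that[of s t]) (use s t K in auto)
  qed
qed

lemma test_functionI_interval:
  assumes "smooth \<phi>" "0 < s" "t < 1" "\<And>x. x \<notin> {s..t} \<Longrightarrow> \<phi> x = 0"
  shows "test_function \<phi>"
  by (rule test_functionI[OF assms(1), of "{s..t}"]) (use assms in auto)

lemma test_deriv:
  assumes "test_function \<phi>"
  shows "test_function (deriv \<phi>)"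
proof -
  obtain s t where st: "0 < s" "s \<le> t" "t < 1"
    and 0: "\<forall>x. x \<notin> {s..t} \<longrightarrow> \<phi> x = 0"
    using test_support[OF assms] by blast
  have "deriv \<phi> x = 0" if "x \<notin> {s..t}" for x
  proof -
    have "((\<lambda>x. 0) has_real_derivative deriv \<phi> x) (at x)"
    proof (rule has_field_derivative_transform_within_open)
      show "(\<phi> has_real_derivative deriv \<phi> x) (at x)"
        by (rule smooth_has_deriv[OF test_smooth[OF assms]])
      show "open (- {s..t})" by (simp add: open_Compl)
    qed (use that 0 in blast)+
    then show ?thesis using DERIV_unique DERIV_const by blast
  qed
  then show ?thesis
    by (intro test_functionI_interval[OF smooth_deriv[OF test_smooth[OF assms]] st(1,3)])
qed

lemma test_mult:
  assumes "test_function \<phi>" "smooth f"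
  shows "test_function (\<lambda>x. f x * \<phi> x)"
proof -
  obtain s t where "0 < s" "s \<le> t" "t < 1"
    "\<forall>x. x \<notin> {s..t} \<longrightarrow> \<phi> x = 0"
    using test_support[OF assms(1)] by blast
  then show ?thesis
    by (intro test_functionI_interval[OF smooth_mult[OF assms(2) test_smooth[OF assms(1)]], of s t])
      auto
qed

lemma test_add:
  assumes "test_function \<phi>" "test_function \<psi>"
  shows "test_function (\<lambda>x. \<phi> x + \<psi> x)"
proof -
  obtain s t where st: "0 < s" "s \<le> t" "t < 1"
    "\<forall>x. x \<notin> {s..t} \<longrightarrow> \<phi> x = 0"
    using test_support[OF assms(1)] by blast
  obtain s' t' where st': "0 < s'" "s' \<le> t'" "t' < 1"
    "\<forall>x. x \<notin> {s'..t'} \<longrightarrow> \<psi> x = 0"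
    using test_support[OF assms(2)] by blast
  show ?thesis
    by (rule test_functionI_interval[OF smooth_add[OF assms[THEN test_smooth]],
          of "min s s'" "max t t'"])
      (use st st' in \<open>auto simp: min_def max_def split: if_splits\<close>)
qed

lemma test_cmult: "test_function \<phi> \<Longrightarrow> test_function (\<lambda>x. c * \<phi> x)"
  using test_mult[OF _ smooth_const] .

lemma test_minus:
  "test_function \<phi> \<Longrightarrow> test_function \<psi> \<Longrightarrow> test_function (\<lambda>x. \<phi> x - \<psi> x)"
  using test_add[OF _ test_cmult[of \<psi> "-1"]] by simp

lemma test_cutoff: "test_function (cutoff n)"
  by (rule test_functionI_interval[OF smooth_cutoff _ _ cutoff_eq_0]) auto

lemma smooth_borel: "smooth f \<Longrightarrow> f \<in> borel_measurable borel"
  by (intro borel_measurable_continuous_onI smooth_continuous_on)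

lemma test_bounded:
  assumes "test_function \<phi>"
  shows "\<exists>B. \<forall>x. \<bar>\<phi> x\<bar> \<le> B"
proof -
  obtain s t where st: "0 < s" "s \<le> t" "t < 1"
    "\<forall>x. x \<notin> {s..t} \<longrightarrow> \<phi> x = 0"
    using test_support[OF assms] by blast
  have "bounded (\<phi> ` {s..t})"
    by (intro compact_imp_bounded compact_continuous_image
        smooth_continuous_on[OF test_smooth[OF assms]]) auto
  then obtain B where B: "\<forall>x\<in>{s..t}. \<bar>\<phi> x\<bar> \<le> B"
    by (auto simp: bounded_iff)
  have "\<bar>\<phi> x\<bar> \<le> max B 0" for x
  proof (cases "x \<in> {s..t}")
    case True
    then show ?thesis using B by fastforce
  next
    case False
    then show ?thesis using st(4) by simp
  qed
  then show ?thesis by blast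
qed

section \<open>Integration on the unit interval\<close>

lemma finite_measure_Om: "finite_measure Om"
  by (rule finite_measure_lebesgue_on) auto

interpretation Om: finite_measure Om
  by (rule finite_measure_Om)

lemma measure_Om [simp]: "measure Om Omega = 1"
  by (simp add: measure_restrict_space)

lemma emeasure_Om: "emeasure Om Omega = 1"
  by (simp add: Om.emeasure_eq_measure)

lemma not_bot_Om: "\<not> (AE x in Om. False)"
proof
  assume "AE x in Om. False"
  then have "Omega \<in> null_sets Om" by (subst AE_iff_null_sets) auto
  then show False using emeasure_Om by (simp add: null_setsD1)
qed

lemma ident_Om: "(\<lambda>x. x) \<in> borel_measurable Om"
  using id_borel_measurable_lebesgue_on[of Omega] by (simp add: id_def)

lemma borel_Om: "f \<in> borel_measurable borel \<Longrightarrow> f \<in> borel_measurable Om"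
  for f :: "real \<Rightarrow> real"
  by (rule measurable_compose[OF ident_Om])

lemma integrable_const_bound_Om:
  fixes f :: "real \<Rightarrow> real"
  shows "f \<in> borel_measurable Om \<Longrightarrow> AE x in Om. \<bar>f x\<bar> \<le> B \<Longrightarrow> integrable Om f"
  by (rule Om.integrable_const_bound[of _ B]) simp_all

lemma AE_Om_ex:
  assumes "AE x in Om. P x"
  shows "\<exists>x\<in>Omega. P x"
proof (rule ccontr)
  assume "\<not> ?thesis"
  then have "AE x in Om. \<not> P x" by (intro AE_I2) simp
  with assms have "AE x in Om. False" by eventually_elim simp
  then show False using not_bot_Om by simp
qed

lemma AE_Om_not_singleton: "AE x in Om. x \<noteq> c"
proof -
  have "AE x in lebesgue. x \<noteq> c"
    using AE_lborel_singleton by (rule AE_completion)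
  then have "AE x in lebesgue. x \<in> Omega \<longrightarrow> x \<noteq> c" by eventually_elim simp
  then show ?thesis by (subst AE_restrict_space_iff) simp_all
qed

lemma AE_Om_not_finite: "finite S \<Longrightarrow> AE x in Om. x \<notin> S"
proof (induction rule: finite_induct)
  case (insert y S)
  from insert.IH AE_Om_not_singleton[of y] show ?case by eventually_elim simp
qed simp

lemma integrable_mult_bounded:
  fixes f g :: "real \<Rightarrow> real"
  assumes "integrable M f" "g \<in> borel_measurable M" "AE x in M. \<bar>g x\<bar> \<le> B"
  shows "integrable M (\<lambda>x. f x * g x)"
proof (rule Bochner_Integration.integrable_bound)
  show "integrable M (\<lambda>x. B * f x)" using assms by simp
  show "AE x in M. norm (f x * g x) \<le> norm (B * f x)"
    using assms(3)
  proof eventually_elim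
    case (elim x)
    then have "\<bar>f x\<bar> * \<bar>g x\<bar> \<le> \<bar>f x\<bar> * \<bar>B\<bar>" by (intro mult_left_mono) auto
    then show ?case by (simp add: abs_mult mult.commute)
  qed
qed (use assms in measurable)

lemma integral_mult_bound:
  fixes f g :: "real \<Rightarrow> real"
  assumes "integrable M f" "g \<in> borel_measurable M" "AE x in M. \<bar>g x\<bar> \<le> B"
  shows "\<bar>\<integral>x. f x * g x \<partial>M\<bar> \<le> B * (\<integral>x. \<bar>f x\<bar> \<partial>M)"
proof -
  have "\<bar>\<integral>x. f x * g x \<partial>M\<bar> \<le> (\<integral>x. \<bar>f x * g x\<bar> \<partial>M)" by simp
  also have "\<dots> \<le> (\<integral>x. B * \<bar>f x\<bar> \<partial>M)"
  proof (rule integral_mono_AE)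
    show "AE x in M. \<bar>f x * g x\<bar> \<le> B * \<bar>f x\<bar>"
      using assms(3)
    proof eventually_elim
      case (elim x)
      then have "\<bar>f x\<bar> * \<bar>g x\<bar> \<le> \<bar>f x\<bar> * B" by (intro mult_left_mono) auto
      then show ?case by (simp add: abs_mult mult.commute)
    qed
  qed (use assms integrable_mult_bounded[OF assms] in auto)
  finally show ?thesis by simp
qed

text \<open>The primitive that vanishes at \<open>0\<close>, continued by constants outside of \<open>[0,1]\<close>.\<close>

definition prim :: "(real \<Rightarrow> real) \<Rightarrow> real \<Rightarrow> real" where
  "prim g x = (\<integral>t. indicat_real {..x} t * g t \<partial>Om)"

lemma indicator_Iic_measurable [measurable]: "indicat_real {..x} \<in> borel_measurable Om"
  by (rule borel_Om) simp

lemma integrable_indicator_mult: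
  "integrable Om g \<Longrightarrow> integrable Om (\<lambda>t. indicat_real {..x} t * g t)"
  using integrable_mult_bounded[of Om g "indicat_real {..x}" 1]
  by (simp add: mult.commute indicator_def)

lemma prim_measurable [measurable]:
  assumes [measurable]: "g \<in> borel_measurable Om"
  shows "prim g \<in> borel_measurable Om" "prim g \<in> borel_measurable borel"
proof -
  have 1: "(\<lambda>(x, t). indicat_real {..x} t) \<in> borel_measurable (borel \<Otimes>\<^sub>M Om)"
  proof -
    have eq: "(\<lambda>(x, t). indicat_real {..x} t) = (\<lambda>p. if snd p \<le> fst p then 1 else 0)"
      by (auto simp: indicator_def fun_eq_iff)
    have [measurable]: "snd \<in> borel_measurable (borel \<Otimes>\<^sub>M Om)"
      by (rule measurable_compose[OF measurable_snd ident_Om])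
    show ?thesis unfolding eq by measurable
  qed
  have "(\<lambda>(x, t). indicat_real {..x} t * g t) \<in> borel_measurable (borel \<Otimes>\<^sub>M Om)"
    using 1 by (simp add: split_beta')
  then show "prim g \<in> borel_measurable borel"
    unfolding prim_def[abs_def] by (rule Om.borel_measurable_lebesgue_integral)
  then show "prim g \<in> borel_measurable Om" by (rule borel_Om)
qed

lemma prim_bound:
  assumes "integrable Om g"
  shows "\<bar>prim g x\<bar> \<le> (\<integral>t. \<bar>g t\<bar> \<partial>Om)"
proof -
  have "\<bar>\<integral>t. g t * indicat_real {..x} t \<partial>Om\<bar> \<le> 1 * (\<integral>t. \<bar>g t\<bar> \<partial>Om)"
    by (rule integral_mult_bound[OF assms indicator_Iic_measurable]) (simp add: indicator_def)
  then show ?thesis by (simp add: prim_def mult.commute)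
qed

lemma prim_nonpos: "x \<le> 0 \<Longrightarrow> prim g x = 0"
  unfolding prim_def
  by (rule trans[OF Bochner_Integration.integral_cong[of _ _ _ "\<lambda>_. 0"]]) auto

lemma prim_ge_1: "1 \<le> x \<Longrightarrow> prim g x = (\<integral>t. g t \<partial>Om)"
  unfolding prim_def by (intro Bochner_Integration.integral_cong) auto

lemma prim_diff:
  assumes "integrable Om g" "x \<le> y"
  shows "prim g y - prim g x = (\<integral>t. indicat_real {x<..y} t * g t \<partial>Om)"
proof -
  have "(\<lambda>t. indicat_real {x<..y} t * g t) = (\<lambda>t. indicat_real {..y} t * g t - indicat_real {..x} t * g t)"
    using assms(2) by (auto simp: indicator_def fun_eq_iff)
  then show ?thesis
    unfolding prim_def using assms(1) by (simp add: integrable_indicator_mult)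
qed

lemma prim_cong_AE:
  assumes "AE t in Om. f t = g t" "f \<in> borel_measurable Om" "g \<in> borel_measurable Om"
  shows "prim f x = prim g x"
  unfolding prim_def by (rule integral_cong_AE) (use assms in auto)

lemma prim_add:
  "integrable Om f \<Longrightarrow> integrable Om g \<Longrightarrow> prim (\<lambda>t. f t + g t) x = prim f x + prim g x"
  unfolding prim_def by (simp add: distrib_left integrable_indicator_mult)

lemma prim_minus:
  "integrable Om f \<Longrightarrow> integrable Om g \<Longrightarrow> prim (\<lambda>t. f t - g t) x = prim f x - prim g x"
  unfolding prim_def by (simp add: right_diff_distrib integrable_indicator_mult)

lemma prim_cmult: "prim (\<lambda>t. c * f t) x = c * prim f x"
  unfolding prim_def
  by (subst integral_mult_right_zero[symmetric]) (simp add: mult_ac)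

lemma integral_Ioc_Om:
  assumes "0 \<le> x" "x \<le> y" "y \<le> 1"
  shows "(\<integral>t. indicat_real {x<..y} t \<partial>Om) = y - x"
proof -
  have s: "{x<..y} \<inter> Omega \<in> sets lebesgue" by simp
  have f: "{x<..y} \<inter> Omega \<in> lmeasurable"
    by (rule bounded_set_imp_lmeasurable[OF _ s]) (auto intro: bounded_subset[of "{0<..<1}"])
  have "{x<..<y} \<subseteq> {x<..y} \<inter> Omega" "{x<..y} \<inter> Omega \<subseteq> {x..y}" using assms by auto
  then have "measure lebesgue {x<..<y} \<le> measure lebesgue ({x<..y} \<inter> Omega)"
    "measure lebesgue ({x<..y} \<inter> Omega) \<le> measure lebesgue {x..y}"
    by (intro measure_mono_fmeasurable f; simp)+
  moreover have "measure lebesgue {x<..<y} = y - x" "measure lebesgue {x..y} = y - x"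
    using assms(2) by simp_all
  ultimately have "measure lebesgue ({x<..y} \<inter> Omega) = y - x" by linarith
  then show ?thesis using s
    by (simp add: measure_restrict_space Int_commute sets_restrict_space_iff)
qed

lemma indicator_Ioc_measurable [measurable]: "indicat_real {x<..y} \<in> borel_measurable Om"
  by (rule borel_Om) simp

lemma prim_Lipschitz:
  assumes "integrable Om g" "AE t in Om. \<bar>g t\<bar> \<le> B" "0 \<le> x" "x \<le> y" "y \<le> 1"
  shows "\<bar>prim g y - prim g x\<bar> \<le> B * (y - x)"
proof -
  have "integrable Om (indicat_real {x<..y})"
    by (rule integrable_const_bound_Om[of _ 1]) (auto simp: indicator_def)
  from integral_mult_bound[OF this borel_measurable_integrable[OF assms(1)] assms(2)]
  have "\<bar>prim g y - prim g x\<bar> \<le> B * (\<integral>t. \<bar>indicat_real {x<..y} t\<bar> \<partial>Om)"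
    by (simp add: prim_diff assms)
  then show ?thesis using integral_Ioc_Om[OF assms(3-5)] by simp
qed

lemma prim_fundamental:
  assumes x: "0 \<le> x" "x \<le> 1" and F: "continuous_on {0..x} F" and "finite S"
    and d: "\<And>t. t \<in> {0<..<x} - S \<Longrightarrow> (F has_real_derivative g t) (at t)" and g: "integrable Om g"
  shows "prim g x = F x - F 0"
proof -
  have "(g has_integral (F x - F 0)) {0..x}"
    by (rule fundamental_theorem_of_calculus_interior_strong[OF \<open>finite S\<close> x(1) _ F])
      (use d in \<open>simp add: has_real_derivative_iff_has_vector_derivative\<close>)
  then have 1: "integral {0..x} g = F x - F 0" by blast
  have i: "set_integrable lebesgue ({..x} \<inter> Omega) g"
  proof -
    have "set_integrable lebesgue Omega g"
      using g by (simp add: set_integrable_def integrable_restrict_space)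
    then show ?thesis by (rule set_integrable_subset) auto
  qed
  have "prim g x = (\<integral>t. indicator Omega t *\<^sub>R (indicat_real {..x} t * g t) \<partial>lebesgue)"
    unfolding prim_def by (subst integral_restrict_space) auto
  also have "\<dots> = (LINT t:{..x} \<inter> Omega|lebesgue. g t)"
    unfolding set_lebesgue_integral_def
    by (intro Bochner_Integration.integral_cong) (auto simp: indicator_def)
  also have "\<dots> = integral ({..x} \<inter> Omega) g"
    by (rule set_lebesgue_integral_eq_integral(2)[OF i])
  also have "\<dots> = integral {0..x} g"
  proof (rule integral_subset_negligible)
    show "negligible ({0..x} - {..x} \<inter> Omega)"
      by (rule negligible_subset[of "{0, 1}"]) (use x in auto)
  qed auto
  finally show ?thesis using 1 by simp
qed

text \<open>Changing the order of integration over the triangle \<open>t \<le> x\<close>. With \<open>N\<close> the Lebesgue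
  measure this is integration by parts; with \<open>N\<close> a finite measure it relates the integral of a test function
  to the distribution function of \<open>N\<close>.\<close>

lemma Fubini_triangle:
  fixes f g :: "real \<Rightarrow> real"
  assumes N: "finite_measure N" "(\<lambda>x. x) \<in> borel_measurable N"
    and f: "integrable N f" and g: "integrable Om g"
  shows "(\<integral>x. f x * prim g x \<partial>N) = (\<integral>t. g t * (\<integral>x. f x * indicat_real {t..} x \<partial>N) \<partial>Om)"
proof -
  interpret N: finite_measure N by fact
  interpret pair_sigma_finite N Om by unfold_locales
  note [measurable] = borel_measurable_integrable[OF f] borel_measurable_integrable[OF g]
  have 1: "(\<lambda>(x, t). indicat_real {..x} t) \<in> borel_measurable (N \<Otimes>\<^sub>M Om)"
  proof -
    have eq: "(\<lambda>(x, t). indicat_real {..x} t) = (\<lambda>p. if snd p \<le> fst p then 1 else 0)"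
      by (auto simp: indicator_def fun_eq_iff)
    have [measurable]: "snd \<in> borel_measurable (N \<Otimes>\<^sub>M Om)"
      "fst \<in> borel_measurable (N \<Otimes>\<^sub>M Om)"
      by (rule measurable_compose[OF measurable_snd ident_Om]
          measurable_compose[OF measurable_fst N(2)])+
    show ?thesis unfolding eq by measurable
  qed
  then have m: "(\<lambda>(x, t). f x * (indicat_real {..x} t * g t)) \<in> borel_measurable (N \<Otimes>\<^sub>M Om)"
    by (simp add: split_beta')
  have int: "integrable (N \<Otimes>\<^sub>M Om) (\<lambda>(x, t). f x * (indicat_real {..x} t * g t))"
  proof (rule Fubini_integrable[OF m])
    have "(\<lambda>(x, t). indicat_real {..x} t * \<bar>g t\<bar>) \<in> borel_measurable (N \<Otimes>\<^sub>M Om)"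
      using 1 by (simp add: split_beta')
    then have m2: "(\<lambda>x. prim (\<lambda>t. \<bar>g t\<bar>) x) \<in> borel_measurable N"
      unfolding prim_def[abs_def] by (rule Om.borel_measurable_lebesgue_integral)
    have "integrable N (\<lambda>x. \<bar>f x\<bar> * prim (\<lambda>t. \<bar>g t\<bar>) x)"
      by (rule integrable_mult_bounded[OF integrable_abs[OF f] m2
            AE_I2[OF prim_bound[OF integrable_abs[OF g]]]])
    then show "integrable N (\<lambda>x. \<integral>t. norm ((\<lambda>(x, t). f x * (indicat_real {..x} t * g t)) (x, t)) \<partial>Om)"
      by (simp add: abs_mult prim_def)
    show "AE x in N. integrable Om (\<lambda>t. (\<lambda>(x, t). f x * (indicat_real {..x} t * g t)) (x, t))"
      using integrable_indicator_mult[OF g] by simp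
  qed
  have "(\<integral>x. f x * prim g x \<partial>N) = (\<integral>x. (\<integral>t. f x * (indicat_real {..x} t * g t) \<partial>Om) \<partial>N)"
    by (simp add: prim_def)
  also have "\<dots> = (\<integral>t. (\<integral>x. f x * (indicat_real {..x} t * g t) \<partial>N) \<partial>Om)"
    using Fubini_integral[OF int] by simp
  also have "\<dots> = (\<integral>t. g t * (\<integral>x. f x * indicat_real {t..} x \<partial>N) \<partial>Om)"
  proof -
    have "(\<lambda>x. f x * (indicat_real {..x} t * g t)) = (\<lambda>x. g t * (f x * indicat_real {t..} x))" for t
      by (auto simp: indicator_def fun_eq_iff)
    then show ?thesis by (simp only: integral_mult_right_zero)
  qed
  finally show ?thesis .
qed

lemma prim_by_parts:
  assumes f: "integrable Om f" and g: "integrable Om g"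
  shows "(\<integral>x. f x * prim g x \<partial>Om) = (\<integral>x. f x \<partial>Om) * (\<integral>x. g x \<partial>Om) - (\<integral>x. g x * prim f x \<partial>Om)"
proof -
  note [measurable] = borel_measurable_integrable[OF f] borel_measurable_integrable[OF g]
  have "(\<integral>x. f x * indicat_real {t..} x \<partial>Om) = (\<integral>x. f x \<partial>Om) - prim f t" for t
  proof -
    have "(\<integral>x. f x * indicat_real {t..} x \<partial>Om) = (\<integral>x. f x - indicat_real {..t} x * f x \<partial>Om)"
    proof (rule integral_cong_AE)
      show "AE x in Om. f x * indicat_real {t..} x = f x - indicat_real {..t} x * f x"
        using AE_Om_not_singleton[of t] by eventually_elim (auto simp: indicator_def)
      have [measurable]: "indicat_real {t..} \<in> borel_measurable Om" by (rule borel_Om) simp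
      show "(\<lambda>x. f x * indicat_real {t..} x) \<in> borel_measurable Om" by measurable
    qed measurable
    then show ?thesis using f by (simp add: prim_def integrable_indicator_mult)
  qed
  then have "(\<integral>x. f x * prim g x \<partial>Om) = (\<integral>t. g t * (\<integral>x. f x \<partial>Om) - g t * prim f t \<partial>Om)"
    unfolding Fubini_triangle[OF finite_measure_Om ident_Om f g] by (simp only: right_diff_distrib)
  also have "\<dots> = (\<integral>x. f x \<partial>Om) * (\<integral>x. g x \<partial>Om) - (\<integral>x. g x * prim f x \<partial>Om)"
    using g integrable_mult_bounded[OF g prim_measurable(1) AE_I2[OF prim_bound[OF f]]]
    by simp
  finally show ?thesis .
qed

section \<open>Test functions determine integrable functions\<close>

lemma test_borel_Om: "test_function \<phi> \<Longrightarrow> \<phi> \<in> borel_measurable Om"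
  by (intro borel_Om smooth_borel test_smooth)

lemma test_integrable: "test_function \<phi> \<Longrightarrow> integrable Om \<phi>"
  using integrable_const_bound_Om[OF test_borel_Om] test_bounded by fast

lemma integrable_mult_test:
  assumes "integrable Om f" "test_function \<phi>"
  shows "integrable Om (\<lambda>x. f x * \<phi> x)"
proof -
  obtain B where B: "\<bar>\<phi> x\<bar> \<le> B" for x using test_bounded[OF assms(2)] by blast
  show ?thesis
    by (rule integrable_mult_bounded[OF assms(1) test_borel_Om[OF assms(2)] AE_I2[OF B]])
qed

lemma test_zero_left:
  assumes "test_function \<phi>" "x \<le> 0 \<or> 1 \<le> x"
  shows "\<phi> x = 0"
proof -
  obtain s t where "0 < s" "s \<le> t" "t < 1" "\<forall>x. x \<notin> {s..t} \<longrightarrow> \<phi> x = 0"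
    using test_support[OF assms(1)] by blast
  then show ?thesis using assms(2) by auto
qed

lemma test_eq_prim:
  assumes "test_function \<phi>" "x \<le> 1"
  shows "\<phi> x = prim (deriv \<phi>) x"
proof (cases "0 \<le> x")
  case True
  have "prim (deriv \<phi>) x = \<phi> x - \<phi> 0"
    by (rule prim_fundamental[of _ _ "{}"])
      (use True assms test_integrable[OF test_deriv[OF assms(1)]]
        smooth_continuous_on[OF test_smooth[OF assms(1)]]
        smooth_has_deriv[OF test_smooth[OF assms(1)]] in simp_all)
  then show ?thesis using test_zero_left[OF assms(1), of 0] by simp
next
  case False
  then show ?thesis using test_zero_left[OF assms(1), of x] by (simp add: prim_nonpos)
qed

lemma integral_deriv_test: "test_function \<phi> \<Longrightarrow> (\<integral>x. deriv \<phi> x \<partial>Om) = 0"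
  using test_eq_prim[of \<phi> 1] test_zero_left[of \<phi> 1] prim_ge_1[of 1 "deriv \<phi>"] by simp

text \<open>The primitive that vanishes to the left of the support equals the total integral, which is zero,
  to the right of it.\<close>

lemma test_antideriv:
  assumes "test_function \<psi>" "(\<integral>x. \<psi> x \<partial>Om) = 0"
  obtains \<phi> where "test_function \<phi>" "deriv \<phi> = \<psi>"
proof -
  have "\<exists>F. \<forall>x::real. -\<infinity> < ereal x \<longrightarrow> ereal x < \<infinity> \<longrightarrow> (F has_vector_derivative \<psi> x) (at x)"
    by (rule einterval_antiderivative) (simp_all add: smooth_isCont[OF test_smooth[OF assms(1)]])
  then obtain F where F: "\<And>x. (F has_real_derivative \<psi> x) (at x)"
    by (auto simp: has_real_derivative_iff_has_vector_derivative)
  define \<phi> where "\<phi> x = F x - F 0" for x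
  have d: "(\<phi> has_real_derivative \<psi> x) (at x)" for x
    unfolding \<phi>_def using DERIV_diff[OF F DERIV_const] by simp
  obtain s t where st: "0 < s" "s \<le> t" "t < 1" "\<forall>x. x \<notin> {s..t} \<longrightarrow> \<psi> x = 0"
    using test_support[OF assms(1)] by blast
  have "\<phi> 1 - \<phi> 0 = prim \<psi> 1"
  proof (rule prim_fundamental[of _ _ "{}", symmetric])
    show "continuous_on {0..1} \<phi>"
      using DERIV_isCont[OF d] by (simp add: continuous_at_imp_continuous_on)
  qed (use d test_integrable[OF assms(1)] in simp_all)
  then have 1: "\<phi> 1 = 0" "\<phi> 0 = 0" using assms(2) by (simp_all add: prim_ge_1 \<phi>_def)
  have left: "\<phi> x = 0" if "x < s" for x
  proof -
    have "\<phi> x = \<phi> 0"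
    proof (rule has_field_derivative_zero_constant[of "{..<s}" \<phi>, THEN exE])
      show "(\<phi> has_real_derivative 0) (at y within {..<s})" if "y \<in> {..<s}" for y
        using d[of y] st(4) that by (auto intro: has_field_derivative_at_within)
    qed (use that st in auto)
    then show ?thesis using 1 by simp
  qed
  have right: "\<phi> x = 0" if "t < x" for x
  proof -
    have "\<phi> x = \<phi> 1"
    proof (rule has_field_derivative_zero_constant[of "{t<..}" \<phi>, THEN exE])
      show "(\<phi> has_real_derivative 0) (at y within {t<..})" if "y \<in> {t<..}" for y
        using d[of y] st(4) that by (auto intro: has_field_derivative_at_within)
    qed (use that st in auto)
    then show ?thesis using 1 by simp
  qed
  have "test_function \<phi>"
    by (rule test_functionI_interval[OF smooth_antiderivative[OF test_smooth[OF assms(1)] d] st(1,3)])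
      (use left right in force)
  moreover have "deriv \<phi> = \<psi>" using DERIV_imp_deriv[OF d] by auto
  ultimately show ?thesis by (rule that)
qed

text \<open>Measurable functions are limits almost everywhere of continuous functions, these are uniform
  limits of polynomials on \<open>[0,1]\<close>, and the cutoffs make polynomials into test functions.
  Truncation keeps the approximation bounded, so dominated convergence applies.\<close>

lemma bounded_approx_test:
  assumes "b \<in> borel_measurable Om" and B: "\<And>x. x \<in> Omega \<Longrightarrow> \<bar>b x\<bar> \<le> B"
  shows "\<exists>\<psi>. (\<forall>n. test_function (\<psi> n)) \<and> (\<forall>n. \<forall>x\<in>Omega. \<bar>\<psi> n x\<bar> \<le> B + 1) \<and>
    (AE x in Om. (\<lambda>n. \<psi> n x) \<longlonglongrightarrow> b x)"
proof -
  have B0: "B \<ge> 0" using B[of "1/2"] by force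
  have "(\<lambda>x. indicat_real Omega x *\<^sub>R b x) \<in> borel_measurable lebesgue"
    using assms(1) by (subst (asm) borel_measurable_restrict_space_iff) simp_all
  then have "(\<lambda>x. indicat_real Omega x *\<^sub>R b x) measurable_on UNIV"
    by (rule lebesgue_measurable_imp_measurable_on) simp
  then obtain N g where N: "negligible N" and g: "\<And>n. continuous_on UNIV (g n)"
    and lim: "\<And>x. x \<notin> N \<Longrightarrow> (\<lambda>n. g n x) \<longlonglongrightarrow> indicat_real Omega x * b x"
    unfolding measurable_on_def by auto
  define h where "h n x = max (- B) (min B (g n x))" for n x
  have "\<exists>p. real_polynomial_function p \<and> (\<forall>x\<in>{0..1}. \<bar>h n x - p x\<bar> < 1 / Suc n)" for n
  proof -
    have "continuous_on {0..1} (h n)"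
      unfolding h_def using continuous_on_subset[OF g] by (intro continuous_intros) auto
    then show ?thesis
      using Stone_Weierstrass_real_polynomial_function[of "{0..1}" "h n" "1 / Suc n"]
      by (metis compact_Icc of_nat_0_less_iff zero_less_Suc zero_less_divide_1_iff)
  qed
  then obtain p where p: "\<And>n. real_polynomial_function (p n)"
    and hp: "\<And>n x. x \<in> {0..1} \<Longrightarrow> \<bar>h n x - p n x\<bar> < 1 / Suc n" by metis
  define \<psi> where "\<psi> n x = p n x * cutoff n x" for n x
  show ?thesis
  proof (intro exI[of _ \<psi>] conjI allI ballI)
    show "test_function (\<psi> n)" for n
      unfolding \<psi>_def by (intro test_mult test_cutoff smooth_polynomial p)
    show "\<bar>\<psi> n x\<bar> \<le> B + 1" if "x \<in> Omega" for n x
    proof -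
      have "\<bar>h n x\<bar> \<le> B" using B0 by (auto simp: h_def)
      moreover have "\<bar>h n x - p n x\<bar> < 1"
        using hp[of x n] that by (smt (verit) atLeastAtMost_iff divide_le_eq_1 greaterThanLessThan_iff of_nat_Suc of_nat_0_le_iff)
      ultimately have "\<bar>p n x\<bar> \<le> B + 1" by linarith
      then have "\<bar>p n x\<bar> * \<bar>cutoff n x\<bar> \<le> (B + 1) * 1"
        using cutoff_bounds[of n x] B0 by (intro mult_mono) auto
      then show ?thesis by (simp add: \<psi>_def abs_mult)
    qed
    have "AE x in lebesgue. x \<notin> N"
      using N by (intro AE_not_in) (simp add: negligible_iff_null_sets)
    then have "AE x in lebesgue. x \<in> Omega \<longrightarrow> (\<lambda>n. \<psi> n x) \<longlonglongrightarrow> b x"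
    proof eventually_elim
      case (elim x)
      show ?case
      proof
        assume x: "x \<in> Omega"
        have "(\<lambda>n. h n x) \<longlonglongrightarrow> max (- B) (min B (b x))"
          unfolding h_def using lim[OF elim] x by (intro tendsto_intros) simp
        then have h: "(\<lambda>n. h n x) \<longlonglongrightarrow> b x" using B[OF x] by (simp add: abs_le_iff max_def min_def split: if_splits)
        have "(\<lambda>n. h n x - p n x) \<longlonglongrightarrow> 0"
        proof (rule Lim_null_comparison)
          show "\<forall>\<^sub>F n in sequentially. norm (h n x - p n x) \<le> 1 / Suc n"
            using hp[of x] x by (intro always_eventually) (auto intro: less_imp_le)
          show "(\<lambda>n. 1 / real (Suc n)) \<longlonglongrightarrow> 0" by (rule LIMSEQ_Suc[OF lim_1_over_n])
        qed
        from tendsto_diff[OF h this] have "(\<lambda>n. p n x) \<longlonglongrightarrow> b x" by simp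
        from tendsto_mult[OF this cutoff_tendsto_1[OF x]] show "(\<lambda>n. \<psi> n x) \<longlonglongrightarrow> b x"
          by (simp add: \<psi>_def)
      qed
    qed
    then show "AE x in Om. (\<lambda>n. \<psi> n x) \<longlonglongrightarrow> b x"
      by (subst AE_restrict_space_iff) simp_all
  qed
qed

text \<open>Test the equation with an approximation of the sign of \<open>G\<close>.\<close>

lemma integrable_test_zero_AE:
  assumes G: "integrable Om G" and 0: "\<And>\<psi>. test_function \<psi> \<Longrightarrow> (\<integral>x. G x * \<psi> x \<partial>Om) = 0"
  shows "AE x in Om. G x = 0"
proof -
  note [measurable] = borel_measurable_integrable[OF G]
  have sg: "(\<lambda>x. sgn (G x)) \<in> borel_measurable Om" by measurable
  have "\<bar>sgn (G x)\<bar> \<le> 1" for x by (simp add: abs_sgn_eq)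
  from bounded_approx_test[OF sg this] obtain \<psi>
    where \<psi>: "test_function (\<psi> n)" "\<forall>x\<in>Omega. \<bar>\<psi> n x\<bar> \<le> 1 + 1"
      "AE x in Om. (\<lambda>n. \<psi> n x) \<longlonglongrightarrow> sgn (G x)" for n
    by blast
  have "(\<lambda>n. \<integral>x. G x * \<psi> n x \<partial>Om) \<longlonglongrightarrow> (\<integral>x. G x * sgn (G x) \<partial>Om)"
  proof (rule integral_dominated_convergence[where w = "\<lambda>x. \<bar>G x\<bar> * 2"])
    show "AE x in Om. (\<lambda>n. G x * \<psi> n x) \<longlonglongrightarrow> G x * sgn (G x)"
      using \<psi>(3) by eventually_elim (intro tendsto_intros)
    show "AE x in Om. norm (G x * \<psi> n x) \<le> \<bar>G x\<bar> * 2" for n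
      using \<psi>(2) by (intro AE_I2) (auto simp: abs_mult intro!: mult_left_mono)
    show "(\<lambda>x. G x * \<psi> n x) \<in> borel_measurable Om" for n
      using test_borel_Om[OF \<psi>(1)] by simp
  qed (use G sg in auto)
  then have "(\<integral>x. G x * sgn (G x) \<partial>Om) = 0"
    by (simp only: 0[OF \<psi>(1)] LIMSEQ_const_iff)
  then have "(\<integral>x. \<bar>G x\<bar> \<partial>Om) = 0" by (simp add: abs_sgn)
  then show ?thesis using integral_nonneg_eq_0_iff_AE[of Om "\<lambda>x. \<bar>G x\<bar>"] G by simp
qed

lemma locally_integrable_test:
  assumes g: "locally_integrable g" and \<phi>: "test_function \<phi>"
  shows "integrable Om (\<lambda>x. g x * \<phi> x)"
proof -
  obtain s t where st: "0 < s" "s \<le> t" "t < 1" "\<forall>x. x \<notin> {s..t} \<longrightarrow> \<phi> x = 0"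
    using test_support[OF \<phi>] by blast
  obtain B where B: "\<bar>\<phi> x\<bar> \<le> B" for x using test_bounded[OF \<phi>] by blast
  have "{s..t} \<subseteq> Omega" using st by auto
  then have 1: "integrable lebesgue (\<lambda>x. indicat_real {s..t} x * g x)"
    using g[unfolded locally_integrable_def set_integrable_def, rule_format, of "{s..t}"] by simp
  have "\<phi> \<in> borel_measurable lborel"
    using smooth_borel[OF test_smooth[OF \<phi>]] by simp
  then have "\<phi> \<in> borel_measurable lebesgue" by (rule measurable_completion)
  from integrable_mult_bounded[OF 1 this AE_I2[OF B]]
  have "integrable lebesgue (\<lambda>x. indicat_real {s..t} x * g x * \<phi> x)" .
  also have "(\<lambda>x. indicat_real {s..t} x * g x * \<phi> x) = (\<lambda>x. indicat_real Omega x *\<^sub>R (g x * \<phi> x))"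
    using st by (auto simp: indicator_def fun_eq_iff)
  finally show ?thesis by (simp add: integrable_restrict_space)
qed

text \<open>The cutoffs reduce local integrability to integrability.\<close>

lemma locally_integrable_test_zero_AE:
  assumes g: "locally_integrable g"
    and 0: "\<And>\<phi>. test_function \<phi> \<Longrightarrow> (\<integral>x. g x * \<phi> x \<partial>Om) = 0"
  shows "AE x in Om. g x = 0"
proof -
  have "AE x in Om. g x * cutoff N x = 0" for N
  proof (rule integrable_test_zero_AE)
    show "integrable Om (\<lambda>x. g x * cutoff N x)" by (rule locally_integrable_test[OF g test_cutoff])
    show "(\<integral>x. g x * cutoff N x * \<psi> x \<partial>Om) = 0" if "test_function \<psi>" for \<psi>
      using 0[OF test_mult[OF that smooth_cutoff[of N]]] by (simp add: mult.assoc)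
  qed
  then have "AE x in Om. \<forall>N. g x * cutoff N x = 0" unfolding AE_all_countable by blast
  then show ?thesis
  proof (rule AE_mp, intro AE_I2 impI)
    fix x assume x: "x \<in> space Om" and z: "\<forall>N. g x * cutoff N x = 0"
    have "\<forall>\<^sub>F N in sequentially. cutoff N x > 0"
      using x order_tendstoD(1)[OF cutoff_tendsto_1[of x], of 0] by simp
    then obtain N where "cutoff N x > 0" by (auto simp: eventually_sequentially)
    then show "g x = 0" using z[rule_format, of N] by simp
  qed
qed

text \<open>A cutoff is nonnegative and positive near the midpoint, so it can be normalized.\<close>

lemma test_unit_mass: "\<exists>\<eta>. test_function \<eta> \<and> (\<integral>x. \<eta> x \<partial>Om) = 1"
proof -
  have "(\<integral>x. cutoff 2 x \<partial>Om) \<noteq> 0"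
  proof
    assume "(\<integral>x. cutoff 2 x \<partial>Om) = 0"
    then have *: "AE x in Om. cutoff 2 x = 0"
      using integral_nonneg_eq_0_iff_AE[OF test_integrable[OF test_cutoff]] by (simp add: cutoff_bounds)
    have "isCont (cutoff 2) (1/2)" by (rule smooth_isCont[OF smooth_cutoff])
    then have "\<forall>\<^sub>F x in nhds (1/2). 0 < cutoff 2 x"
      using cutoff_pos[of 2 "1/2"]
      by (intro order_tendstoD(1)[of _ "cutoff 2 (1/2)"]) (simp_all add: isCont_def tendsto_nhds_iff)
    then obtain e where e: "e > 0" "\<And>x. dist x (1/2) < e \<Longrightarrow> 0 < cutoff 2 x"
      by (auto simp: eventually_nhds_metric)
    define e' where "e' = min e (1/4)"
    have e': "0 < e'" "e' \<le> e" "e' \<le> 1/4" using e by (auto simp: e'_def)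
    have "AE x in Om. indicat_real {1/2 - e' / 2<..1/2} x = 0"
      using *
    proof eventually_elim
      case (elim x)
      have "x \<notin> {1/2 - e' / 2<..1/2}"
      proof
        assume "x \<in> {1/2 - e' / 2<..1/2}"
        then have "dist x (1/2) < e" using e' by (auto simp: dist_real_def abs_if)
        with e(2) elim show False by force
      qed
      then show ?case by simp
    qed
    then have "(\<integral>x. indicat_real {1/2 - e' / 2<..1/2} x \<partial>Om) = (\<integral>x. 0 \<partial>Om)"
      by (intro integral_cong_AE) auto
    then show False using integral_Ioc_Om[of "1/2 - e'/2" "1/2"] e' by simp
  qed
  define \<eta> where "\<eta> x = (1 / (\<integral>x. cutoff 2 x \<partial>Om)) * cutoff 2 x" for x
  have \<eta>: "test_function \<eta>" unfolding \<eta>_def by (rule test_cmult[OF test_cutoff])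
  have \<eta>1: "(\<integral>x. \<eta> x \<partial>Om) = 1"
    unfolding \<eta>_def using \<open>(\<integral>x. cutoff 2 x \<partial>Om) \<noteq> 0\<close> by simp
  show ?thesis using \<eta> \<eta>1 by blast
qed

text \<open>Du Bois-Reymond: subtracting a fixed test function of integral one makes an arbitrary test
  function into the derivative of one.\<close>

lemma deriv_test_zero_const_AE:
  assumes f: "integrable Om f"
    and 0: "\<And>\<phi>. test_function \<phi> \<Longrightarrow> (\<integral>x. f x * deriv \<phi> x \<partial>Om) = 0"
  obtains c where "AE x in Om. f x = c"
proof -
  obtain \<eta> where \<eta>: "test_function \<eta>" and \<eta>1: "(\<integral>x. \<eta> x \<partial>Om) = 1"
    using test_unit_mass by blast
  define c where "c = (\<integral>x. f x * \<eta> x \<partial>Om)"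
  have "AE x in Om. f x - c = 0"
  proof (rule integrable_test_zero_AE)
    show "integrable Om (\<lambda>x. f x - c)" using f by simp
    fix \<psi> assume \<psi>: "test_function \<psi>"
    define m where "m = (\<integral>x. \<psi> x \<partial>Om)"
    have t: "test_function (\<lambda>x. \<psi> x - m * \<eta> x)" by (intro test_minus \<psi> test_cmult \<eta>)
    have "(\<integral>x. \<psi> x - m * \<eta> x \<partial>Om) = 0"
      using test_integrable[OF \<psi>] test_integrable[OF \<eta>] by (simp add: \<eta>1 m_def)
    then obtain \<phi> where "test_function \<phi>" "deriv \<phi> = (\<lambda>x. \<psi> x - m * \<eta> x)"
      using test_antideriv[OF t] by blast
    from 0[OF this(1)] this(2) have "(\<integral>x. f x * (\<psi> x - m * \<eta> x) \<partial>Om) = 0" by simp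
    also have "(\<lambda>x. f x * (\<psi> x - m * \<eta> x)) = (\<lambda>x. f x * \<psi> x - m * (f x * \<eta> x))"
      by (simp add: algebra_simps fun_eq_iff)
    finally have "(\<integral>x. f x * \<psi> x \<partial>Om) - m * c = 0"
      using integrable_mult_test[OF f \<psi>] integrable_mult_test[OF f \<eta>] by (simp add: c_def)
    then show "(\<integral>x. (f x - c) * \<psi> x \<partial>Om) = 0"
      using integrable_mult_test[OF f \<psi>] test_integrable[OF \<psi>]
      by (simp add: left_diff_distrib m_def algebra_simps)
  qed
  then have "AE x in Om. f x = c" by eventually_elim simp
  then show ?thesis by (rule that)
qed

section \<open>Square integrable functions\<close>

lemma in_L2_measurable: "in_L2 f \<Longrightarrow> f \<in> borel_measurable Om"
  by (simp add: in_L2_def)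

lemma in_L2_mult_integrable:
  assumes "in_L2 f" "in_L2 g"
  shows "integrable Om (\<lambda>x. f x * g x)"
proof (rule Bochner_Integration.integrable_bound)
  show "integrable Om (\<lambda>x. (f x)\<^sup>2 + (g x)\<^sup>2)" using assms by (simp add: in_L2_def)
  show "(\<lambda>x. f x * g x) \<in> borel_measurable Om" using assms by (auto simp: in_L2_def)
  show "AE x in Om. norm (f x * g x) \<le> norm ((f x)\<^sup>2 + (g x)\<^sup>2)"
  proof (rule AE_I2)
    fix x
    have "2 * \<bar>f x * g x\<bar> \<le> (f x)\<^sup>2 + (g x)\<^sup>2"
      using sum_squares_bound[of "\<bar>f x\<bar>" "\<bar>g x\<bar>"] by (simp add: abs_mult)
    then show "norm (f x * g x) \<le> norm ((f x)\<^sup>2 + (g x)\<^sup>2)" by simp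
  qed
qed

lemma bounded_in_L2:
  assumes "f \<in> borel_measurable Om" "AE x in Om. \<bar>f x\<bar> \<le> B"
  shows "in_L2 f"
  unfolding in_L2_def
proof
  show "integrable Om (\<lambda>x. (f x)\<^sup>2)"
  proof (rule integrable_const_bound_Om)
    show "AE x in Om. \<bar>(f x)\<^sup>2\<bar> \<le> B\<^sup>2"
      using assms(2) by eventually_elim (metis abs_ge_zero power2_abs power_mono abs_power2)
  qed (use assms(1) in simp)
qed fact

lemma in_L2_integrable: "in_L2 f \<Longrightarrow> integrable Om f"
  using in_L2_mult_integrable[of f "\<lambda>_. 1"] bounded_in_L2[of "\<lambda>_. 1" 1] by simp

lemma in_L2_add: "in_L2 f \<Longrightarrow> in_L2 g \<Longrightarrow> in_L2 (\<lambda>x. f x + g x)"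
  using in_L2_mult_integrable[of f g]
  by (auto simp: in_L2_def power2_sum mult.assoc)

lemma in_L2_cmult: "in_L2 f \<Longrightarrow> in_L2 (\<lambda>x. c * f x)"
  by (auto simp: in_L2_def power_mult_distrib)

lemma in_L2_minus: "in_L2 f \<Longrightarrow> in_L2 g \<Longrightarrow> in_L2 (\<lambda>x. f x - g x)"
  using in_L2_add[OF _ in_L2_cmult[of g "-1"]] by simp

lemma in_L2_cong_AE:
  assumes "in_L2 f" "AE x in Om. f x = g x" "g \<in> borel_measurable Om"
  shows "in_L2 g"
  unfolding in_L2_def
proof
  have "AE x in Om. (f x)\<^sup>2 = (g x)\<^sup>2" using assms(2) by eventually_elim simp
  then show "integrable Om (\<lambda>x. (g x)\<^sup>2)"
    using assms integrable_cong_AE[of "\<lambda>x. (f x)\<^sup>2" Om "\<lambda>x. (g x)\<^sup>2"] by (auto simp: in_L2_def)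
qed fact

lemma in_L2_mult_bounded:
  assumes "in_L2 f" "b \<in> borel_measurable Om" "AE x in Om. \<bar>b x\<bar> \<le> B"
  shows "in_L2 (\<lambda>x. b x * f x)"
  unfolding in_L2_def
proof
  have "AE x in Om. \<bar>(b x)\<^sup>2\<bar> \<le> B\<^sup>2"
    using assms(3) by eventually_elim (metis abs_ge_zero power2_abs power_mono abs_power2)
  then have "integrable Om (\<lambda>x. (f x)\<^sup>2 * (b x)\<^sup>2)"
    using assms by (intro integrable_mult_bounded) (auto simp: in_L2_def)
  then show "integrable Om (\<lambda>x. (b x * f x)\<^sup>2)" by (simp add: power_mult_distrib mult.commute)
qed (use assms in \<open>auto simp: in_L2_def\<close>)

lemma test_in_L2: "test_function \<phi> \<Longrightarrow> in_L2 \<phi>"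
  using bounded_in_L2[OF test_borel_Om] test_bounded by fast

lemma L2_inner_self: "L2_inner f f = (\<integral>x. (f x)\<^sup>2 \<partial>Om)"
  by (simp add: L2_inner_def power2_eq_square)

lemma L2_inner_self_nonneg: "0 \<le> L2_inner f f"
  by (simp add: L2_inner_self)

lemma L2_norm_nonneg: "0 \<le> L2_norm f"
  by (simp add: L2_norm_def L2_inner_self_nonneg)

lemma L2_norm_sq: "(L2_norm f)\<^sup>2 = L2_inner f f"
  by (simp add: L2_norm_def L2_inner_self_nonneg)

lemma L2_inner_commute: "L2_inner f g = L2_inner g f"
  by (simp add: L2_inner_def mult.commute)

lemma L2_inner_add_left:
  "in_L2 f \<Longrightarrow> in_L2 g \<Longrightarrow> in_L2 h \<Longrightarrow> L2_inner (\<lambda>x. f x + g x) h = L2_inner f h + L2_inner g h"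
  by (simp add: L2_inner_def distrib_right in_L2_mult_integrable)

lemma L2_inner_cmult_left: "L2_inner (\<lambda>x. c * f x) h = c * L2_inner f h"
  by (simp add: L2_inner_def mult.assoc)

lemma L2_inner_minus_left:
  "in_L2 f \<Longrightarrow> in_L2 g \<Longrightarrow> in_L2 h \<Longrightarrow> L2_inner (\<lambda>x. f x - g x) h = L2_inner f h - L2_inner g h"
  by (simp add: L2_inner_def left_diff_distrib in_L2_mult_integrable)

lemma L2_inner_cong_AE:
  assumes "AE x in Om. f x = f' x" "AE x in Om. g x = g' x"
    "f \<in> borel_measurable Om" "f' \<in> borel_measurable Om" "g \<in> borel_measurable Om" "g' \<in> borel_measurable Om"
  shows "L2_inner f g = L2_inner f' g'"
  unfolding L2_inner_def
proof (rule integral_cong_AE)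
  show "AE x in Om. f x * g x = f' x * g' x" using assms(1,2) by eventually_elim simp
qed (use assms in simp_all)

lemma L2_norm_cong_AE:
  assumes "AE x in Om. f x = g x" "f \<in> borel_measurable Om" "g \<in> borel_measurable Om"
  shows "L2_norm f = L2_norm g"
  unfolding L2_norm_def using L2_inner_cong_AE[OF assms(1) assms(1)] assms by simp

lemma Cauchy_Schwarz:
  assumes f: "in_L2 f" and g: "in_L2 g"
  shows "\<bar>L2_inner f g\<bar> \<le> L2_norm f * L2_norm g"
proof -
  define A B C where "A = L2_inner f f" "B = L2_inner g g" "C = L2_inner f g"
  have A: "A \<ge> 0" and B: "B \<ge> 0" unfolding A_B_C_def by (rule L2_inner_self_nonneg)+
  have q: "0 \<le> A - 2 * t * C + t\<^sup>2 * B" for t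
  proof -
    have "0 \<le> (\<integral>x. (f x - t * g x)\<^sup>2 \<partial>Om)" by simp
    also have "(\<lambda>x. (f x - t * g x)\<^sup>2) = (\<lambda>x. f x * f x - 2 * t * (f x * g x) + t\<^sup>2 * (g x * g x))"
      by (simp add: fun_eq_iff power2_eq_square algebra_simps)
    also have "(\<integral>x. f x * f x - 2 * t * (f x * g x) + t\<^sup>2 * (g x * g x) \<partial>Om) = A - 2 * t * C + t\<^sup>2 * B"
      unfolding A_B_C_def L2_inner_def
      using in_L2_mult_integrable[OF f f] in_L2_mult_integrable[OF f g] in_L2_mult_integrable[OF g g]
      by simp
    finally show ?thesis .
  qed
  have "C\<^sup>2 \<le> A * B"
  proof (cases "B = 0")
    case True
    have "C = 0"
    proof (rule ccontr)
      assume "C \<noteq> 0"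
      with q[of "(A + 1) / (2 * C)"] True show False by (simp add: field_simps)
    qed
    then show ?thesis using True by simp
  next
    case False
    with q[of "C / B"] B show ?thesis by (simp add: field_simps power2_eq_square)
  qed
  then have "sqrt (C\<^sup>2) \<le> sqrt (A * B)" by (rule real_sqrt_le_mono)
  then show ?thesis by (simp add: A_B_C_def L2_norm_def real_sqrt_mult)
qed

lemma L1_le_L2:
  assumes f: "in_L2 f"
  shows "(\<integral>x. \<bar>f x\<bar> \<partial>Om) \<le> L2_norm f"
proof -
  have "in_L2 (\<lambda>x. \<bar>f x\<bar>)" using f by (auto simp: in_L2_def)
  moreover have "in_L2 (\<lambda>_. 1)" by (rule bounded_in_L2[of _ 1]) auto
  ultimately have "\<bar>L2_inner (\<lambda>x. \<bar>f x\<bar>) (\<lambda>_. 1)\<bar> \<le> L2_norm (\<lambda>x. \<bar>f x\<bar>) * L2_norm (\<lambda>_. 1)"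
    by (rule Cauchy_Schwarz)
  then show ?thesis by (simp add: L2_norm_def L2_inner_def)
qed

lemma L2_norm_le:
  assumes "AE x in Om. \<bar>f x\<bar> \<le> B" "f \<in> borel_measurable Om"
  shows "L2_norm f \<le> B"
proof -
  have B: "B \<ge> 0" using AE_Om_ex[OF assms(1)] by force
  have "L2_inner f f \<le> (\<integral>x. B\<^sup>2 \<partial>Om)"
    unfolding L2_inner_self
  proof (rule integral_mono_AE)
    show "integrable Om (\<lambda>x. (f x)\<^sup>2)" using bounded_in_L2[OF assms(2,1)] by (simp add: in_L2_def)
    show "AE x in Om. (f x)\<^sup>2 \<le> B\<^sup>2"
      using assms(1) by eventually_elim (metis abs_ge_zero power2_abs power_mono)
  qed simp
  then have "sqrt (L2_inner f f) \<le> sqrt (B\<^sup>2)" by (intro real_sqrt_le_mono) simp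
  then show ?thesis using B by (simp add: L2_norm_def)
qed

lemma L2_norm_triangle:
  assumes f: "in_L2 f" and g: "in_L2 g"
  shows "L2_norm (\<lambda>x. f x + g x) \<le> L2_norm f + L2_norm g"
proof (rule power2_le_imp_le)
  have "(L2_norm (\<lambda>x. f x + g x))\<^sup>2 = L2_inner f f + 2 * L2_inner f g + L2_inner g g"
  proof -
    have "(\<lambda>x. (f x + g x)\<^sup>2) = (\<lambda>x. f x * f x + 2 * (f x * g x) + g x * g x)"
      by (simp add: fun_eq_iff power2_eq_square algebra_simps)
    then show ?thesis
      unfolding L2_norm_sq L2_inner_self[of "\<lambda>x. f x + g x"]
      using in_L2_mult_integrable[OF f f] in_L2_mult_integrable[OF f g] in_L2_mult_integrable[OF g g]
      by (simp add: L2_inner_def)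
  qed
  then show "(L2_norm (\<lambda>x. f x + g x))\<^sup>2 \<le> (L2_norm f + L2_norm g)\<^sup>2"
    using Cauchy_Schwarz[OF f g] by (simp add: L2_norm_sq[symmetric] power2_sum)
  show "0 \<le> L2_norm f + L2_norm g" by (simp add: L2_norm_nonneg)
qed

lemma L2_norm_cmult: "L2_norm (\<lambda>x. c * f x) = \<bar>c\<bar> * L2_norm f"
proof -
  have "L2_inner (\<lambda>x. c * f x) (\<lambda>x. c * f x) = c\<^sup>2 * L2_inner f f"
    by (simp add: L2_inner_self power_mult_distrib)
  then show ?thesis by (simp add: L2_norm_def real_sqrt_mult)
qed

lemma L2_norm_eq_0_AE:
  assumes "in_L2 f" "L2_norm f = 0"
  shows "AE x in Om. f x = 0"
proof -
  have "(\<integral>x. (f x)\<^sup>2 \<partial>Om) = 0"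
    using assms(2) by (simp add: L2_norm_def L2_inner_self)
  then show ?thesis
    using assms(1) integral_nonneg_eq_0_iff_AE[of Om "\<lambda>x. (f x)\<^sup>2"] by (simp add: in_L2_def)
qed

text \<open>Truncation followed by the bounded approximation.\<close>

lemma test_dense_L2:
  assumes f: "in_L2 f" and "e > 0"
  shows "\<exists>\<psi>. test_function \<psi> \<and> L2_norm (\<lambda>x. f x - \<psi> x) < e"
proof -
  note [measurable] = in_L2_measurable[OF f]
  define c where "c k x = max (- real k) (min (real k) (f x))" for k x
  have cm [measurable]: "c k \<in> borel_measurable Om" for k unfolding c_def by measurable
  have c_le: "\<bar>c k x\<bar> \<le> real k" "\<bar>f x - c k x\<bar> \<le> \<bar>f x\<bar>" for k x by (auto simp: c_def)
  have "(\<lambda>k. \<integral>x. (f x - c k x)\<^sup>2 \<partial>Om) \<longlonglongrightarrow> (\<integral>x. 0 \<partial>Om)"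
  proof (rule integral_dominated_convergence[where w = "\<lambda>x. (f x)\<^sup>2"])
    show "AE x in Om. (\<lambda>k. (f x - c k x)\<^sup>2) \<longlonglongrightarrow> 0"
    proof (rule AE_I2, rule tendsto_eventually)
      fix x
      obtain K where K: "\<bar>f x\<bar> \<le> real K" using real_arch_simple by blast
      show "\<forall>\<^sub>F k in sequentially. (f x - c k x)\<^sup>2 = 0"
        using eventually_ge_at_top[of K]
        by eventually_elim (use K in \<open>auto simp: c_def max_def min_def\<close>)
    qed
    show "AE x in Om. norm ((f x - c k x)\<^sup>2) \<le> (f x)\<^sup>2" for k
      using c_le(2) by (intro AE_I2) (simp add: abs_le_square_iff)
  qed (use f in \<open>simp_all add: in_L2_def\<close>)
  then have "(\<lambda>k. L2_norm (\<lambda>x. f x - c k x)) \<longlonglongrightarrow> 0"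
    unfolding L2_norm_def L2_inner_self using tendsto_real_sqrt by fastforce
  then have "\<forall>\<^sub>F k in sequentially. L2_norm (\<lambda>x. f x - c k x) < e / 2"
    using \<open>e > 0\<close> by (intro order_tendstoD(2)) auto
  then obtain k where k: "L2_norm (\<lambda>x. f x - c k x) < e / 2"
    by (auto simp: eventually_sequentially)
  obtain \<psi> where \<psi>: "\<And>n. test_function (\<psi> n)" "\<forall>n. \<forall>x\<in>Omega. \<bar>\<psi> n x\<bar> \<le> real k + 1"
      "AE x in Om. (\<lambda>n. \<psi> n x) \<longlonglongrightarrow> c k x"
    using bounded_approx_test[OF cm c_le(1)] by fast
  have "(\<lambda>n. \<integral>x. (c k x - \<psi> n x)\<^sup>2 \<partial>Om) \<longlonglongrightarrow> (\<integral>x. 0 \<partial>Om)"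
  proof (rule integral_dominated_convergence[where w = "\<lambda>x. (2 * real k + 1)\<^sup>2"])
    show "AE x in Om. (\<lambda>n. (c k x - \<psi> n x)\<^sup>2) \<longlonglongrightarrow> 0"
      using \<psi>(3)
    proof eventually_elim
      case (elim x)
      have "(\<lambda>n. (c k x - \<psi> n x)\<^sup>2) \<longlonglongrightarrow> (c k x - c k x)\<^sup>2" by (intro tendsto_intros elim)
      then show ?case by simp
    qed
    show "AE x in Om. norm ((c k x - \<psi> n x)\<^sup>2) \<le> (2 * real k + 1)\<^sup>2" for n
    proof (rule AE_I2)
      fix x assume "x \<in> space Om"
      then have "\<bar>\<psi> n x\<bar> \<le> real k + 1" using \<psi>(2) by simp
      then have "\<bar>c k x - \<psi> n x\<bar> \<le> 2 * real k + 1" using c_le(1)[of k x] by linarith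
      then have "\<bar>c k x - \<psi> n x\<bar>\<^sup>2 \<le> (2 * real k + 1)\<^sup>2" by (intro power_mono) auto
      then show "norm ((c k x - \<psi> n x)\<^sup>2) \<le> (2 * real k + 1)\<^sup>2" by simp
    qed
    show "(\<lambda>x. (c k x - \<psi> n x)\<^sup>2) \<in> borel_measurable Om" for n
      using test_borel_Om[OF \<psi>(1)[of n]] by simp
  qed simp_all
  then have "(\<lambda>n. L2_norm (\<lambda>x. c k x - \<psi> n x)) \<longlonglongrightarrow> 0"
    unfolding L2_norm_def L2_inner_self using tendsto_real_sqrt by fastforce
  then have "\<forall>\<^sub>F n in sequentially. L2_norm (\<lambda>x. c k x - \<psi> n x) < e / 2"
    using \<open>e > 0\<close> by (intro order_tendstoD(2)) auto
  then obtain n where n: "L2_norm (\<lambda>x. c k x - \<psi> n x) < e / 2"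
    by (auto simp: eventually_sequentially)
  have ck: "in_L2 (c k)" using c_le(1) by (intro bounded_in_L2[of _ "real k"]) auto
  have "L2_norm (\<lambda>x. (f x - c k x) + (c k x - \<psi> n x))
    \<le> L2_norm (\<lambda>x. f x - c k x) + L2_norm (\<lambda>x. c k x - \<psi> n x)"
    by (intro L2_norm_triangle in_L2_minus f ck test_in_L2 \<psi>(1))
  then have "L2_norm (\<lambda>x. f x - \<psi> n x) < e" using k n by simp
  then show ?thesis using \<psi>(1) by blast
qed

section \<open>Weak derivatives and the space \<open>H10\<close>\<close>

lemma locally_integrable_measurable:
  assumes "locally_integrable g"
  shows "g \<in> borel_measurable Om"
proof (rule borel_measurable_LIMSEQ_real)
  show "(\<lambda>n. g x * cutoff n x) \<longlonglongrightarrow> g x" if "x \<in> space Om" for x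
    using tendsto_mult[OF tendsto_const cutoff_tendsto_1[of x]] that by simp
  show "(\<lambda>x. g x * cutoff n x) \<in> borel_measurable Om" for n
    by (rule borel_measurable_integrable[OF locally_integrable_test[OF assms test_cutoff]])
qed

lemma integrable_locally_integrable:
  assumes "integrable Om g"
  shows "locally_integrable g"
  unfolding locally_integrable_def
proof (intro allI impI)
  fix K assume K: "compact K \<and> K \<subseteq> Omega"
  have "set_integrable lebesgue Omega g"
    using assms by (simp add: set_integrable_def integrable_restrict_space)
  then show "set_integrable lebesgue K g"
    by (rule set_integrable_subset) (use K in \<open>auto intro: lmeasurable_compact fmeasurableD\<close>)
qed

lemma weak_deriv_unique_AE:
  assumes "is_weak_deriv v g" "is_weak_deriv v k"
  shows "AE x in Om. g x = k x"
proof -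
  have li: "locally_integrable g" "locally_integrable k"
    using assms by (auto simp: is_weak_deriv_def)
  have "AE x in Om. g x - k x = 0"
  proof (rule locally_integrable_test_zero_AE)
    show "locally_integrable (\<lambda>x. g x - k x)"
      using li unfolding locally_integrable_def by (auto intro!: set_integral_diff(1))
    fix \<phi> assume \<phi>: "test_function \<phi>"
    then have "L2_inner g \<phi> = L2_inner k \<phi>"
      using assms by (simp add: is_weak_deriv_def)
    then show "(\<integral>x. (g x - k x) * \<phi> x \<partial>Om) = 0"
      using locally_integrable_test[OF li(1) \<phi>] locally_integrable_test[OF li(2) \<phi>]
      by (simp add: L2_inner_def left_diff_distrib)
  qed
  then show ?thesis by eventually_elim simp
qed

lemma weak_deriv_is_weak_deriv: "is_weak_deriv v g \<Longrightarrow> is_weak_deriv v (weak_deriv v)"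
  unfolding weak_deriv_def by (rule someI[of "is_weak_deriv v"])

lemma weak_deriv_AE: "is_weak_deriv v g \<Longrightarrow> AE x in Om. weak_deriv v x = g x"
  using weak_deriv_unique_AE weak_deriv_is_weak_deriv by blast

lemma weak_deriv_measurable: "is_weak_deriv v g \<Longrightarrow> weak_deriv v \<in> borel_measurable Om"
  using weak_deriv_is_weak_deriv locally_integrable_measurable unfolding is_weak_deriv_def by blast

lemma prim_is_weak_deriv:
  assumes g: "integrable Om g" and v: "AE x in Om. v x = prim g x" "v \<in> borel_measurable Om"
  shows "is_weak_deriv v g"
  unfolding is_weak_deriv_def
proof (intro conjI allI impI)
  note [measurable] = borel_measurable_integrable[OF g]
  have "AE x in Om. \<bar>v x\<bar> \<le> (\<integral>t. \<bar>g t\<bar> \<partial>Om)"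
    using v(1) by eventually_elim (simp add: prim_bound[OF g])
  then show "locally_integrable v"
    by (intro integrable_locally_integrable integrable_const_bound_Om[OF v(2)])
  show "locally_integrable g" by (rule integrable_locally_integrable[OF g])
  fix \<phi> assume \<phi>: "test_function \<phi>"
  have d: "integrable Om (deriv \<phi>)" by (intro test_integrable test_deriv \<phi>)
  have "L2_inner v (deriv \<phi>) = (\<integral>x. deriv \<phi> x * prim g x \<partial>Om)"
    unfolding L2_inner_def
  proof (rule integral_cong_AE)
    show "AE x in Om. v x * deriv \<phi> x = deriv \<phi> x * prim g x"
      using v(1) by eventually_elim simp
  qed (use v(2) d in auto)
  also have "\<dots> = - (\<integral>x. g x * prim (deriv \<phi>) x \<partial>Om)"
    by (simp add: prim_by_parts[OF d g] integral_deriv_test[OF \<phi>])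
  also have "(\<integral>x. g x * prim (deriv \<phi>) x \<partial>Om) = L2_inner g \<phi>"
    unfolding L2_inner_def
    by (intro Bochner_Integration.integral_cong) (simp_all add: test_eq_prim[OF \<phi>])
  finally show "L2_inner v (deriv \<phi>) = - L2_inner g \<phi>" .
qed

text \<open>In one dimension \<open>H10\<close> consists of the primitives of mean-free square integrable functions.\<close>

definition H10_rep :: "(real \<Rightarrow> real) \<Rightarrow> (real \<Rightarrow> real) \<Rightarrow> bool" where
  "H10_rep v g \<longleftrightarrow> v \<in> borel_measurable Om \<and> in_L2 g \<and> (AE x in Om. v x = prim g x)
     \<and> (\<integral>x. g x \<partial>Om) = 0"

lemma H10_rep_weak_deriv: "H10_rep v g \<Longrightarrow> is_weak_deriv v g"
  by (simp add: H10_rep_def prim_is_weak_deriv in_L2_integrable)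

lemma H10_rep_AE_bound:
  assumes "H10_rep v g"
  shows "AE x in Om. \<bar>v x\<bar> \<le> L2_norm g"
proof -
  have g: "in_L2 g" and v: "AE x in Om. v x = prim g x" using assms by (auto simp: H10_rep_def)
  show ?thesis
    using v by eventually_elim
      (simp add: order_trans[OF prim_bound[OF in_L2_integrable[OF g]] L1_le_L2[OF g]])
qed

lemma H10_rep_in_L2: "H10_rep v g \<Longrightarrow> in_L2 v"
  using H10_rep_AE_bound bounded_in_L2 by (auto simp: H10_rep_def)

lemma H10_rep_L2_bound: "H10_rep v g \<Longrightarrow> L2_norm v \<le> L2_norm g"
  using H10_rep_AE_bound L2_norm_le by (auto simp: H10_rep_def)

lemma H10_rep_add:
  assumes "H10_rep v g" "H10_rep w k"
  shows "H10_rep (\<lambda>x. v x + w x) (\<lambda>x. g x + k x)"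
proof -
  have "AE x in Om. v x = prim g x" "AE x in Om. w x = prim k x"
    using assms by (auto simp: H10_rep_def)
  then have "AE x in Om. v x + w x = prim (\<lambda>x. g x + k x) x"
    by eventually_elim (use assms in \<open>simp add: H10_rep_def prim_add in_L2_integrable\<close>)
  then show ?thesis using assms by (auto simp: H10_rep_def in_L2_add in_L2_integrable)
qed

lemma H10_rep_cmult:
  assumes "H10_rep v g"
  shows "H10_rep (\<lambda>x. c * v x) (\<lambda>x. c * g x)"
proof -
  have "AE x in Om. v x = prim g x" using assms by (auto simp: H10_rep_def)
  then have "AE x in Om. c * v x = prim (\<lambda>x. c * g x) x"
    by eventually_elim (simp add: prim_cmult)
  then show ?thesis using assms by (auto simp: H10_rep_def in_L2_cmult)
qed

lemma H10_rep_minus: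
  assumes "H10_rep v g" "H10_rep w k"
  shows "H10_rep (\<lambda>x. v x - w x) (\<lambda>x. g x - k x)"
  using H10_rep_add[OF assms(1) H10_rep_cmult[OF assms(2), of "-1"]] by simp

lemma H10_rep_cong_AE:
  assumes "H10_rep v g" "AE x in Om. g x = k x" "k \<in> borel_measurable Om"
  shows "H10_rep v k"
proof -
  have g: "in_L2 g" using assms by (simp add: H10_rep_def)
  have "prim g x = prim k x" for x
    using prim_cong_AE[OF assms(2) in_L2_measurable[OF g] assms(3)] .
  moreover have "(\<integral>x. g x \<partial>Om) = (\<integral>x. k x \<partial>Om)"
    by (rule integral_cong_AE) (use assms(2,3) in_L2_measurable[OF g] in auto)
  ultimately show ?thesis
    using assms in_L2_cong_AE[OF g assms(2,3)] by (simp add: H10_rep_def)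
qed

lemma H10_rep_test: "test_function \<phi> \<Longrightarrow> H10_rep \<phi> (deriv \<phi>)"
  unfolding H10_rep_def
  by (intro conjI test_borel_Om test_in_L2 test_deriv integral_deriv_test AE_I2 test_eq_prim) simp_all

text \<open>Test functions are primitives of their mean-free derivatives. Taking primitives is continuous
  from \<open>L2\<close> to the bounded functions, so both properties pass to limits in the \<open>H1\<close> norm.\<close>

lemma in_H10_imp_rep:
  assumes "v \<in> H10"
  shows "H10_rep v (weak_deriv v)"
proof -
  define D where "D = weak_deriv v"
  from assms obtain g where v: "in_L2 v" and g: "is_weak_deriv v g" "in_L2 g"
    unfolding H10_def in_H1_def by blast
  have D: "is_weak_deriv v D" unfolding D_def by (rule weak_deriv_is_weak_deriv[OF g(1)])
  have Dm: "D \<in> borel_measurable Om" unfolding D_def by (rule weak_deriv_measurable[OF g(1)])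
  have DL2: "in_L2 D"
    by (rule in_L2_cong_AE[OF g(2) weak_deriv_unique_AE[OF g(1) D] Dm])
  from assms obtain \<phi> where \<phi>: "\<And>n. test_function (\<phi> n)"
    and lim: "(\<lambda>n. H1_norm (\<lambda>x. v x - \<phi> n x)) \<longlonglongrightarrow> 0"
    unfolding H10_def by blast
  define e where "e n = H1_norm (\<lambda>x. v x - \<phi> n x)" for n
  define d where "d n = L2_norm (\<lambda>x. D x - deriv (\<phi> n) x)" for n
  have dphi: "in_L2 (deriv (\<phi> n))" for n by (intro test_in_L2 test_deriv \<phi>)
  have wd: "is_weak_deriv (\<lambda>x. v x - \<phi> n x) (\<lambda>x. D x - deriv (\<phi> n) x)" for n
    unfolding is_weak_deriv_def
  proof (intro conjI allI impI)
    show "locally_integrable (\<lambda>x. v x - \<phi> n x)" "locally_integrable (\<lambda>x. D x - deriv (\<phi> n) x)"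
      using v DL2 dphi test_in_L2[OF \<phi>]
      by (auto intro!: integrable_locally_integrable in_L2_integrable in_L2_minus)
    fix \<psi> assume \<psi>: "test_function \<psi>"
    have "L2_inner v (deriv \<psi>) = - L2_inner D \<psi>" using D \<psi> by (simp add: is_weak_deriv_def)
    moreover have "L2_inner (\<phi> n) (deriv \<psi>) = - L2_inner (deriv (\<phi> n)) \<psi>"
      using H10_rep_weak_deriv[OF H10_rep_test[OF \<phi>]] \<psi> by (simp add: is_weak_deriv_def)
    ultimately show "L2_inner (\<lambda>x. v x - \<phi> n x) (deriv \<psi>) = - L2_inner (\<lambda>x. D x - deriv (\<phi> n) x) \<psi>"
      using v DL2 dphi \<phi> \<psi> by (simp add: L2_inner_minus_left test_in_L2 test_deriv)
  qed
  have H1: "(e n)\<^sup>2 = (L2_norm (\<lambda>x. v x - \<phi> n x))\<^sup>2 + (d n)\<^sup>2" for n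
  proof -
    have "L2_norm (weak_deriv (\<lambda>x. v x - \<phi> n x)) = d n"
      unfolding d_def
      by (rule L2_norm_cong_AE[OF weak_deriv_AE[OF wd] weak_deriv_measurable[OF wd]])
        (use Dm in_L2_measurable[OF dphi] in simp)
    then show ?thesis by (simp add: e_def H1_norm_def)
  qed
  have e0: "e n \<ge> 0" for n by (simp add: e_def H1_norm_def)
  have le: "L2_norm (\<lambda>x. v x - \<phi> n x) \<le> e n" "d n \<le> e n" for n
    by (rule power2_le_imp_le[OF _ e0], simp only: H1, simp)+
  have e_lim: "e \<longlonglongrightarrow> 0" using lim by (simp add: e_def[abs_def])
  have L1: "(\<integral>x. \<bar>D x - deriv (\<phi> n) x\<bar> \<partial>Om) \<le> e n" for n
    using L1_le_L2[OF in_L2_minus[OF DL2 dphi], of n] le(2)[of n] by (simp add: d_def)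
  have int0: "(\<integral>x. D x \<partial>Om) = 0"
  proof -
    have "\<bar>\<integral>x. D x \<partial>Om\<bar> \<le> e n" for n
    proof -
      have "(\<integral>x. D x \<partial>Om) = (\<integral>x. D x - deriv (\<phi> n) x \<partial>Om)"
        using DL2 dphi by (simp add: in_L2_integrable integral_deriv_test[OF \<phi>])
      also have "\<bar>\<dots>\<bar> \<le> e n"
        by (rule order_trans[OF integral_abs_bound L1])
      finally show ?thesis .
    qed
    then have "\<bar>\<integral>x. D x \<partial>Om\<bar> \<le> 0" using LIMSEQ_le_const[OF e_lim] by blast
    then show ?thesis by simp
  qed
  note [measurable] = Dm in_L2_measurable[OF v]
  have pL2: "in_L2 (\<lambda>x. prim D x)"
    by (rule bounded_in_L2[OF _ AE_I2[OF prim_bound[OF in_L2_integrable[OF DL2]]]]) measurable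
  have "L2_norm (\<lambda>x. v x - prim D x) \<le> 2 * e n" for n
  proof -
    have "L2_norm (\<lambda>x. \<phi> n x - prim D x) \<le> e n"
    proof (rule L2_norm_le)
      show "AE x in Om. \<bar>\<phi> n x - prim D x\<bar> \<le> e n"
      proof (rule AE_I2)
        fix x assume "x \<in> space Om"
        then have "\<phi> n x - prim D x = - prim (\<lambda>x. D x - deriv (\<phi> n) x) x"
          using DL2 dphi by (simp add: test_eq_prim[OF \<phi>] prim_minus in_L2_integrable)
        then show "\<bar>\<phi> n x - prim D x\<bar> \<le> e n"
          using prim_bound[OF in_L2_integrable[OF in_L2_minus[OF DL2 dphi]], of n x] L1[of n] by simp
      qed
    qed (use test_borel_Om[OF \<phi>] in simp)
    moreover have "L2_norm (\<lambda>x. (v x - \<phi> n x) + (\<phi> n x - prim D x))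
        \<le> L2_norm (\<lambda>x. v x - \<phi> n x) + L2_norm (\<lambda>x. \<phi> n x - prim D x)"
      by (intro L2_norm_triangle in_L2_minus v pL2 test_in_L2 \<phi>)
    ultimately show ?thesis using le(1)[of n] by simp
  qed
  moreover have "(\<lambda>n. 2 * e n) \<longlonglongrightarrow> 0" using tendsto_mult_left[OF e_lim, of 2] by simp
  ultimately have "L2_norm (\<lambda>x. v x - prim D x) \<le> 0" using LIMSEQ_le_const by blast
  then have "L2_norm (\<lambda>x. v x - prim D x) = 0" using L2_norm_nonneg by (metis antisym)
  then have "AE x in Om. v x - prim D x = 0" by (rule L2_norm_eq_0_AE[OF in_L2_minus[OF v pL2]])
  then have "AE x in Om. v x = prim D x" by eventually_elim simp
  then show ?thesis using DL2 int0 in_L2_measurable[OF v] by (simp add: H10_rep_def D_def)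
qed

text \<open>Approximate \<open>g\<close> by test functions, correct their mean, and integrate.\<close>

lemma H10_rep_imp_in_H10:
  assumes rep: "H10_rep v g"
  shows "v \<in> H10"
proof -
  have g: "in_L2 g" and v: "in_L2 v" and g0: "(\<integral>x. g x \<partial>Om) = 0"
    using rep H10_rep_in_L2[OF rep] by (auto simp: H10_rep_def)
  obtain \<eta> where \<eta>: "test_function \<eta>" "(\<integral>x. \<eta> x \<partial>Om) = 1" using test_unit_mass by blast
  define c where "c = 2 * (1 + L2_norm \<eta>)"
  have c: "c > 0" using L2_norm_nonneg[of \<eta>] by (simp add: c_def)
  have "\<exists>\<phi>. test_function \<phi> \<and> H1_norm (\<lambda>x. v x - \<phi> x) \<le> c * (1 / Suc n)" for n
  proof -
    obtain \<psi> where \<psi>: "test_function \<psi>" "L2_norm (\<lambda>x. g x - \<psi> x) < 1 / Suc n"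
      using test_dense_L2[OF g, of "1 / Suc n"] by auto
    define m where "m = (\<integral>x. \<psi> x \<partial>Om)"
    have "\<bar>m\<bar> = \<bar>\<integral>x. g x - \<psi> x \<partial>Om\<bar>"
      using in_L2_integrable[OF g] test_integrable[OF \<psi>(1)] by (simp add: m_def g0)
    also have "\<dots> \<le> L2_norm (\<lambda>x. g x - \<psi> x)"
      using L1_le_L2[OF in_L2_minus[OF g test_in_L2[OF \<psi>(1)]]]
        integral_abs_bound[of Om "\<lambda>x. g x - \<psi> x"] by linarith
    finally have m: "\<bar>m\<bar> \<le> 1 / Suc n" using \<psi>(2) by linarith
    have t: "test_function (\<lambda>x. \<psi> x - m * \<eta> x)" by (intro test_minus \<psi> test_cmult \<eta>)
    have "(\<integral>x. \<psi> x - m * \<eta> x \<partial>Om) = 0"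
      using test_integrable[OF \<psi>(1)] test_integrable[OF \<eta>(1)] by (simp add: \<eta> m_def)
    then obtain \<phi> where \<phi>: "test_function \<phi>" "deriv \<phi> = (\<lambda>x. \<psi> x - m * \<eta> x)"
      using test_antideriv[OF t] by blast
    have rep': "H10_rep (\<lambda>x. v x - \<phi> x) (\<lambda>x. g x - deriv \<phi> x)"
      by (rule H10_rep_minus[OF rep H10_rep_test[OF \<phi>(1)]])
    note wd = H10_rep_weak_deriv[OF rep']
    define d where "d = L2_norm (\<lambda>x. g x - deriv \<phi> x)"
    have "d \<le> L2_norm (\<lambda>x. g x - \<psi> x) + L2_norm (\<lambda>x. m * \<eta> x)"
      using L2_norm_triangle[OF in_L2_minus[OF g test_in_L2[OF \<psi>(1)]] in_L2_cmult[OF test_in_L2[OF \<eta>(1)], of m]]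
      by (simp add: d_def \<phi>(2) algebra_simps)
    also have "\<dots> \<le> 1 / Suc n + 1 / Suc n * L2_norm \<eta>"
      unfolding L2_norm_cmult using \<psi>(2) m L2_norm_nonneg[of \<eta>] by (intro add_mono mult_right_mono) auto
    finally have d: "2 * d \<le> c * (1 / Suc n)" by (simp add: c_def field_simps)
    have "L2_norm (weak_deriv (\<lambda>x. v x - \<phi> x)) = d"
      unfolding d_def
      by (rule L2_norm_cong_AE[OF weak_deriv_AE[OF wd] weak_deriv_measurable[OF wd]])
        (use rep' in \<open>simp add: H10_rep_def in_L2_def\<close>)
    moreover have "L2_norm (\<lambda>x. v x - \<phi> x) \<le> d" unfolding d_def by (rule H10_rep_L2_bound[OF rep'])
    ultimately have "H1_norm (\<lambda>x. v x - \<phi> x) \<le> sqrt (d\<^sup>2 + d\<^sup>2)"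
      unfolding H1_norm_def using L2_norm_nonneg by (intro real_sqrt_le_mono add_mono power_mono) auto
    also have "\<dots> \<le> 2 * d"
    proof (rule real_le_lsqrt)
      show "0 \<le> 2 * d" using L2_norm_nonneg[of "\<lambda>x. g x - deriv \<phi> x"] by (simp add: d_def)
      show "d\<^sup>2 + d\<^sup>2 \<le> (2 * d)\<^sup>2" by (simp add: power_mult_distrib)
    qed
    finally show ?thesis using \<phi>(1) d by force
  qed
  then obtain \<phi> where \<phi>: "\<And>n. test_function (\<phi> n)" "\<And>n. H1_norm (\<lambda>x. v x - \<phi> n x) \<le> c * (1 / Suc n)"
    by metis
  have "(\<lambda>n. H1_norm (\<lambda>x. v x - \<phi> n x)) \<longlonglongrightarrow> 0"
  proof (rule Lim_null_comparison)
    show "\<forall>\<^sub>F n in sequentially. norm (H1_norm (\<lambda>x. v x - \<phi> n x)) \<le> c * (1 / Suc n)"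
      using \<phi>(2) by (intro always_eventually) (simp add: H1_norm_def)
    show "(\<lambda>n. c * (1 / real (Suc n))) \<longlonglongrightarrow> 0"
      using tendsto_mult_left[OF LIMSEQ_Suc[OF lim_1_over_n], of c] by simp
  qed
  then show ?thesis
    using v g H10_rep_weak_deriv[OF rep] \<phi>(1) unfolding H10_def in_H1_def by blast
qed

lemma H10_rep_weak_deriv_AE:
  assumes "H10_rep v g"
  shows "AE x in Om. weak_deriv v x = g x" "weak_deriv v \<in> borel_measurable Om"
    "H10_rep v (weak_deriv v)"
  using weak_deriv_AE weak_deriv_measurable H10_rep_weak_deriv[OF assms]
    in_H10_imp_rep[OF H10_rep_imp_in_H10[OF assms]] by blast+

section \<open>Functions of bounded variation\<close>

lemma Borel_Omega_iff: "A \<in> Borel_Omega \<longleftrightarrow> A \<subseteq> Omega \<and> A \<in> sets borel"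
  unfolding Borel_Omega_def by (subst sets_restrict_space_iff) auto

lemma sets_Borel_Omega_space:
  assumes "sets P = Borel_Omega"
  shows "space P = Omega"
  using sets_eq_imp_space_eq[of P "restrict_space borel Omega"] assms
  by (simp add: Borel_Omega_def space_restrict_space)

lemma ident_Borel_Omega:
  assumes "sets P = Borel_Omega"
  shows "(\<lambda>x. x) \<in> borel_measurable P"
proof -
  have "(\<lambda>x. x) \<in> measurable (restrict_space borel Omega) borel"
    by (rule measurable_restrict_space1) simp
  then show ?thesis
    using measurable_cong_sets[of P "restrict_space borel Omega" borel borel] assms
    by (simp add: Borel_Omega_def)
qed

lemma finite_measure_signed_measure:
  assumes "finite_measure P" "sets P = Borel_Omega"
  shows "signed_measure (measure P)"
  unfolding signed_measure_def
proof (intro conjI allI impI)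
  interpret finite_measure P by fact
  show "(\<lambda>n. measure P (A n)) sums measure P (\<Union>n. A n)"
    if "range A \<subseteq> Borel_Omega" "disjoint_family A" for A :: "nat \<Rightarrow> real set"
    using that assms(2) by (intro finite_measure_UNION) simp_all
qed simp

lemma signed_measure_cmult: "signed_measure m \<Longrightarrow> signed_measure (\<lambda>A. c * m A)"
  unfolding signed_measure_def by (simp add: sums_mult)

lemma signed_measure_add:
  "signed_measure m \<Longrightarrow> signed_measure m' \<Longrightarrow> signed_measure (\<lambda>A. m A + m' A)"
  unfolding signed_measure_def by (simp add: sums_add)

lemma signed_measure_sum:
  assumes "finite I" "\<And>i. i \<in> I \<Longrightarrow> signed_measure (m i)"
  shows "signed_measure (\<lambda>A. \<Sum>i\<in>I. m i A)"
  using assms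
proof (induction rule: finite_induct)
  case empty
  then show ?case by (simp add: signed_measure_def)
next
  case (insert i I)
  then show ?case by (simp add: signed_measure_add)
qed

lemma signed_measure_cong:
  assumes "signed_measure m" "\<And>A. A \<in> Borel_Omega \<Longrightarrow> m A = m' A"
  shows "signed_measure m'"
proof -
  have "{} \<in> Borel_Omega" by (simp add: Borel_Omega_iff)
  moreover have "(\<Union>n. A n) \<in> Borel_Omega" if "range A \<subseteq> Borel_Omega" for A :: "nat \<Rightarrow> real set"
    using that unfolding Borel_Omega_def by (rule sets.countable_UN)
  moreover have "m (A n) = m' (A n)" if "range A \<subseteq> Borel_Omega" for A :: "nat \<Rightarrow> real set" and n
    using that assms(2) by blast
  ultimately show ?thesis
    using assms unfolding signed_measure_def by (metis (no_types, lifting) sums_cong)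
qed

lemma nonneg_signed_measure:
  assumes m: "signed_measure m" and nn: "\<And>A. A \<in> Borel_Omega \<Longrightarrow> 0 \<le> m A"
  shows "\<exists>P. finite_measure P \<and> sets P = Borel_Omega \<and> (\<forall>A\<in>Borel_Omega. measure P A = m A)"
proof -
  define P where "P = measure_of Omega Borel_Omega (\<lambda>A. ennreal (m A))"
  have alg: "sigma_algebra Omega Borel_Omega"
    using sets.sigma_algebra_axioms[of "restrict_space borel Omega"]
    by (simp add: Borel_Omega_def space_restrict_space)
  have sets: "sets P = Borel_Omega"
    unfolding P_def using alg by (rule sigma_algebra.sets_measure_of_eq)
  have em: "emeasure P A = ennreal (m A)" if "A \<in> Borel_Omega" for A
    unfolding P_def
  proof (rule emeasure_measure_of_sigma[OF alg])
    show "positive Borel_Omega (\<lambda>A. ennreal (m A))"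
      using m by (simp add: positive_def signed_measure_def)
    show "countably_additive Borel_Omega (\<lambda>A. ennreal (m A))"
      unfolding countably_additive_def
    proof (intro allI impI)
      fix A :: "nat \<Rightarrow> real set"
      assume A: "range A \<subseteq> Borel_Omega" "disjoint_family A" "(\<Union>i. A i) \<in> Borel_Omega"
      have "(\<lambda>n. m (A n)) sums m (\<Union>n. A n)" using m A by (simp add: signed_measure_def)
      then show "(\<Sum>i. ennreal (m (A i))) = ennreal (m (\<Union>i. A i))"
        using A nn by (intro suminf_ennreal_eq) auto
    qed
  qed fact
  have "Omega \<in> Borel_Omega" by (simp add: Borel_Omega_iff)
  then have "finite_measure P"
    using em by (intro finite_measureI) (simp add: sets_Borel_Omega_space[OF sets])
  then show ?thesis using sets em nn by (auto simp: measure_def)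
qed

lemma measure_difference_exists:
  assumes "signed_measure m" "signed_measure m'"
    "\<And>A. A \<in> Borel_Omega \<Longrightarrow> 0 \<le> m A" "\<And>A. A \<in> Borel_Omega \<Longrightarrow> 0 \<le> m' A"
    "\<And>A. A \<in> Borel_Omega \<Longrightarrow> \<mu> A = m A - m' A"
  shows "\<exists>P N. measure_difference \<mu> P N"
  using nonneg_signed_measure[OF assms(1,3)] nonneg_signed_measure[OF assms(2,4)] assms(5)
  unfolding measure_difference_def by metis

lemma measure_difference_signed:
  assumes "measure_difference \<mu> P N"
  shows "signed_measure \<mu>"
proof (rule signed_measure_cong)
  show "signed_measure (\<lambda>A. measure P A + (- 1) * measure N A)"
    using assms unfolding measure_difference_def
    by (intro signed_measure_add signed_measure_cmult finite_measure_signed_measure) auto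
qed (use assms in \<open>simp add: measure_difference_def\<close>)

text \<open>The left continuous distribution function: the half line is open because integration by parts
  against a test function produces the measure of \<open>{t..}\<close>.\<close>

definition cdf :: "(real set \<Rightarrow> real) \<Rightarrow> real \<Rightarrow> real" where
  "cdf \<mu> t = \<mu> ({..<t} \<inter> Omega)"

lemma Iio_Borel_Omega: "{..<t} \<inter> Omega \<in> Borel_Omega"
  by (simp add: Borel_Omega_iff)

lemma cdf_mono:
  assumes "finite_measure P" "sets P = Borel_Omega" "s \<le> t"
  shows "cdf (measure P) s \<le> cdf (measure P) t"
  unfolding cdf_def
  by (intro finite_measure.finite_measure_mono[OF assms(1)])
    (use assms(3) Iio_Borel_Omega in \<open>auto simp: assms(2)\<close>)

lemma cdf_bounds:
  assumes "finite_measure P" "sets P = Borel_Omega"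
  shows "0 \<le> cdf (measure P) t" "cdf (measure P) t \<le> measure P Omega"
  unfolding cdf_def
  using finite_measure.finite_measure_mono[OF assms(1), of "{..<t} \<inter> Omega" Omega]
  by (auto simp: assms(2) Borel_Omega_iff)

lemma cdf_measurable:
  assumes "finite_measure P" "sets P = Borel_Omega"
  shows "cdf (measure P) \<in> borel_measurable borel"
  by (intro borel_measurable_mono monoI cdf_mono[OF assms])

lemma cdf_difference:
  assumes "measure_difference \<mu> P N"
  shows "cdf \<mu> t = cdf (measure P) t - cdf (measure N) t"
  using assms Iio_Borel_Omega by (simp add: measure_difference_def cdf_def)

lemma cdf_difference_measurable:
  assumes "measure_difference \<mu> P N"
  shows "cdf \<mu> \<in> borel_measurable borel"
proof -
  have [measurable]: "cdf (measure P) \<in> borel_measurable borel" "cdf (measure N) \<in> borel_measurable borel"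
    using assms by (auto simp: measure_difference_def intro: cdf_measurable)
  show ?thesis unfolding cdf_difference[OF assms, abs_def] by measurable
qed

lemma cdf_difference_bound:
  assumes "measure_difference \<mu> P N"
  shows "\<bar>cdf \<mu> t\<bar> \<le> measure P Omega + measure N Omega"
  using cdf_bounds[of P t] cdf_bounds[of N t] assms
  unfolding cdf_difference[OF assms] by (simp add: measure_difference_def)

lemma cdf_diff_eq:
  assumes d: "measure_difference \<mu> P N" and "s \<le> t"
  shows "cdf \<mu> t - cdf \<mu> s = \<mu> ({s..<t} \<inter> Omega)"
proof -
  have "cdf (measure M) t - cdf (measure M) s = measure M ({s..<t} \<inter> Omega)"
    if "finite_measure M" "sets M = Borel_Omega" for M
  proof -
    have "{..<t} \<inter> Omega = ({..<s} \<inter> Omega) \<union> ({s..<t} \<inter> Omega)" using \<open>s \<le> t\<close> by auto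
    moreover have "measure M (({..<s} \<inter> Omega) \<union> ({s..<t} \<inter> Omega))
        = measure M ({..<s} \<inter> Omega) + measure M ({s..<t} \<inter> Omega)"
      by (rule finite_measure.finite_measure_Union[OF that(1)])
        (auto simp: that(2) Borel_Omega_iff)
    ultimately show ?thesis by (simp add: cdf_def)
  qed
  from this[of P] this[of N] show ?thesis
    using d unfolding cdf_difference[OF d] by (simp add: measure_difference_def Borel_Omega_iff)
qed

lemma integral_test_measure:
  assumes P: "finite_measure P" "sets P = Borel_Omega" and \<phi>: "test_function \<phi>"
  shows "(\<integral>x. \<phi> x \<partial>P) = - (\<integral>t. deriv \<phi> t * cdf (measure P) t \<partial>Om)"
proof -
  interpret P: finite_measure P by fact
  have sp: "space P = Omega" by (rule sets_Borel_Omega_space[OF P(2)])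
  have d: "integrable Om (deriv \<phi>)" by (intro test_integrable test_deriv \<phi>)
  have up: "(\<integral>x. 1 * indicat_real {t..} x \<partial>P) = measure P Omega - cdf (measure P) t" for t
  proof -
    have s: "{t..} \<inter> Omega \<in> sets P" by (simp add: P(2) Borel_Omega_iff)
    have "(\<integral>x. 1 * indicat_real {t..} x \<partial>P) = (\<integral>x. indicat_real ({t..} \<inter> Omega) x \<partial>P)"
      by (intro Bochner_Integration.integral_cong) (auto simp: sp indicator_def)
    also have "\<dots> = measure P ({t..} \<inter> Omega)" using s by (simp add: sp Int_absorb2)
    also have "{t..} \<inter> Omega = Omega - ({..<t} \<inter> Omega)" by auto
    also have "measure P \<dots> = measure P Omega - cdf (measure P) t"
      unfolding cdf_def
      by (rule P.finite_measure_Diff) (auto simp: P(2) Borel_Omega_iff)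
    finally show ?thesis .
  qed
  have "(\<integral>x. \<phi> x \<partial>P) = (\<integral>x. 1 * prim (deriv \<phi>) x \<partial>P)"
    by (intro Bochner_Integration.integral_cong) (simp_all add: sp test_eq_prim[OF \<phi>])
  also have "\<dots> = (\<integral>t. deriv \<phi> t * (\<integral>x. 1 * indicat_real {t..} x \<partial>P) \<partial>Om)"
    by (rule Fubini_triangle[OF P(1) ident_Borel_Omega[OF P(2)] _ d]) simp
  also have "\<dots> = (\<integral>t. deriv \<phi> t * measure P Omega - deriv \<phi> t * cdf (measure P) t \<partial>Om)"
    unfolding up by (simp only: right_diff_distrib)
  also have "\<dots> = (\<integral>t. deriv \<phi> t \<partial>Om) * measure P Omega - (\<integral>t. deriv \<phi> t * cdf (measure P) t \<partial>Om)"
  proof -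
    have "integrable Om (\<lambda>t. deriv \<phi> t * cdf (measure P) t)"
      by (rule integrable_mult_bounded[OF d borel_Om[OF cdf_measurable[OF P]], of "measure P Omega"])
        (simp add: cdf_bounds[OF P])
    then show ?thesis using d by simp
  qed
  finally show ?thesis by (simp add: integral_deriv_test[OF \<phi>])
qed

lemma cdf_difference_integrable:
  assumes "measure_difference \<mu> P N"
  shows "integrable Om (cdf \<mu>)"
  by (rule integrable_const_bound_Om[OF borel_Om[OF cdf_difference_measurable[OF assms]]
        AE_I2[OF cdf_difference_bound[OF assms]]])

lemma integral_test_difference:
  assumes d: "measure_difference \<mu> P N" and \<phi>: "test_function \<phi>"
  shows "- ((\<integral>x. \<phi> x \<partial>P) - (\<integral>x. \<phi> x \<partial>N)) = L2_inner (cdf \<mu>) (deriv \<phi>)"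
proof -
  have P: "finite_measure P" "sets P = Borel_Omega" and N: "finite_measure N" "sets N = Borel_Omega"
    using d by (auto simp: measure_difference_def)
  have di: "integrable Om (deriv \<phi>)" by (intro test_integrable test_deriv \<phi>)
  have i: "integrable Om (\<lambda>t. deriv \<phi> t * cdf (measure M) t)"
    if "finite_measure M" "sets M = Borel_Omega" for M
    by (rule integrable_mult_bounded[OF di borel_Om[OF cdf_measurable[OF that]], of "measure M Omega"])
      (simp add: cdf_bounds[OF that])
  have "L2_inner (cdf \<mu>) (deriv \<phi>)
      = (\<integral>t. deriv \<phi> t * cdf (measure P) t - deriv \<phi> t * cdf (measure N) t \<partial>Om)"
    unfolding L2_inner_def cdf_difference[OF d] by (simp add: algebra_simps)
  then show ?thesis
    using i[OF P] i[OF N] by (simp add: integral_test_measure[OF P \<phi>] integral_test_measure[OF N \<phi>])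
qed

text \<open>In this form the integrals against \<open>P\<close> and \<open>N\<close> have disappeared and the identity is linear in
  \<open>\<mu>\<close>.\<close>

lemma is_measure_deriv_iff:
  "is_measure_deriv q \<mu> \<longleftrightarrow> (\<exists>P N. measure_difference \<mu> P N) \<and>
     (\<forall>\<phi>. test_function \<phi> \<longrightarrow> L2_inner q (deriv \<phi>) = L2_inner (cdf \<mu>) (deriv \<phi>))"
  unfolding is_measure_deriv_def
  using integral_test_difference measure_difference_signed by (metis (no_types, lifting))

text \<open>By the previous characterization \<open>q - cdf \<mu>\<close> is orthogonal to all derivatives of test functions,
  hence constant.\<close>

lemma is_measure_deriv_rep:
  assumes q: "integrable Om q" and \<mu>: "is_measure_deriv q \<mu>"
  shows "\<exists>c. AE x in Om. q x = c + cdf \<mu> x"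
proof -
  obtain P N where d: "measure_difference \<mu> P N" using \<mu> is_measure_deriv_iff by blast
  have "integrable Om (\<lambda>x. q x - cdf \<mu> x)" using q cdf_difference_integrable[OF d] by simp
  then obtain c where "AE x in Om. q x - cdf \<mu> x = c"
  proof (rule deriv_test_zero_const_AE)
    fix \<phi> assume \<phi>: "test_function \<phi>"
    then have "L2_inner q (deriv \<phi>) = L2_inner (cdf \<mu>) (deriv \<phi>)" using \<mu> is_measure_deriv_iff by blast
    then show "(\<integral>x. (q x - cdf \<mu> x) * deriv \<phi> x \<partial>Om) = 0"
      using integrable_mult_test[OF q test_deriv[OF \<phi>]]
        integrable_mult_test[OF cdf_difference_integrable[OF d] test_deriv[OF \<phi>]]
      by (simp add: L2_inner_def left_diff_distrib)
  qed blast
  then have "AE x in Om. q x = c + cdf \<mu> x" by eventually_elim simp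
  then show ?thesis by blast
qed

lemma rep_is_measure_deriv:
  assumes d: "measure_difference \<mu> P N" and q: "q \<in> borel_measurable Om" "AE x in Om. q x = c + cdf \<mu> x"
  shows "is_measure_deriv q \<mu>"
proof -
  have "L2_inner q (deriv \<phi>) = L2_inner (cdf \<mu>) (deriv \<phi>)" if \<phi>: "test_function \<phi>" for \<phi>
  proof -
    note [measurable] = borel_Om[OF cdf_difference_measurable[OF d]] q(1) test_borel_Om[OF test_deriv[OF \<phi>]]
    have "L2_inner q (deriv \<phi>) = (\<integral>x. c * deriv \<phi> x + cdf \<mu> x * deriv \<phi> x \<partial>Om)"
      unfolding L2_inner_def
    proof (rule integral_cong_AE)
      show "AE x in Om. q x * deriv \<phi> x = c * deriv \<phi> x + cdf \<mu> x * deriv \<phi> x"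
        using q(2) by eventually_elim (simp add: distrib_right)
    qed measurable
    then show ?thesis
      using test_integrable[OF test_deriv[OF \<phi>]]
        integrable_mult_test[OF cdf_difference_integrable[OF d] test_deriv[OF \<phi>]]
      by (simp add: L2_inner_def integral_deriv_test[OF \<phi>])
  qed
  then show ?thesis using d is_measure_deriv_iff by blast
qed

lemma AE_Om_dense:
  assumes "AE x in Om. P x" "0 \<le> a" "a < b" "b \<le> 1"
  shows "\<exists>x\<in>{a<..<b}. P x"
proof (rule ccontr)
  assume n: "\<not> ?thesis"
  have "AE x in Om. indicat_real {a<..(a+b)/2} x = 0"
    using assms(1)
  proof eventually_elim
    case (elim x)
    then have "x \<notin> {a<..<b}" using n by blast
    then have "x \<notin> {a<..(a+b)/2}" using assms(3) by auto
    then show ?case by simp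
  qed
  then have "(\<integral>x. indicat_real {a<..(a+b)/2} x \<partial>Om) = (\<integral>x. 0 \<partial>Om)"
    by (intro integral_cong_AE) auto
  then show False using integral_Ioc_Om[of a "(a+b)/2"] assms by simp
qed

lemma cdf_left_continuous:
  assumes P: "finite_measure P" "sets P = Borel_Omega"
    and s: "\<And>n. s n \<in> {t - 1 / Suc n<..<t}"
  shows "(\<lambda>n. cdf (measure P) (s n)) \<longlonglongrightarrow> cdf (measure P) t"
proof (rule tendsto_sandwich)
  define A where "A n = {..<t - 1 / real (Suc n)} \<inter> Omega" for n
  have "(\<lambda>n. measure P (A n)) \<longlonglongrightarrow> measure P (\<Union>n. A n)"
  proof (rule finite_measure.finite_Lim_measure_incseq[OF P(1)])
    show "range A \<subseteq> sets P" using Iio_Borel_Omega by (auto simp: A_def P(2))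
    show "incseq A"
      by (rule incseq_SucI) (auto simp: A_def field_simps intro: less_le_trans)
  qed
  also have "(\<Union>n. A n) = {..<t} \<inter> Omega"
  proof
    show "(\<Union>n. A n) \<subseteq> {..<t} \<inter> Omega" by (auto simp: A_def intro: less_le_trans)
    show "{..<t} \<inter> Omega \<subseteq> (\<Union>n. A n)"
    proof
      fix x assume x: "x \<in> {..<t} \<inter> Omega"
      then obtain n where "1 / real (Suc n) < t - x"
        using reals_Archimedean[of "t - x"] by (auto simp: inverse_eq_divide)
      then show "x \<in> (\<Union>n. A n)" using x by (auto simp: A_def intro!: exI[of _ n])
    qed
  qed
  finally show "(\<lambda>n. cdf (measure P) (t - 1 / real (Suc n))) \<longlonglongrightarrow> cdf (measure P) t"
    by (simp add: cdf_def A_def)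
  show "\<forall>\<^sub>F n in sequentially. cdf (measure P) (t - 1 / real (Suc n)) \<le> cdf (measure P) (s n)"
    using s by (intro always_eventually allI cdf_mono[OF P]) (auto intro: less_imp_le)
  show "\<forall>\<^sub>F n in sequentially. cdf (measure P) (s n) \<le> cdf (measure P) t"
    using s by (intro always_eventually allI cdf_mono[OF P]) (auto intro: less_imp_le)
qed simp

lemma cdf_tendsto_0:
  assumes P: "finite_measure P" "sets P = Borel_Omega"
    and s: "\<And>n. s n \<in> {0<..<1 / Suc n}"
  shows "(\<lambda>n. cdf (measure P) (s n)) \<longlonglongrightarrow> 0"
proof (rule tendsto_sandwich[where f = "\<lambda>_. 0" and h = "\<lambda>n. cdf (measure P) (1 / real (Suc n))"])
  define A where "A n = {..<1 / real (Suc n)} \<inter> Omega" for n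
  have "(\<lambda>n. measure P (A n)) \<longlonglongrightarrow> measure P (\<Inter>n. A n)"
  proof (rule finite_measure.finite_Lim_measure_decseq[OF P(1)])
    show "range A \<subseteq> sets P" using Iio_Borel_Omega by (auto simp: A_def P(2))
    show "decseq A"
      by (rule decseq_SucI) (auto simp: A_def field_simps intro: less_le_trans)
  qed
  also have "(\<Inter>n. A n) = {}"
  proof (rule equals0I)
    fix x assume x: "x \<in> (\<Inter>n. A n)"
    then have "x > 0" by (auto simp: A_def)
    then obtain n where "1 / real (Suc n) < x"
      using reals_Archimedean[of x] by (auto simp: inverse_eq_divide)
    moreover have "x < 1 / real (Suc n)" using x by (auto simp: A_def)
    ultimately show False by simp
  qed
  finally show "(\<lambda>n. cdf (measure P) (1 / real (Suc n))) \<longlonglongrightarrow> 0"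
    by (simp add: cdf_def A_def)
  show "\<forall>\<^sub>F n in sequentially. cdf (measure P) (s n) \<le> cdf (measure P) (1 / real (Suc n))"
    using s by (intro always_eventually allI cdf_mono[OF P]) (auto intro: less_imp_le)
  show "\<forall>\<^sub>F n in sequentially. 0 \<le> cdf (measure P) (s n)"
    by (intro always_eventually allI cdf_bounds[OF P])
qed simp

lemma signed_measure_Diff:
  assumes "measure_difference \<mu> P N" "A \<in> Borel_Omega"
  shows "\<mu> (Omega - A) = \<mu> Omega - \<mu> A"
proof -
  have "measure M (Omega - A) = measure M Omega - measure M A"
    if "finite_measure M" "sets M = Borel_Omega" for M
    by (rule finite_measure.finite_measure_Diff[OF that(1)])
      (use assms(2) in \<open>auto simp: that(2) Borel_Omega_iff\<close>)
  moreover have "Omega - A \<in> Borel_Omega" "Omega \<in> Borel_Omega"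
    using assms(2) by (auto simp: Borel_Omega_iff)
  ultimately show ?thesis using assms by (simp add: measure_difference_def)
qed

text \<open>Left continuity turns equality of the distribution functions almost everywhere, up to a
  constant, into equality everywhere, and half lines generate the Borel sets.\<close>

lemma is_measure_deriv_unique:
  assumes 1: "is_measure_deriv q \<mu>" and 2: "is_measure_deriv q \<mu>'" and A: "A \<in> Borel_Omega"
  shows "\<mu> A = \<mu>' A"
proof -
  obtain P N where d: "measure_difference \<mu> P N" using 1 is_measure_deriv_iff by blast
  obtain P' N' where d': "measure_difference \<mu>' P' N'" using 2 is_measure_deriv_iff by blast
  have meas: "finite_measure P" "sets P = Borel_Omega" "finite_measure N" "sets N = Borel_Omega"
    "finite_measure P'" "sets P' = Borel_Omega" "finite_measure N'" "sets N' = Borel_Omega"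
    using d d' by (auto simp: measure_difference_def)
  have i: "integrable Om (\<lambda>x. cdf \<mu> x - cdf \<mu>' x)"
    using cdf_difference_integrable[OF d] cdf_difference_integrable[OF d'] by simp
  then obtain c where c: "AE x in Om. cdf \<mu> x - cdf \<mu>' x = c"
  proof (rule deriv_test_zero_const_AE)
    fix \<phi> assume \<phi>: "test_function \<phi>"
    then have "L2_inner (cdf \<mu>) (deriv \<phi>) = L2_inner (cdf \<mu>') (deriv \<phi>)"
      using 1 2 is_measure_deriv_iff by metis
    then show "(\<integral>x. (cdf \<mu> x - cdf \<mu>' x) * deriv \<phi> x \<partial>Om) = 0"
      using integrable_mult_test[OF cdf_difference_integrable[OF d'] test_deriv[OF \<phi>]]
        integrable_mult_test[OF cdf_difference_integrable[OF d] test_deriv[OF \<phi>]]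
      by (simp add: L2_inner_def left_diff_distrib)
  qed blast
  have eq_c: "cdf \<mu> t - cdf \<mu>' t = c" if t: "0 < t" "t \<le> 1" for t
  proof -
    have "\<exists>x\<in>{max 0 (t - 1 / Suc n)<..<t}. cdf \<mu> x - cdf \<mu>' x = c" for n
      by (rule AE_Om_dense[OF c]) (use t in auto)
    then obtain s where s: "\<And>n. s n \<in> {max 0 (t - 1 / Suc n)<..<t}" "\<And>n. cdf \<mu> (s n) - cdf \<mu>' (s n) = c"
      by metis
    then have s': "s n \<in> {t - 1 / Suc n<..<t}" for n using s(1)[of n] by auto
    have "(\<lambda>n. (cdf (measure P) (s n) - cdf (measure N) (s n)) - (cdf (measure P') (s n) - cdf (measure N') (s n)))
      \<longlonglongrightarrow> (cdf (measure P) t - cdf (measure N) t) - (cdf (measure P') t - cdf (measure N') t)"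
      by (intro tendsto_intros cdf_left_continuous meas s')
    then have "(\<lambda>n. c) \<longlonglongrightarrow> cdf \<mu> t - cdf \<mu>' t"
      unfolding cdf_difference[OF d, symmetric] cdf_difference[OF d', symmetric] s(2) .
    then show ?thesis by (simp add: LIMSEQ_const_iff)
  qed
  have "c = 0"
  proof -
    define s where "s n = 1 / real (Suc (Suc n))" for n
    have s: "s n \<in> {0<..<1 / Suc n}" for n by (simp add: s_def field_simps)
    have "(\<lambda>n. (cdf (measure P) (s n) - cdf (measure N) (s n)) - (cdf (measure P') (s n) - cdf (measure N') (s n)))
      \<longlonglongrightarrow> (0 - 0) - (0 - 0)"
      by (intro tendsto_intros cdf_tendsto_0 meas s)
    moreover have "cdf \<mu> (s n) - cdf \<mu>' (s n) = c" for n
      by (rule eq_c) (auto simp: s_def)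
    ultimately have "(\<lambda>n. c) \<longlonglongrightarrow> 0"
      unfolding cdf_difference[OF d, symmetric] cdf_difference[OF d', symmetric] by simp
    then show ?thesis by (simp add: LIMSEQ_const_iff)
  qed
  have cdf_eq: "cdf \<mu> t = cdf \<mu>' t" for t
  proof -
    consider "t \<le> 0" | "0 < t" "t \<le> 1" | "1 < t" by linarith
    then show ?thesis
    proof cases
      case 1
      then have "{..<t} \<inter> Omega = {}" by auto
      then show ?thesis
        using d d' by (simp add: cdf_def measure_difference_def Borel_Omega_iff)
    next
      case 2
      then show ?thesis using eq_c[of t] \<open>c = 0\<close> by simp
    next
      case 3
      then have "{..<t} \<inter> Omega = {..<1} \<inter> Omega" by auto
      then show ?thesis using eq_c[of 1] \<open>c = 0\<close> by (simp add: cdf_def)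
    qed
  qed
  have Om_eq: "\<mu> Omega = \<mu>' Omega"
    using cdf_eq[of 1] by (simp add: cdf_def Int_absorb1 subset_eq)
  have sm: "signed_measure \<mu>" "signed_measure \<mu>'" using measure_difference_signed d d' by auto
  define G where "G = (\<inter>) Omega ` range lessThan"
  have gen: "Borel_Omega = sigma_sets Omega G"
  proof -
    have "Borel_Omega = (\<inter>) Omega ` sigma_sets UNIV (range lessThan)"
      unfolding Borel_Omega_def sets_restrict_space by (subst borel_Iio) simp
    also have "\<dots> = sigma_sets Omega G"
      unfolding G_def
    proof (rule sigma_sets_Int)
      have "Omega \<in> sets (borel :: real measure)" by simp
      then show "Omega \<in> sigma_sets UNIV (range lessThan)"
        by (subst (asm) borel_Iio) simp
    qed simp
    finally show ?thesis .
  qed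
  have stable: "Int_stable G"
  proof (rule Int_stableI)
    fix a b assume "a \<in> G" "b \<in> G"
    then obtain s t where "a = Omega \<inter> {..<s}" "b = Omega \<inter> {..<t}" by (auto simp: G_def)
    then have "a \<inter> b = Omega \<inter> {..<min s t}" by auto
    then show "a \<inter> b \<in> G" by (simp add: G_def)
  qed
  have GP: "G \<subseteq> Pow Omega" by (auto simp: G_def)
  have "A \<in> sigma_sets Omega G" using A gen by simp
  from stable GP this show ?thesis
  proof (induction rule: sigma_sets_induct_disjoint)
    case (basic B)
    then obtain t where "B = Omega \<inter> {..<t}" by (auto simp: G_def)
    then show ?case using cdf_eq[of t] by (simp add: cdf_def Int_commute)
  next
    case empty
    then show ?case using sm by (simp add: signed_measure_def)
  next
    case (compl B)
    then show ?case
      using signed_measure_Diff[OF d] signed_measure_Diff[OF d'] Om_eq gen by simp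
  next
    case (union B)
    then have "range B \<subseteq> Borel_Omega" "disjoint_family B" using gen by auto
    then have "(\<lambda>n. \<mu> (B n)) sums \<mu> (\<Union>n. B n)" "(\<lambda>n. \<mu>' (B n)) sums \<mu>' (\<Union>n. B n)"
      using sm unfolding signed_measure_def by blast+
    moreover have "(\<lambda>n. \<mu> (B n)) = (\<lambda>n. \<mu>' (B n))" using union by auto
    ultimately show ?case using sums_unique2 by simp
  qed
qed

lemma total_variation_cong:
  assumes "\<And>A. A \<in> Borel_Omega \<Longrightarrow> \<mu> A = \<mu>' A"
  shows "total_variation \<mu> = total_variation \<mu>'"
  unfolding total_variation_def
  by (intro SUP_cong refl sum.cong arg_cong[where f = abs] assms) auto

text \<open>By uniqueness, the measure picked in the definition of \<open>deriv_TV\<close> may be replaced by any other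
  one.\<close>

lemma deriv_TV_eq:
  assumes "is_measure_deriv q \<mu>"
  shows "deriv_TV q = total_variation \<mu>"
  unfolding deriv_TV_def
proof (rule total_variation_cong)
  have "is_measure_deriv q (SOME \<mu>. is_measure_deriv q \<mu>)"
    using assms by (rule someI[of "is_measure_deriv q"])
  then show "(SOME \<mu>. is_measure_deriv q \<mu>) A = \<mu> A" if "A \<in> Borel_Omega" for A
    using is_measure_deriv_unique assms that by blast
qed

lemma total_variation_bdd:
  assumes "measure_difference \<mu> P N"
  shows "bdd_above ((\<lambda>\<A>. \<Sum>A\<in>\<A>. \<bar>\<mu> A\<bar>) ` {\<A>. finite \<A> \<and> \<A> \<subseteq> Borel_Omega \<and> partition_on Omega \<A>})"
proof (rule bdd_aboveI2)
  fix \<A> assume \<A>: "\<A> \<in> {\<A>. finite \<A> \<and> \<A> \<subseteq> Borel_Omega \<and> partition_on Omega \<A>}"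
  have s: "(\<Sum>A\<in>\<A>. measure M A) = measure M Omega"
    if "finite_measure M" "sets M = Borel_Omega" for M
  proof -
    have "disjoint_family_on (\<lambda>A. A) \<A>"
      using \<A> by (auto simp: partition_on_def disjoint_def disjoint_family_on_def)
    then have "measure M (\<Union>A\<in>\<A>. A) = (\<Sum>A\<in>\<A>. measure M A)"
      using \<A> that by (intro finite_measure.finite_measure_finite_Union) auto
    moreover have "(\<Union>A\<in>\<A>. A) = Omega" using \<A> by (auto simp: partition_on_def)
    ultimately show ?thesis by simp
  qed
  have "(\<Sum>A\<in>\<A>. \<bar>\<mu> A\<bar>) \<le> (\<Sum>A\<in>\<A>. measure P A + measure N A)"
  proof (rule sum_mono)
    fix A assume "A \<in> \<A>"
    then have "\<mu> A = measure P A - measure N A" using \<A> assms by (auto simp: measure_difference_def)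
    then show "\<bar>\<mu> A\<bar> \<le> measure P A + measure N A"
      using measure_nonneg[of P A] measure_nonneg[of N A] by linarith
  qed
  also have "\<dots> = measure P Omega + measure N Omega"
    using s[of P] s[of N] assms by (simp add: measure_difference_def sum.distrib)
  finally show "(\<Sum>A\<in>\<A>. \<bar>\<mu> A\<bar>) \<le> measure P Omega + measure N Omega" .
qed

text \<open>The complement of the union turns the disjoint family into a partition.\<close>

lemma total_variation_upper:
  assumes d: "measure_difference \<mu> P N" and "finite I"
    and A: "\<And>i. i \<in> I \<Longrightarrow> A i \<in> Borel_Omega" "\<And>i. i \<in> I \<Longrightarrow> A i \<noteq> {}"
    and disj: "disjoint_family_on A I"
  shows "(\<Sum>i\<in>I. \<bar>\<mu> (A i)\<bar>) \<le> total_variation \<mu>"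
proof -
  define R where "R = Omega - (\<Union>i\<in>I. A i)"
  define \<A> where "\<A> = (A ` I \<union> {R}) - {{}}"
  have inj: "inj_on A I"
  proof (rule inj_onI, rule ccontr)
    fix i j assume ij: "i \<in> I" "j \<in> I" "A i = A j" "i \<noteq> j"
    then have "A i \<inter> A j = {}" using disj unfolding disjoint_family_on_def by blast
    then show False using ij A(2)[of j] by simp
  qed
  have fin: "finite \<A>" using \<open>finite I\<close> by (simp add: \<A>_def)
  have "R \<in> Borel_Omega"
  proof -
    have "Omega \<in> Borel_Omega" by (simp add: Borel_Omega_iff)
    then show ?thesis
      using A(1) \<open>finite I\<close> unfolding R_def Borel_Omega_def
      by (intro sets.Diff sets.finite_UN) simp_all
  qed
  moreover have AI: "A ` I \<subseteq> Borel_Omega" using A(1) by (rule image_subsetI)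
  ultimately have "A ` I \<union> {R} \<subseteq> Borel_Omega" by simp
  then have sub: "\<A> \<subseteq> Borel_Omega" unfolding \<A>_def by (rule order_trans[OF Diff_subset])
  have part: "partition_on Omega \<A>"
  proof (rule partition_onI)
    have "A i \<subseteq> Omega" if "i \<in> I" for i using A(1)[OF that] by (simp add: Borel_Omega_iff)
    then have "(\<Union>i\<in>I. A i) \<subseteq> Omega" by (rule UN_least)
    then have "(\<Union>i\<in>I. A i) \<union> R = Omega" unfolding R_def by (simp add: Un_absorb1)
    moreover have "\<Union> \<A> = (\<Union>i\<in>I. A i) \<union> R" unfolding \<A>_def by blast
    ultimately show "\<Union> \<A> = Omega" by simp
    show "disjnt p q" if pq: "p \<in> \<A>" "q \<in> \<A>" "p \<noteq> q" for p q
    proof -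
      have "A i \<inter> A j = {}" if "i \<in> I" "j \<in> I" "A i \<noteq> A j" for i j
        using disj that unfolding disjoint_family_on_def by metis
      moreover have "A i \<inter> R = {}" if "i \<in> I" for i using that by (auto simp: R_def)
      moreover have "p \<in> A ` I \<union> {R}" "q \<in> A ` I \<union> {R}" using pq(1,2) by (simp_all add: \<A>_def)
      ultimately show ?thesis using pq(3) unfolding disjnt_def by (metis Int_commute UnE imageE singletonD)
    qed
    show "{} \<notin> \<A>" unfolding \<A>_def by blast
  qed
  have "(\<Sum>i\<in>I. \<bar>\<mu> (A i)\<bar>) = (\<Sum>B\<in>A ` I. \<bar>\<mu> B\<bar>)" by (simp add: sum.reindex[OF inj])
  also have "\<dots> \<le> (\<Sum>B\<in>\<A>. \<bar>\<mu> B\<bar>)"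
  proof (rule sum_mono2[OF fin])
    show "A ` I \<subseteq> \<A>" using A(2) unfolding \<A>_def by blast
  qed simp
  also have "\<dots> \<le> total_variation \<mu>"
    unfolding total_variation_def
    by (rule cSUP_upper[OF _ total_variation_bdd[OF d]]) (use fin sub part in simp)
  finally show ?thesis .
qed

lemma total_variation_nonneg:
  assumes "measure_difference \<mu> P N"
  shows "0 \<le> total_variation \<mu>"
  using total_variation_upper[OF assms, of "{} :: nat set" "\<lambda>_. {}"]
  by (simp add: disjoint_family_on_def)

lemma total_variation_least:
  assumes "\<And>\<A>. finite \<A> \<Longrightarrow> \<A> \<subseteq> Borel_Omega \<Longrightarrow> partition_on Omega \<A> \<Longrightarrow> (\<Sum>A\<in>\<A>. \<bar>\<mu> A\<bar>) \<le> c"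
  shows "total_variation \<mu> \<le> c"
  unfolding total_variation_def
proof (rule cSUP_least)
  have "{Omega} \<in> {\<A>. finite \<A> \<and> \<A> \<subseteq> Borel_Omega \<and> partition_on Omega \<A>}"
    by (auto simp: Borel_Omega_iff partition_on_def disjoint_def)
  then show "{\<A>. finite \<A> \<and> \<A> \<subseteq> Borel_Omega \<and> partition_on Omega \<A>} \<noteq> {}" by blast
qed (use assms in auto)

lemma deriv_TV_nonneg:
  assumes "q \<in> BV"
  shows "0 \<le> deriv_TV q"
proof -
  obtain \<mu> where \<mu>: "is_measure_deriv q \<mu>" using assms by (auto simp: BV_def)
  then obtain P N where "measure_difference \<mu> P N" using is_measure_deriv_iff by blast
  then show ?thesis unfolding deriv_TV_eq[OF \<mu>] by (rule total_variation_nonneg)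
qed

text \<open>Derivatives combine linearly, and the total variation is a supremum of convex functions of the
  measure.\<close>

lemma deriv_TV_convex:
  assumes p: "p \<in> BV" and q: "q \<in> BV" and t: "0 \<le> t" "t \<le> 1"
  shows "(\<lambda>x. (1 - t) * p x + t * q x) \<in> BV"
    and "deriv_TV (\<lambda>x. (1 - t) * p x + t * q x) \<le> (1 - t) * deriv_TV p + t * deriv_TV q"
proof -
  obtain \<mu> where ip: "integrable Om p" and \<mu>: "is_measure_deriv p \<mu>" using p by (auto simp: BV_def)
  obtain \<mu>' where iq: "integrable Om q" and \<mu>': "is_measure_deriv q \<mu>'" using q by (auto simp: BV_def)
  obtain P N where d: "measure_difference \<mu> P N" using \<mu> is_measure_deriv_iff by blast
  obtain P' N' where d': "measure_difference \<mu>' P' N'" using \<mu>' is_measure_deriv_iff by blast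
  define \<rho> where "\<rho> A = (1 - t) * \<mu> A + t * \<mu>' A" for A
  have "\<exists>P N. measure_difference \<rho> P N"
  proof (rule measure_difference_exists)
    show "signed_measure (\<lambda>A. (1 - t) * measure P A + t * measure P' A)"
      "signed_measure (\<lambda>A. (1 - t) * measure N A + t * measure N' A)"
      using d d' unfolding measure_difference_def
      by (auto intro!: signed_measure_add signed_measure_cmult finite_measure_signed_measure)
    show "\<rho> A = (1 - t) * measure P A + t * measure P' A - ((1 - t) * measure N A + t * measure N' A)"
      if "A \<in> Borel_Omega" for A
    proof -
      have "\<mu> A = measure P A - measure N A" "\<mu>' A = measure P' A - measure N' A"
        using d d' that by (auto simp: measure_difference_def)
      then show ?thesis unfolding \<rho>_def by (simp only:) (simp add: algebra_simps)
    qed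
  qed (use t in auto)
  then obtain P'' N'' where d'': "measure_difference \<rho> P'' N''" by blast
  have cdf: "cdf \<rho> x = (1 - t) * cdf \<mu> x + t * cdf \<mu>' x" for x by (simp add: cdf_def \<rho>_def)
  have "is_measure_deriv (\<lambda>x. (1 - t) * p x + t * q x) \<rho>"
    unfolding is_measure_deriv_iff
  proof (intro conjI allI impI)
    fix \<phi> assume \<phi>: "test_function \<phi>"
    have "L2_inner p (deriv \<phi>) = L2_inner (cdf \<mu>) (deriv \<phi>)" "L2_inner q (deriv \<phi>) = L2_inner (cdf \<mu>') (deriv \<phi>)"
      using \<mu> \<mu>' \<phi> is_measure_deriv_iff by auto
    moreover have lin: "L2_inner (\<lambda>x. (1 - t) * f x + t * g x) (deriv \<phi>)
        = (1 - t) * L2_inner f (deriv \<phi>) + t * L2_inner g (deriv \<phi>)"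
      if "integrable Om f" "integrable Om g" for f g
      using integrable_mult_test[OF that(1) test_deriv[OF \<phi>]] integrable_mult_test[OF that(2) test_deriv[OF \<phi>]]
      by (simp add: L2_inner_def distrib_right mult.assoc)
    ultimately show "L2_inner (\<lambda>x. (1 - t) * p x + t * q x) (deriv \<phi>) = L2_inner (cdf \<rho>) (deriv \<phi>)"
      using lin[OF ip iq] lin[OF cdf_difference_integrable[OF d] cdf_difference_integrable[OF d']]
      by (simp add: cdf[abs_def])
  qed (use d'' in blast)
  note \<rho> = this
  show "(\<lambda>x. (1 - t) * p x + t * q x) \<in> BV" using \<rho> ip iq by (auto simp: BV_def)
  have "total_variation \<rho> \<le> (1 - t) * total_variation \<mu> + t * total_variation \<mu>'"
  proof (rule total_variation_least)
    fix \<A> assume \<A>: "finite \<A>" "\<A> \<subseteq> Borel_Omega" "partition_on Omega \<A>"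
    have *: "(\<Sum>A\<in>\<A>. \<bar>\<nu> A\<bar>) \<le> total_variation \<nu>" if "measure_difference \<nu> P N" for \<nu> P N
      unfolding total_variation_def
      by (rule cSUP_upper[OF _ total_variation_bdd[OF that]]) (use \<A> in simp)
    have "(\<Sum>A\<in>\<A>. \<bar>\<rho> A\<bar>) \<le> (\<Sum>A\<in>\<A>. (1 - t) * \<bar>\<mu> A\<bar> + t * \<bar>\<mu>' A\<bar>)"
    proof (rule sum_mono)
      fix A
      have "\<bar>\<rho> A\<bar> \<le> \<bar>(1 - t) * \<mu> A\<bar> + \<bar>t * \<mu>' A\<bar>" unfolding \<rho>_def by (rule abs_triangle_ineq)
      then show "\<bar>\<rho> A\<bar> \<le> (1 - t) * \<bar>\<mu> A\<bar> + t * \<bar>\<mu>' A\<bar>" using t by (simp add: abs_mult)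
    qed
    also have "\<dots> = (1 - t) * (\<Sum>A\<in>\<A>. \<bar>\<mu> A\<bar>) + t * (\<Sum>A\<in>\<A>. \<bar>\<mu>' A\<bar>)"
      by (simp add: sum.distrib sum_distrib_left)
    also have "\<dots> \<le> (1 - t) * total_variation \<mu> + t * total_variation \<mu>'"
      using *[OF d] *[OF d'] t by (intro add_mono mult_left_mono) auto
    finally show "(\<Sum>A\<in>\<A>. \<bar>\<rho> A\<bar>) \<le> (1 - t) * total_variation \<mu> + t * total_variation \<mu>'" .
  qed
  then show "deriv_TV (\<lambda>x. (1 - t) * p x + t * q x) \<le> (1 - t) * deriv_TV p + t * deriv_TV q"
    by (simp add: deriv_TV_eq[OF \<rho>] deriv_TV_eq[OF \<mu>] deriv_TV_eq[OF \<mu>'])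
qed

section \<open>The bilinear form\<close>

lemma prim_Lipschitz_abs:
  assumes "integrable Om g" "AE t in Om. \<bar>g t\<bar> \<le> B" "x \<in> {0..1}" "y \<in> {0..1}"
  shows "\<bar>prim g x - prim g y\<bar> \<le> B * \<bar>x - y\<bar>"
proof (cases "x \<le> y")
  case True
  then have "\<bar>x - y\<bar> = y - x" by simp
  then show ?thesis
    using prim_Lipschitz[OF assms(1,2), of x y] True assms(3,4)
    by (simp add: abs_minus_commute[of "prim g x"])
next
  case False
  then have "\<bar>x - y\<bar> = x - y" by simp
  then show ?thesis using prim_Lipschitz[OF assms(1,2), of y x] False assms(3,4) by simp
qed

locale coefficients =
  fixes a d0 :: "real \<Rightarrow> real" and \<nu> L D :: real
  assumes \<nu>_pos: "\<nu> > 0" and a_lower: "\<And>x. x \<in> {0..1} \<Longrightarrow> \<nu> \<le> a x"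
    and a_Lipschitz: "L-lipschitz_on {0..1} a"
    and d0_measurable: "d0 \<in> borel_measurable Om"
    and d0_nonneg: "AE x in Om. 0 \<le> d0 x" and d0_bound: "AE x in Om. \<bar>d0 x\<bar> \<le> D"
begin

text \<open>By the Lipschitz condition, an upper bound of \<open>a\<close> on \<open>[0,1]\<close>.\<close>

definition A :: real where "A = a 0 + L"

lemma L_nonneg: "0 \<le> L"
  using a_Lipschitz by (rule lipschitz_on_nonneg)

lemma D_nonneg: "0 \<le> D"
  using AE_Om_ex[OF d0_bound] by force

lemma a_diff: "x \<in> {0..1} \<Longrightarrow> y \<in> {0..1} \<Longrightarrow> \<bar>a x - a y\<bar> \<le> L * \<bar>x - y\<bar>"
  using lipschitz_onD[OF a_Lipschitz, of x y] by (simp add: dist_real_def)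

lemma a_upper: 
  assumes "x \<in> {0..1}"
  shows "a x \<le> A"
proof -
  have "\<bar>a x - a 0\<bar> \<le> L * \<bar>x\<bar>" using a_diff[of x 0] assms by simp
  also have "\<dots> \<le> L * 1" using assms L_nonneg by (intro mult_left_mono) auto
  finally show ?thesis by (simp add: A_def)
qed

lemma A_pos: "0 < A"
  using \<nu>_pos a_lower[of 0] a_upper[of 0] by simp

lemma a_measurable [measurable]: "a \<in> borel_measurable Om"
proof -
  have "continuous_on Omega a"
    using lipschitz_on_continuous_on[OF a_Lipschitz] by (rule continuous_on_subset) auto
  then show ?thesis by (intro continuous_imp_measurable_on_sets_lebesgue) auto
qed

lemma a_AE_bound: "AE x in Om. \<bar>a x\<bar> \<le> A"
proof (rule AE_I2)
  fix x assume "x \<in> space Om"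
  then have "x \<in> {0..1}" by simp
  then show "\<bar>a x\<bar> \<le> A" using a_lower[of x] a_upper[of x] \<nu>_pos by linarith
qed

lemma in_L2_a: "in_L2 g \<Longrightarrow> in_L2 (\<lambda>x. a x * g x)"
  by (rule in_L2_mult_bounded[OF _ a_measurable a_AE_bound])

lemma in_L2_d0: "in_L2 v \<Longrightarrow> in_L2 (\<lambda>x. d0 x * v x)"
  by (rule in_L2_mult_bounded[OF _ d0_measurable d0_bound])

lemma bilin_rep:
  assumes v: "H10_rep v g" and w: "H10_rep w k"
  shows "bilin a d0 v w = L2_inner (\<lambda>x. a x * g x) k + L2_inner (\<lambda>x. d0 x * v x) w"
proof -
  note v' = H10_rep_weak_deriv_AE[OF v] and w' = H10_rep_weak_deriv_AE[OF w]
  have [measurable]: "g \<in> borel_measurable Om" "k \<in> borel_measurable Om"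
    using v w by (auto simp: H10_rep_def in_L2_def)
  note [measurable] = v'(2) w'(2)
  have "L2_inner (\<lambda>x. a x * weak_deriv v x) (weak_deriv w) = L2_inner (\<lambda>x. a x * g x) k"
  proof (rule L2_inner_cong_AE)
    show "AE x in Om. a x * weak_deriv v x = a x * g x" using v'(1) by eventually_elim simp
  qed (use w'(1) in measurable)
  then show ?thesis by (simp add: bilin_def)
qed

lemma bilin_commute: "bilin a d0 v w = bilin a d0 w v"
  by (simp add: bilin_def L2_inner_def mult_ac)

lemma H10_cmult: "v \<in> H10 \<Longrightarrow> (\<lambda>x. c * v x) \<in> H10"
  using H10_rep_imp_in_H10[OF H10_rep_cmult[OF in_H10_imp_rep]] .

lemma H10_add: "v \<in> H10 \<Longrightarrow> w \<in> H10 \<Longrightarrow> (\<lambda>x. v x + w x) \<in> H10"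
  using H10_rep_imp_in_H10[OF H10_rep_add[OF in_H10_imp_rep in_H10_imp_rep]] .

lemma bilin_cmult_left:
  assumes "v \<in> H10" "w \<in> H10"
  shows "bilin a d0 (\<lambda>x. c * v x) w = c * bilin a d0 v w"
proof -
  note v = in_H10_imp_rep[OF assms(1)] and w = in_H10_imp_rep[OF assms(2)]
  have "bilin a d0 (\<lambda>x. c * v x) w
      = L2_inner (\<lambda>x. c * (a x * weak_deriv v x)) (weak_deriv w) + L2_inner (\<lambda>x. c * (d0 x * v x)) w"
    unfolding bilin_rep[OF H10_rep_cmult[OF v] w] by (simp only: mult.left_commute)
  then show ?thesis
    unfolding bilin_rep[OF v w] L2_inner_cmult_left by (simp only: distrib_left)
qed

lemma bilin_add_left:
  assumes "v \<in> H10" "v' \<in> H10" "w \<in> H10"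
  shows "bilin a d0 (\<lambda>x. v x + v' x) w = bilin a d0 v w + bilin a d0 v' w"
proof -
  note v = in_H10_imp_rep[OF assms(1)] and v' = in_H10_imp_rep[OF assms(2)] and w = in_H10_imp_rep[OF assms(3)]
  have L2: "in_L2 (weak_deriv v)" "in_L2 (weak_deriv v')" "in_L2 (weak_deriv w)"
    using v v' w by (auto simp: H10_rep_def)
  note L2' = H10_rep_in_L2[OF v] H10_rep_in_L2[OF v'] H10_rep_in_L2[OF w]
  show ?thesis
    unfolding bilin_rep[OF H10_rep_add[OF v v'] w] bilin_rep[OF v w] bilin_rep[OF v' w] distrib_left
    using L2 L2' by (simp add: L2_inner_add_left in_L2_a in_L2_d0)
qed

lemma bilin_minus_left:
  assumes "v \<in> H10" "v' \<in> H10" "w \<in> H10"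
  shows "bilin a d0 (\<lambda>x. v x - v' x) w = bilin a d0 v w - bilin a d0 v' w"
  using bilin_add_left[OF assms(1) H10_cmult[OF assms(2), of "-1"] assms(3)]
    bilin_cmult_left[OF assms(2,3), of "-1"] by simp

lemma bilin_minus_right:
  assumes "v \<in> H10" "w \<in> H10" "w' \<in> H10"
  shows "bilin a d0 v (\<lambda>x. w x - w' x) = bilin a d0 v w - bilin a d0 v w'"
  using bilin_minus_left[OF assms(2,3,1)] by (simp add: bilin_commute)

lemma bilin_coercive:
  assumes v: "H10_rep v g"
  shows "\<nu> * (L2_norm g)\<^sup>2 \<le> bilin a d0 v v"
proof -
  have g: "in_L2 g" using v by (simp add: H10_rep_def)
  have "\<nu> * (L2_norm g)\<^sup>2 = (\<integral>x. \<nu> * (g x * g x) \<partial>Om)"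
    by (simp add: L2_norm_sq L2_inner_def)
  also have "\<dots> \<le> (\<integral>x. a x * g x * g x \<partial>Om)"
  proof (rule integral_mono_AE)
    show "AE x in Om. \<nu> * (g x * g x) \<le> a x * g x * g x"
    proof (rule AE_I2)
      fix x assume "x \<in> space Om"
      then have "\<nu> \<le> a x" by (intro a_lower) simp
      then show "\<nu> * (g x * g x) \<le> a x * g x * g x"
        unfolding mult.assoc[of "a x"] by (rule mult_right_mono) simp
    qed
  qed (use in_L2_mult_integrable[OF g g] in_L2_mult_integrable[OF in_L2_a[OF g] g] in simp_all)
  also have "\<dots> \<le> (\<integral>x. a x * g x * g x \<partial>Om) + (\<integral>x. d0 x * v x * v x \<partial>Om)"
  proof -
    have "AE x in Om. 0 \<le> d0 x * v x * v x"
      using d0_nonneg by eventually_elim (simp add: mult.assoc)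
    then show ?thesis using integral_nonneg_AE by auto
  qed
  finally show ?thesis unfolding bilin_rep[OF v v] by (simp only: L2_inner_def)
qed

lemma L2_norm_a: "in_L2 g \<Longrightarrow> L2_norm (\<lambda>x. a x * g x) \<le> A * L2_norm g"
  and L2_norm_d0: "in_L2 v \<Longrightarrow> L2_norm (\<lambda>x. d0 x * v x) \<le> D * L2_norm v"
proof -
  have *: "L2_norm (\<lambda>x. b x * f x) \<le> B * L2_norm f"
    if f: "in_L2 f" and b: "b \<in> borel_measurable Om" "AE x in Om. \<bar>b x\<bar> \<le> B" for f b B
  proof -
    have B: "B \<ge> 0" using AE_Om_ex[OF b(2)] by force
    have "L2_inner (\<lambda>x. b x * f x) (\<lambda>x. b x * f x) \<le> L2_inner (\<lambda>x. B * f x) (\<lambda>x. B * f x)"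
      unfolding L2_inner_self
    proof (rule integral_mono_AE)
      show "AE x in Om. (b x * f x)\<^sup>2 \<le> (B * f x)\<^sup>2"
        using b(2)
      proof eventually_elim
        case (elim x)
        then have "(b x)\<^sup>2 \<le> B\<^sup>2" by (metis abs_ge_zero power2_abs power_mono)
        then show ?case unfolding power_mult_distrib by (rule mult_right_mono) simp
      qed
    qed (use in_L2_mult_bounded[OF f b] in_L2_cmult[OF f, of B] in \<open>simp_all add: in_L2_def\<close>)
    then have "L2_norm (\<lambda>x. b x * f x) \<le> L2_norm (\<lambda>x. B * f x)"
      unfolding L2_norm_def by (rule real_sqrt_le_mono)
    then show ?thesis using B by (simp add: L2_norm_cmult)
  qed
  show "in_L2 g \<Longrightarrow> L2_norm (\<lambda>x. a x * g x) \<le> A * L2_norm g"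
    by (rule *[OF _ a_measurable a_AE_bound])
  show "in_L2 v \<Longrightarrow> L2_norm (\<lambda>x. d0 x * v x) \<le> D * L2_norm v"
    by (rule *[OF _ d0_measurable d0_bound])
qed

lemma bilin_bound:
  assumes v: "H10_rep v g" and w: "H10_rep w k"
  shows "\<bar>bilin a d0 v w\<bar> \<le> (A + D) * L2_norm g * L2_norm k"
proof -
  have g: "in_L2 g" and k: "in_L2 k" using v w by (auto simp: H10_rep_def)
  note v2 = H10_rep_in_L2[OF v] and w2 = H10_rep_in_L2[OF w]
  have "\<bar>L2_inner (\<lambda>x. a x * g x) k\<bar> \<le> L2_norm (\<lambda>x. a x * g x) * L2_norm k"
    by (rule Cauchy_Schwarz[OF in_L2_a[OF g] k])
  also have "\<dots> \<le> A * L2_norm g * L2_norm k"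
    by (intro mult_right_mono L2_norm_a g L2_norm_nonneg)
  finally have 1: "\<bar>L2_inner (\<lambda>x. a x * g x) k\<bar> \<le> A * L2_norm g * L2_norm k" .
  have "\<bar>L2_inner (\<lambda>x. d0 x * v x) w\<bar> \<le> L2_norm (\<lambda>x. d0 x * v x) * L2_norm w"
    by (rule Cauchy_Schwarz[OF in_L2_d0[OF v2] w2])
  also have "\<dots> \<le> D * L2_norm v * L2_norm w"
    by (intro mult_right_mono L2_norm_d0 v2 L2_norm_nonneg)
  also have "\<dots> \<le> D * L2_norm g * L2_norm k"
    by (intro mult_mono mult_left_mono H10_rep_L2_bound[OF v] H10_rep_L2_bound[OF w] D_nonneg L2_norm_nonneg
        mult_nonneg_nonneg)
  finally have 2: "\<bar>L2_inner (\<lambda>x. d0 x * v x) w\<bar> \<le> D * L2_norm g * L2_norm k" .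
  show ?thesis unfolding bilin_rep[OF v w] using 1 2 by (simp add: distrib_right)
qed

text \<open>Coercivity annihilates the difference of two solutions. Stated for subspaces, so that it covers
  the continuous and the discrete equation.\<close>

lemma state_unique:
  assumes W: "W \<subseteq> H10" "\<And>v w. v \<in> W \<Longrightarrow> w \<in> W \<Longrightarrow> (\<lambda>x. v x - w x) \<in> W"
    and u: "is_state W a d0 f u" and u': "is_state W a d0 f u'"
  shows "AE x in Om. u x = u' x"
proof -
  define e where "e = (\<lambda>x. u x - u' x)"
  have W': "u \<in> W" "u' \<in> W" using u u' by (auto simp: is_state_def)
  then have eW: "e \<in> W" using W by (simp add: e_def)
  then have "bilin a d0 u e = bilin a d0 u' e" using u u' by (simp add: is_state_def)
  then have "bilin a d0 e e = 0"
    using bilin_minus_left[of u u' e] W' eW W(1) by (auto simp: e_def)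
  moreover have e: "H10_rep e (weak_deriv e)" using eW W(1) by (intro in_H10_imp_rep) auto
  ultimately have "\<nu> * (L2_norm (weak_deriv e))\<^sup>2 \<le> 0" using bilin_coercive by force
  then have "L2_norm (weak_deriv e) = 0" using \<nu>_pos by (simp add: mult_le_0_iff)
  then have "AE x in Om. \<bar>e x\<bar> \<le> 0" using H10_rep_AE_bound[OF e] by simp
  then show ?thesis by eventually_elim (simp add: e_def)
qed

section \<open>Regularity of solutions\<close>

text \<open>Tested with test functions, the equation says that \<open>a v' + R\<close> is constant, where \<open>R\<close> is a
  primitive of the bounded function \<open>f - d0 v\<close>. Hence \<open>v'\<close> is Lipschitz continuous.\<close>

lemma solution_regularity:
  assumes v: "H10_rep v g" and f: "f \<in> borel_measurable Om" "AE x in Om. \<bar>f x\<bar> \<le> F"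
    and eq: "\<And>\<phi>. test_function \<phi> \<Longrightarrow> bilin a d0 v \<phi> = L2_inner f \<phi>"
  shows "\<exists>k K M. H10_rep v k \<and> (\<forall>x\<in>{0..1}. \<bar>k x\<bar> \<le> K) \<and>
    (\<forall>x\<in>{0..1}. \<forall>y\<in>{0..1}. \<bar>k x - k y\<bar> \<le> M * \<bar>x - y\<bar>)"
proof -
  have g: "in_L2 g" using v by (simp add: H10_rep_def)
  note v2 = H10_rep_in_L2[OF v]
  note [measurable] = f(1) d0_measurable in_L2_measurable[OF v2] in_L2_measurable[OF g]
  define r where "r = (\<lambda>x. f x - d0 x * v x)"
  define B where "B = F + D * L2_norm g"
  have rm [measurable]: "r \<in> borel_measurable Om" unfolding r_def by measurable
  have rB: "AE x in Om. \<bar>r x\<bar> \<le> B"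
    using f(2) d0_bound H10_rep_AE_bound[OF v]
  proof eventually_elim
    case (elim x)
    have "\<bar>d0 x * v x\<bar> \<le> D * L2_norm g"
      unfolding abs_mult using elim D_nonneg by (intro mult_mono) auto
    then show ?case using elim by (simp add: r_def B_def)
  qed
  have B0: "B \<ge> 0" using AE_Om_ex[OF rB] by force
  have ri: "integrable Om r" by (rule integrable_const_bound_Om[OF rm rB])
  have agi: "integrable Om (\<lambda>x. a x * g x)" by (intro in_L2_integrable in_L2_a g)
  have pri: "integrable Om (prim r)"
    by (rule integrable_const_bound_Om[OF _ AE_I2[OF prim_bound[OF ri]]]) measurable
  have "integrable Om (\<lambda>x. a x * g x + prim r x)" using agi pri by simp
  then obtain c where c: "AE x in Om. a x * g x + prim r x = c"
  proof (rule deriv_test_zero_const_AE)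
    fix \<phi> assume \<phi>: "test_function \<phi>"
    have d: "integrable Om (deriv \<phi>)" by (intro test_integrable test_deriv \<phi>)
    have "bilin a d0 v \<phi> = L2_inner f \<phi>" by (rule eq[OF \<phi>])
    moreover have "bilin a d0 v \<phi> = L2_inner (\<lambda>x. a x * g x) (deriv \<phi>) + L2_inner (\<lambda>x. d0 x * v x) \<phi>"
      by (rule bilin_rep[OF v H10_rep_test[OF \<phi>]])
    moreover have "L2_inner r \<phi> = L2_inner f \<phi> - L2_inner (\<lambda>x. d0 x * v x) \<phi>"
      unfolding r_def using bounded_in_L2[OF f] in_L2_d0[OF v2] test_in_L2[OF \<phi>]
      by (rule L2_inner_minus_left)
    moreover have "L2_inner (prim r) (deriv \<phi>) = - L2_inner r \<phi>"
    proof -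
      have "L2_inner (prim r) (deriv \<phi>) = (\<integral>x. deriv \<phi> x * prim r x \<partial>Om)"
        by (simp add: L2_inner_def mult.commute)
      also have "\<dots> = - (\<integral>x. r x * prim (deriv \<phi>) x \<partial>Om)"
        by (simp add: prim_by_parts[OF d ri] integral_deriv_test[OF \<phi>])
      also have "(\<integral>x. r x * prim (deriv \<phi>) x \<partial>Om) = L2_inner r \<phi>"
        unfolding L2_inner_def
        by (intro Bochner_Integration.integral_cong) (simp_all add: test_eq_prim[OF \<phi>])
      finally show ?thesis .
    qed
    ultimately have "L2_inner (\<lambda>x. a x * g x) (deriv \<phi>) + L2_inner (prim r) (deriv \<phi>) = 0" by simp
    then show "(\<integral>x. (a x * g x + prim r x) * deriv \<phi> x \<partial>Om) = 0"
      using integrable_mult_test[OF agi test_deriv[OF \<phi>]] integrable_mult_test[OF pri test_deriv[OF \<phi>]]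
      by (simp add: L2_inner_def distrib_right)
  qed blast
  define k where "k x = (c - prim r x) / a x" for x
  define m where "m = \<bar>c\<bar> + (\<integral>t. \<bar>r t\<bar> \<partial>Om)"
  have num: "\<bar>c - prim r x\<bar> \<le> m" for x using prim_bound[OF ri, of x] by (simp add: m_def)
  have m0: "m \<ge> 0" using num[of 0] by linarith
  have "AE x in Om. g x = k x"
  proof (rule AE_mp[OF c], rule AE_I2, rule impI)
    fix x assume "x \<in> space Om" and e: "a x * g x + prim r x = c"
    then have "a x > 0" using a_lower[of x] \<nu>_pos by simp
    then show "g x = k x" using e by (simp add: k_def field_simps)
  qed
  then have "H10_rep v k" by (rule H10_rep_cong_AE[OF v]) (simp add: k_def[abs_def])
  moreover have "\<bar>k x\<bar> \<le> m / \<nu>" if "x \<in> {0..1}" for x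
    unfolding k_def abs_divide using num[of x] a_lower[OF that] \<nu>_pos m0 by (intro frac_le) auto
  moreover have "\<bar>k x - k y\<bar> \<le> (B / \<nu> + m * L / \<nu>\<^sup>2) * \<bar>x - y\<bar>" if xy: "x \<in> {0..1}" "y \<in> {0..1}" for x y
  proof -
    have ax: "a x \<ge> \<nu>" "a y \<ge> \<nu>" using a_lower xy by auto
    then have ap: "a x > 0" "a y > 0" using \<nu>_pos by auto
    have "k x - k y = (prim r y - prim r x) / a x + (c - prim r y) * (a y - a x) / (a x * a y)"
      using ap by (simp add: k_def field_simps)
    also have "\<bar>\<dots>\<bar> \<le> \<bar>(prim r y - prim r x) / a x\<bar> + \<bar>(c - prim r y) * (a y - a x) / (a x * a y)\<bar>"
      by (rule abs_triangle_ineq)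
    also have "\<dots> \<le> B * \<bar>x - y\<bar> / \<nu> + m * (L * \<bar>x - y\<bar>) / (\<nu> * \<nu>)"
    proof (rule add_mono)
      have "\<bar>prim r y - prim r x\<bar> \<le> B * \<bar>x - y\<bar>"
        using prim_Lipschitz_abs[OF ri rB xy] by (simp only: abs_minus_commute)
      then show "\<bar>(prim r y - prim r x) / a x\<bar> \<le> B * \<bar>x - y\<bar> / \<nu>"
        unfolding abs_divide using ax ap \<nu>_pos B0 by (intro frac_le) auto
      have "\<bar>(c - prim r y) * (a y - a x)\<bar> \<le> m * (L * \<bar>x - y\<bar>)"
        unfolding abs_mult using num[of y] a_diff[OF xy] m0
        by (intro mult_mono) (auto simp: abs_minus_commute)
      then show "\<bar>(c - prim r y) * (a y - a x) / (a x * a y)\<bar> \<le> m * (L * \<bar>x - y\<bar>) / (\<nu> * \<nu>)"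
        unfolding abs_divide using ax ap \<nu>_pos m0 L_nonneg
        by (intro frac_le mult_pos_pos) (auto simp: abs_mult intro!: mult_mono)
    qed
    also have "\<dots> = (B / \<nu> + m * L / \<nu>\<^sup>2) * \<bar>x - y\<bar>"
      by (simp add: power2_eq_square distrib_right)
    finally show ?thesis .
  qed
  ultimately show ?thesis by blast
qed

section \<open>Solvability of the state equation\<close>

text \<open>Integrating the equation twice gives a Volterra equation; in the supremum norm with weight
  \<open>exp (- \<kappa> x)\<close> its right hand side is a contraction for large \<open>\<kappa>\<close>.\<close>

definition volterra :: "(real \<Rightarrow> real) \<Rightarrow> real \<Rightarrow> real" where
  "volterra v = prim (\<lambda>s. prim (\<lambda>t. d0 t * v t) s / a s)"

lemma a_recip: "x \<in> Omega \<Longrightarrow> \<bar>1 / a x\<bar> \<le> 1 / \<nu>"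
  using a_lower[of x] \<nu>_pos by (simp add: frac_le)

lemma integrable_div_a:
  assumes "integrable Om f"
  shows "integrable Om (\<lambda>s. f s / a s)"
proof -
  have "integrable Om (\<lambda>s. f s * (1 / a s))"
    by (rule integrable_mult_bounded[OF assms _ AE_I2[of _ "\<lambda>x. \<bar>1 / a x\<bar> \<le> 1 / \<nu>"]]) (use a_recip in simp_all)
  then show ?thesis by simp
qed

lemma integrable_d0:
  assumes "integrable Om f"
  shows "integrable Om (\<lambda>s. d0 s * f s)"
  using integrable_mult_bounded[OF assms d0_measurable d0_bound] by (simp add: mult.commute)

lemma prim_integrable:
  assumes "integrable Om f"
  shows "integrable Om (prim f)"
  by (rule integrable_const_bound_Om[OF prim_measurable(1) AE_I2[OF prim_bound[OF assms]]])
    (use assms in simp)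

lemma prim_mono:
  assumes "integrable Om f" "integrable Om g" "AE x in Om. f x \<le> g x"
  shows "prim f x \<le> prim g x"
  unfolding prim_def
proof (rule integral_mono_AE)
  show "AE t in Om. indicat_real {..x} t * f t \<le> indicat_real {..x} t * g t"
    using assms(3) by eventually_elim (simp add: indicator_def)
qed (use assms integrable_indicator_mult in auto)

lemma prim_abs: "integrable Om f \<Longrightarrow> \<bar>prim f x\<bar> \<le> prim (\<lambda>t. \<bar>f t\<bar>) x"
  unfolding prim_def using integral_abs_bound[of Om "\<lambda>t. indicat_real {..x} t * f t"]
  by (simp add: abs_mult)

lemma prim_exp_le:
  assumes "\<kappa> > 0" "0 \<le> x" "x \<le> 1"
  shows "prim (\<lambda>t. exp (\<kappa> * t)) x \<le> exp (\<kappa> * x) / \<kappa>"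
proof -
  have "integrable Om (\<lambda>t. exp (\<kappa> * t))"
    by (rule integrable_const_bound_Om[of _ "exp \<kappa>"]) (use assms(1) in \<open>auto intro: borel_Om\<close>)
  then have "prim (\<lambda>t. exp (\<kappa> * t)) x = exp (\<kappa> * x) / \<kappa> - exp (\<kappa> * 0) / \<kappa>"
    using assms
    by (intro prim_fundamental[where S = "{}"]) (auto intro!: continuous_intros derivative_eq_intros)
  then show ?thesis using assms by simp
qed

lemma volterra_weighted:
  assumes v: "v \<in> borel_measurable Om" and "\<kappa> > 0" and m: "\<And>t. t \<in> Omega \<Longrightarrow> \<bar>v t\<bar> \<le> m * exp (\<kappa> * t)"
    and x: "x \<in> {0..1}"
  shows "\<bar>volterra v x\<bar> \<le> D / (\<nu> * \<kappa>\<^sup>2) * m * exp (\<kappa> * x)"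
proof -
  have "0 \<le> m * exp (\<kappa> * (1/2))" using m[of "1/2"] by (intro order_trans[OF abs_ge_zero]) auto
  then have m0: "m \<ge> 0" by (simp add: zero_le_mult_iff)
  have ei: "integrable Om (\<lambda>t. exp (\<kappa> * t))"
    by (rule integrable_const_bound_Om[of _ "exp \<kappa>"]) (use assms(2) in \<open>auto intro: borel_Om\<close>)
  have vi: "integrable Om v"
  proof (rule integrable_const_bound_Om[OF v])
    show "AE x in Om. \<bar>v x\<bar> \<le> m * exp \<kappa>"
    proof (rule AE_I2)
      fix t assume t: "t \<in> space Om"
      then have "exp (\<kappa> * t) \<le> exp \<kappa>" using assms(2) by simp
      then have "m * exp (\<kappa> * t) \<le> m * exp \<kappa>" using m0 by (rule mult_left_mono)
      then show "\<bar>v t\<bar> \<le> m * exp \<kappa>" using m[of t] t by simp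
    qed
  qed
  have di: "integrable Om (\<lambda>t. d0 t * v t)" by (rule integrable_d0[OF vi])
  have inner: "\<bar>prim (\<lambda>t. d0 t * v t) s\<bar> \<le> D * m / \<kappa> * exp (\<kappa> * s)" if s: "s \<in> Omega" for s
  proof -
    have "\<bar>prim (\<lambda>t. d0 t * v t) s\<bar> \<le> prim (\<lambda>t. \<bar>d0 t * v t\<bar>) s" by (rule prim_abs[OF di])
    also have "\<dots> \<le> prim (\<lambda>t. (D * m) * exp (\<kappa> * t)) s"
    proof (rule prim_mono)
      show "AE t in Om. \<bar>d0 t * v t\<bar> \<le> (D * m) * exp (\<kappa> * t)"
      proof (rule AE_mp[OF d0_bound], rule AE_I2, rule impI)
        fix t assume "t \<in> space Om" "\<bar>d0 t\<bar> \<le> D"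
        then have "\<bar>d0 t\<bar> * \<bar>v t\<bar> \<le> D * (m * exp (\<kappa> * t))" using m[of t] D_nonneg by (intro mult_mono) auto
        then show "\<bar>d0 t * v t\<bar> \<le> (D * m) * exp (\<kappa> * t)" by (simp add: abs_mult mult.assoc)
      qed
    qed (use di ei in simp_all)
    also have "\<dots> = D * m * prim (\<lambda>t. exp (\<kappa> * t)) s" by (rule prim_cmult)
    also have "\<dots> \<le> D * m * (exp (\<kappa> * s) / \<kappa>)"
      using prim_exp_le[OF assms(2), of s] s D_nonneg m0 by (intro mult_left_mono) auto
    finally show ?thesis by simp
  qed
  have oi: "integrable Om (\<lambda>s. prim (\<lambda>t. d0 t * v t) s / a s)"
    by (intro integrable_div_a prim_integrable di)
  have "\<bar>volterra v x\<bar> \<le> prim (\<lambda>s. \<bar>prim (\<lambda>t. d0 t * v t) s / a s\<bar>) x"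
    unfolding volterra_def by (rule prim_abs[OF oi])
  also have "\<dots> \<le> prim (\<lambda>s. (D * m / \<kappa> / \<nu>) * exp (\<kappa> * s)) x"
  proof (rule prim_mono)
    show "AE s in Om. \<bar>prim (\<lambda>t. d0 t * v t) s / a s\<bar> \<le> (D * m / \<kappa> / \<nu>) * exp (\<kappa> * s)"
    proof (rule AE_I2)
      fix s assume "s \<in> space Om"
      then have s: "s \<in> Omega" by simp
      have "\<bar>prim (\<lambda>t. d0 t * v t) s / a s\<bar> \<le> (D * m / \<kappa> * exp (\<kappa> * s)) / \<nu>"
        unfolding abs_divide using inner[OF s] a_lower[of s] s \<nu>_pos D_nonneg m0 assms(2)
        by (intro frac_le) auto
      then show "\<bar>prim (\<lambda>t. d0 t * v t) s / a s\<bar> \<le> (D * m / \<kappa> / \<nu>) * exp (\<kappa> * s)" by simp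
    qed
  qed (use integrable_abs[OF oi] ei in simp_all)
  also have "\<dots> = (D * m / \<kappa> / \<nu>) * prim (\<lambda>t. exp (\<kappa> * t)) x" by (rule prim_cmult)
  also have "\<dots> \<le> (D * m / \<kappa> / \<nu>) * (exp (\<kappa> * x) / \<kappa>)"
    using prim_exp_le[OF assms(2), of x] x D_nonneg m0 \<nu>_pos assms(2) by (intro mult_left_mono) auto
  finally show ?thesis by (simp add: power2_eq_square mult_ac)
qed

lemma prim_continuous_on:
  assumes "integrable Om g" "AE t in Om. \<bar>g t\<bar> \<le> B"
  shows "continuous_on {0..1} (prim g)"
proof -
  have B: "B \<ge> 0" using AE_Om_ex[OF assms(2)] by force
  have "B-lipschitz_on {0..1} (prim g)"
  proof (rule lipschitz_onI)
    fix x y :: real assume "x \<in> {0..1}" "y \<in> {0..1}"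
    then show "dist (prim g x) (prim g y) \<le> B * dist x y"
      unfolding dist_real_def by (rule prim_Lipschitz_abs[OF assms])
  qed (rule B)
  then show ?thesis by (rule lipschitz_on_continuous_on)
qed

lemma volterra_continuous_on:
  assumes "integrable Om v"
  shows "continuous_on {0..1} (volterra v)"
  unfolding volterra_def
proof (rule prim_continuous_on)
  have di: "integrable Om (\<lambda>t. d0 t * v t)" by (rule integrable_d0[OF assms])
  show "integrable Om (\<lambda>s. prim (\<lambda>t. d0 t * v t) s / a s)"
    by (intro integrable_div_a prim_integrable di)
  show "AE s in Om. \<bar>prim (\<lambda>t. d0 t * v t) s / a s\<bar> \<le> (\<integral>t. \<bar>d0 t * v t\<bar> \<partial>Om) / \<nu>"
  proof (rule AE_I2)
    fix s assume "s \<in> space Om"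
    then show "\<bar>prim (\<lambda>t. d0 t * v t) s / a s\<bar> \<le> (\<integral>t. \<bar>d0 t * v t\<bar> \<partial>Om) / \<nu>"
      unfolding abs_divide using prim_bound[OF di, of s] a_lower[of s] \<nu>_pos
      by (intro frac_le) (auto intro!: integral_nonneg_AE)
  qed
qed

lemma volterra_diff:
  assumes "integrable Om v" "integrable Om w"
  shows "volterra (\<lambda>t. v t - w t) x = volterra v x - volterra w x"
proof -
  have "prim (\<lambda>t. d0 t * (v t - w t)) s / a s
      = prim (\<lambda>t. d0 t * v t) s / a s - prim (\<lambda>t. d0 t * w t) s / a s" for s
    using prim_minus[OF integrable_d0[OF assms(1)] integrable_d0[OF assms(2)], of s]
    by (simp add: right_diff_distrib diff_divide_distrib)
  then show ?thesis
    unfolding volterra_def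
    using prim_minus[OF integrable_div_a[OF prim_integrable[OF integrable_d0[OF assms(1)]]]
        integrable_div_a[OF prim_integrable[OF integrable_d0[OF assms(2)]]], of x]
    by simp
qed

lemma volterra_solution:
  assumes b: "continuous_on {0..1} b"
  shows "\<exists>v. continuous_on {0..1} v \<and> (\<forall>x\<in>{0..1}. v x = b x + volterra v x)"
proof -
  \<comment> \<open>Since \<open>\<kappa> \<ge> 1\<close>, this choice gives \<open>\<kappa>\<^sup>2 \<ge> 2 D / \<nu>\<close> and hence the contraction constant \<open>1/2\<close>.\<close>
  define \<kappa> where "\<kappa> = 1 + 2 * D / \<nu>"
  have \<kappa>: "\<kappa> \<ge> 1" "\<kappa> > 0" using D_nonneg \<nu>_pos by (auto simp: \<kappa>_def add_pos_nonneg)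
  have "2 * D / \<nu> \<le> \<kappa> * \<kappa>"
  proof -
    have "2 * D / \<nu> \<le> \<kappa>" by (simp add: \<kappa>_def)
    also have "\<dots> \<le> \<kappa> * \<kappa>" using \<kappa> by simp
    finally show ?thesis .
  qed
  then have half: "D / (\<nu> * \<kappa>\<^sup>2) \<le> 1 / 2"
    using \<nu>_pos \<kappa>(2) by (simp add: field_simps power2_eq_square)
  \<comment> \<open>The fixed point is sought in the complete space of bounded continuous functions on the whole
    line; composition with \<open>cl\<close> extends functions from \<open>[0,1]\<close> by constants.\<close>
  define cl where "cl x = max 0 (min 1 x)" for x :: real
  have cl: "cl x \<in> {0..1}" for x by (simp add: cl_def)
  have cl_id: "x \<in> {0..1} \<Longrightarrow> cl x = x" for x by (simp add: cl_def)
  have cl_cont: "continuous_on UNIV cl" unfolding cl_def by (intro continuous_intros)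
  \<comment> \<open>Elements \<open>w\<close> of that space are weighted functions; \<open>lift w\<close> removes the weight.\<close>
  define lift where "lift w t = exp (\<kappa> * t) * apply_bcontfun w t" for w :: "real \<Rightarrow>\<^sub>C real" and t
  have wc: "continuous_on UNIV (apply_bcontfun w)" for w :: "real \<Rightarrow>\<^sub>C real"
    by (rule continuous_on_apply_bcontfun)
  have lm: "lift w \<in> borel_measurable Om" for w
    unfolding lift_def
    by (intro borel_Om borel_measurable_continuous_onI continuous_intros wc)
  have lb: "\<bar>lift w t\<bar> \<le> norm w * exp (\<kappa> * t)" for w t
    using norm_bounded[of w t] by (simp add: lift_def abs_mult mult.commute)
  have li: "integrable Om (lift w)" for w
  proof (rule integrable_const_bound_Om[OF lm])
    show "AE x in Om. \<bar>lift w x\<bar> \<le> norm w * exp \<kappa>"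
    proof (rule AE_I2)
      fix t assume "t \<in> space Om"
      then have "exp (\<kappa> * t) \<le> exp \<kappa>" using \<kappa> by simp
      then have "norm w * exp (\<kappa> * t) \<le> norm w * exp \<kappa>" by (intro mult_left_mono) auto
      then show "\<bar>lift w t\<bar> \<le> norm w * exp \<kappa>" using lb[of w t] by linarith
    qed
  qed
  define T0 where "T0 w x = exp (- \<kappa> * cl x) * (b (cl x) + volterra (lift w) (cl x))" for w x
  have T0: "T0 w \<in> bcontfun" for w
  proof -
    have c1: "continuous_on {0..1} (\<lambda>y. exp (- \<kappa> * y) * (b y + volterra (lift w) y))"
      by (intro continuous_intros b volterra_continuous_on li)
    then have c2: "continuous_on UNIV (T0 w)"
      unfolding T0_def by (rule continuous_on_compose2[OF _ cl_cont]) (use cl in auto)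
    have "bounded ((\<lambda>y. exp (- \<kappa> * y) * (b y + volterra (lift w) y)) ` {0..1})"
      by (intro compact_imp_bounded compact_continuous_image c1) simp
    then obtain B where "\<forall>y\<in>{0..1}. norm (exp (- \<kappa> * y) * (b y + volterra (lift w) y)) \<le> B"
      unfolding bounded_iff by auto
    then have "norm (T0 w x) \<le> B" for x unfolding T0_def using cl by blast
    with c2 show ?thesis by (rule bcontfun_normI)
  qed
  define T where "T w = Bcontfun (T0 w)" for w
  have T_app: "apply_bcontfun (T w) = T0 w" for w
    unfolding T_def by (rule Bcontfun_inverse[OF T0])
  have contr: "dist (T w) (T w') \<le> 1 / 2 * dist w w'" for w w'
  proof (rule dist_bound)
    fix x
    have "volterra (lift w) (cl x) - volterra (lift w') (cl x) = volterra (\<lambda>t. lift w t - lift w' t) (cl x)"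
      by (rule volterra_diff[OF li li, symmetric])
    also have "\<bar>\<dots>\<bar> \<le> D / (\<nu> * \<kappa>\<^sup>2) * dist w w' * exp (\<kappa> * cl x)"
    proof (rule volterra_weighted[OF _ \<kappa>(2) _ cl])
      show "(\<lambda>t. lift w t - lift w' t) \<in> borel_measurable Om" using lm[of w] lm[of w'] by simp
      fix t
      have "\<bar>lift w t - lift w' t\<bar> = dist (apply_bcontfun w t) (apply_bcontfun w' t) * exp (\<kappa> * t)"
        unfolding lift_def right_diff_distrib[symmetric] abs_mult dist_real_def by simp
      also have "\<dots> \<le> dist w w' * exp (\<kappa> * t)"
        by (rule mult_right_mono[OF dist_bounded]) simp
      finally show "\<bar>lift w t - lift w' t\<bar> \<le> dist w w' * exp (\<kappa> * t)" .
    qed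
    also have "\<dots> \<le> 1 / 2 * dist w w' * exp (\<kappa> * cl x)"
      using half by (intro mult_right_mono) auto
    finally have *: "\<bar>volterra (lift w) (cl x) - volterra (lift w') (cl x)\<bar> \<le> 1 / 2 * dist w w' * exp (\<kappa> * cl x)" .
    have "dist (T0 w x) (T0 w' x) = exp (- \<kappa> * cl x) * \<bar>volterra (lift w) (cl x) - volterra (lift w') (cl x)\<bar>"
      by (simp add: T0_def dist_real_def right_diff_distrib[symmetric] abs_mult)
    also have "\<dots> \<le> exp (- \<kappa> * cl x) * (1 / 2 * dist w w' * exp (\<kappa> * cl x))"
      by (rule mult_left_mono[OF *]) simp
    also have "\<dots> = 1 / 2 * dist w w'" by (simp add: exp_minus)
    finally show "dist (apply_bcontfun (T w) x) (apply_bcontfun (T w') x) \<le> 1 / 2 * dist w w'"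
      by (simp add: T_app)
  qed
  have "\<exists>!w. T w = w"
    by (rule banach_fix_type[where c = "1/2"]) (use contr in simp_all)
  then obtain w where w: "T w = w" by blast
  have fix_eq: "apply_bcontfun w x = T0 w x" for x using T_app[of w] w by simp
  show ?thesis
  proof (intro exI[of _ "lift w"] conjI ballI)
    show "continuous_on {0..1} (lift w)"
      unfolding lift_def by (intro continuous_intros continuous_on_subset[OF wc]) auto
    fix x :: real assume "x \<in> {0..1}"
    then have "lift w x = exp (\<kappa> * x) * (exp (- \<kappa> * x) * (b x + volterra (lift w) x))"
      by (simp add: lift_def fix_eq T0_def cl_id)
    then show "lift w x = b x + volterra (lift w) x" by (simp add: exp_minus)
  qed
qed

end

context coefficients
begin

text \<open>Integration by parts moves the derivative from the function \<open>w\<close> onto the flux \<open>a u'\<close>.\<close>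

lemma flux_imp_weak_solution:
  assumes u: "H10_rep u g" and f: "integrable Om f"
    and flux: "AE x in Om. a x * g x = s + prim (\<lambda>t. d0 t * u t - f t) x" and w: "H10_rep w k"
  shows "bilin a d0 u w = L2_inner f w"
proof -
  have g: "in_L2 g" and k: "in_L2 k" and k0: "(\<integral>x. k x \<partial>Om) = 0" and wp: "AE x in Om. w x = prim k x"
    using u w by (auto simp: H10_rep_def)
  note u2 = H10_rep_in_L2[OF u] and w2 = H10_rep_in_L2[OF w]
  define h where "h = (\<lambda>t. d0 t * u t - f t)"
  have di: "integrable Om (\<lambda>t. d0 t * u t)" by (intro in_L2_integrable in_L2_d0 u2)
  have h: "integrable Om h" unfolding h_def using di f by simp
  have ki: "integrable Om k" by (rule in_L2_integrable[OF k])
  note [measurable] = borel_measurable_integrable[OF h] in_L2_measurable[OF g] in_L2_measurable[OF k]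
    in_L2_measurable[OF w2] borel_measurable_integrable[OF f]
  have kpi: "integrable Om (\<lambda>x. k x * prim h x)"
    by (rule integrable_mult_bounded[OF ki _ AE_I2[OF prim_bound[OF h]]]) measurable
  have fw: "integrable Om (\<lambda>x. f x * w x)"
    by (rule integrable_mult_bounded[OF f _ H10_rep_AE_bound[OF w]]) measurable
  have "L2_inner (\<lambda>x. a x * g x) k = (\<integral>x. s * k x + k x * prim h x \<partial>Om)"
    unfolding L2_inner_def
  proof (rule integral_cong_AE)
    show "AE x in Om. a x * g x * k x = s * k x + k x * prim h x"
      using flux by eventually_elim (simp add: h_def algebra_simps)
  qed measurable
  also have "\<dots> = (\<integral>x. k x * prim h x \<partial>Om)" using ki kpi by (simp add: k0)
  also have "\<dots> = - (\<integral>x. h x * prim k x \<partial>Om)" by (simp add: prim_by_parts[OF ki h] k0)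
  also have "(\<integral>x. h x * prim k x \<partial>Om) = (\<integral>x. d0 x * u x * w x - f x * w x \<partial>Om)"
  proof (rule integral_cong_AE)
    show "AE x in Om. h x * prim k x = d0 x * u x * w x - f x * w x"
      using wp by eventually_elim (simp add: h_def left_diff_distrib)
    show "(\<lambda>x. d0 x * u x * w x - f x * w x) \<in> borel_measurable Om"
      using in_L2_measurable[OF in_L2_d0[OF u2]] by measurable
  qed measurable
  also have "\<dots> = L2_inner (\<lambda>x. d0 x * u x) w - L2_inner f w"
    using in_L2_mult_integrable[OF in_L2_d0[OF u2] w2] fw by (simp add: L2_inner_def)
  finally show ?thesis unfolding bilin_rep[OF u w] by simp
qed

text \<open>Shooting: the solution with flux zero at the left end point is corrected by a multiple of
  the homogeneous solution with flux one there. The latter does not vanish at the right end point,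
  since otherwise it would be a nonzero element of \<open>H10\<close> of zero energy.\<close>

lemma state_exists:
  assumes f: "integrable Om f"
  shows "\<exists>u. is_state H10 a d0 f u"
proof -
  have recip: "integrable Om (\<lambda>s. 1 / a s)" by (intro integrable_div_a) simp
  define b1 where "b1 = prim (\<lambda>s. 1 / a s)"
  define b2 where "b2 = prim (\<lambda>s. (- prim f s) / a s)"
  have pf: "integrable Om (\<lambda>s. - prim f s)" using prim_integrable[OF f] by simp
  have b2i: "integrable Om (\<lambda>s. (- prim f s) / a s)" by (rule integrable_div_a[OF pf])
  have "continuous_on {0..1} b1"
    unfolding b1_def by (rule prim_continuous_on[OF recip AE_I2[of _ "\<lambda>x. \<bar>1 / a x\<bar> \<le> 1 / \<nu>"]]) (simp only: space_lebesgue_on a_recip)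
  then obtain u1 where u1c: "continuous_on {0..1} u1" and u1: "\<And>x. x \<in> {0..1} \<Longrightarrow> u1 x = b1 x + volterra u1 x"
    using volterra_solution by blast
  have "continuous_on {0..1} b2"
    unfolding b2_def
  proof (rule prim_continuous_on[OF b2i AE_I2])
    fix s assume "s \<in> space Om"
    then show "\<bar>- prim f s / a s\<bar> \<le> (\<integral>t. \<bar>f t\<bar> \<partial>Om) / \<nu>"
      unfolding abs_divide using prim_bound[OF f, of s] a_lower[of s] \<nu>_pos
      by (intro frac_le) (auto intro!: integral_nonneg_AE)
  qed
  then obtain u2 where u2c: "continuous_on {0..1} u2" and u2: "\<And>x. x \<in> {0..1} \<Longrightarrow> u2 x = b2 x + volterra u2 x"
    using volterra_solution by blast
  have cm: "v \<in> borel_measurable Om" and ci: "integrable Om v" if c: "continuous_on {0..1} v" for v :: "real \<Rightarrow> real"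
  proof -
    show m: "v \<in> borel_measurable Om"
      by (intro continuous_imp_measurable_on_sets_lebesgue continuous_on_subset[OF c]) auto
    have "bounded (v ` {0..1})" by (intro compact_imp_bounded compact_continuous_image c) simp
    then obtain B where "\<forall>x\<in>{0..1}. \<bar>v x\<bar> \<le> B" unfolding bounded_iff by auto
    then have "AE x in Om. \<bar>v x\<bar> \<le> B" by (intro AE_I2) auto
    with m show "integrable Om v" by (rule integrable_const_bound_Om)
  qed
  have d1: "integrable Om (\<lambda>t. d0 t * u1 t)" and d2: "integrable Om (\<lambda>t. d0 t * u2 t)"
    by (intro integrable_d0 ci u1c u2c)+
  define g1 where "g1 s = (1 + prim (\<lambda>t. d0 t * u1 t) s) / a s" for s
  define g2 where "g2 s = (- prim f s + prim (\<lambda>t. d0 t * u2 t) s) / a s" for s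
  have g1i: "integrable Om (\<lambda>s. prim (\<lambda>t. d0 t * u1 t) s / a s)"
    and g2i: "integrable Om (\<lambda>s. prim (\<lambda>t. d0 t * u2 t) s / a s)"
    by (intro integrable_div_a prim_integrable d1 d2)+
  have u1p: "u1 x = prim g1 x" if "x \<in> {0..1}" for x
    using u1[OF that] prim_add[OF recip g1i, of x]
    by (simp add: b1_def volterra_def g1_def[abs_def] add_divide_distrib)
  have u2p: "u2 x = prim g2 x" if "x \<in> {0..1}" for x
    using u2[OF that] prim_add[OF b2i g2i, of x]
    by (simp only: b2_def volterra_def g2_def[abs_def] add_divide_distrib)
  have L2: "in_L2 (\<lambda>s. p s / a s)" if p: "p \<in> borel_measurable Om" and B: "\<And>s. \<bar>p s\<bar> \<le> B" for p B
  proof (rule bounded_in_L2)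
    show "AE s in Om. \<bar>p s / a s\<bar> \<le> B / \<nu>"
    proof (rule AE_I2)
      fix s assume "s \<in> space Om"
      then show "\<bar>p s / a s\<bar> \<le> B / \<nu>"
        unfolding abs_divide using B[of s] order_trans[OF abs_ge_zero B[of s]] a_lower[of s] \<nu>_pos
        by (intro frac_le) auto
    qed
  qed (use p in simp)
  have g1L2: "in_L2 g1"
    unfolding g1_def
  proof (rule L2)
    show "\<bar>1 + prim (\<lambda>t. d0 t * u1 t) s\<bar> \<le> 1 + (\<integral>t. \<bar>d0 t * u1 t\<bar> \<partial>Om)" for s
      using prim_bound[OF d1, of s] by linarith
  qed (use borel_measurable_integrable[OF d1] in simp)
  have g2L2: "in_L2 g2"
    unfolding g2_def
  proof (rule L2)
    show "\<bar>- prim f s + prim (\<lambda>t. d0 t * u2 t) s\<bar> \<le> (\<integral>t. \<bar>f t\<bar> \<partial>Om) + (\<integral>t. \<bar>d0 t * u2 t\<bar> \<partial>Om)" for s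
      using prim_bound[OF d2, of s] prim_bound[OF f, of s] by linarith
  qed (use borel_measurable_integrable[OF d2] borel_measurable_integrable[OF f] in simp)
  have ap: "a x \<noteq> 0" if "x \<in> Omega" for x using a_lower[of x] that \<nu>_pos by simp
  have nz: "u1 1 \<noteq> 0"
  proof
    assume "u1 1 = 0"
    then have "(\<integral>x. g1 x \<partial>Om) = 0" using u1p[of 1] by (simp add: prim_ge_1)
    then have rep: "H10_rep u1 g1"
      using g1L2 cm[OF u1c] u1p by (auto simp: H10_rep_def intro!: AE_I2)
    have flux: "AE x in Om. a x * g1 x = 1 + prim (\<lambda>t. d0 t * u1 t - 0) x"
      by (rule AE_I2) (simp add: g1_def ap)
    have "bilin a d0 u1 u1 = L2_inner (\<lambda>_. 0) u1"
      by (rule flux_imp_weak_solution[OF rep _ flux rep]) simp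
    then have "\<nu> * (L2_norm g1)\<^sup>2 \<le> 0" using bilin_coercive[OF rep] by (simp add: L2_inner_def)
    then have "L2_norm g1 = 0" using \<nu>_pos by (simp add: mult_le_0_iff)
    then have "AE x in Om. g1 x = 0" and "AE x in Om. \<bar>u1 x\<bar> \<le> 0"
      using L2_norm_eq_0_AE[OF g1L2] H10_rep_AE_bound[OF rep] by auto
    then have "AE x in Om. g1 x = 0 \<and> d0 x * u1 x = 0" by eventually_elim simp
    then have e: "AE x in Om. g1 x = 0" "AE x in Om. d0 x * u1 x = 0" by auto
    have "prim (\<lambda>t. d0 t * u1 t) x = prim (\<lambda>_. 0) x" for x
      by (rule prim_cong_AE[OF e(2)]) (use borel_measurable_integrable[OF d1] in simp_all)
    then have "prim (\<lambda>t. d0 t * u1 t) x = 0" for x by (simp add: prim_def)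
    moreover obtain x where "x \<in> Omega" "g1 x = 0" using AE_Om_ex[OF e(1)] by blast
    ultimately show False using ap[of x] by (simp add: g1_def)
  qed
  define s where "s = - u2 1 / u1 1"
  define u where "u x = u2 x + s * u1 x" for x
  define g where "g x = g2 x + s * g1 x" for x
  have gL2: "in_L2 g" unfolding g_def by (intro in_L2_add in_L2_cmult g1L2 g2L2)
  have up: "u x = prim g x" if "x \<in> {0..1}" for x
    unfolding u_def g_def u1p[OF that] u2p[OF that]
    using prim_add[OF in_L2_integrable[OF g2L2] in_L2_integrable[OF in_L2_cmult[OF g1L2, of s]], of x]
    by (simp add: prim_cmult)
  have "u 1 = 0" using nz by (simp add: u_def s_def)
  then have "(\<integral>x. g x \<partial>Om) = 0" using up[of 1] by (simp add: prim_ge_1)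
  moreover have "u \<in> borel_measurable Om" unfolding u_def using cm[OF u1c] cm[OF u2c] by simp
  ultimately have rep: "H10_rep u g" using gL2 up by (auto simp: H10_rep_def intro!: AE_I2)
  have flux: "AE x in Om. a x * g x = s + prim (\<lambda>t. d0 t * u t - f t) x"
  proof (rule AE_I2)
    fix x assume "x \<in> space Om"
    then have x: "x \<in> Omega" by simp
    have "prim (\<lambda>t. d0 t * u t - f t) x = prim (\<lambda>t. d0 t * u t) x - prim f x"
      by (rule prim_minus[OF integrable_d0[OF in_L2_integrable[OF H10_rep_in_L2[OF rep]]] f])
    moreover have "prim (\<lambda>t. d0 t * u t) x = prim (\<lambda>t. d0 t * u2 t) x + s * prim (\<lambda>t. d0 t * u1 t) x"
    proof -
      have "(\<lambda>t. d0 t * u t) = (\<lambda>t. d0 t * u2 t + s * (d0 t * u1 t))"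
        by (simp add: u_def fun_eq_iff algebra_simps)
      then show ?thesis
        using prim_add[OF d2 integrable_mult_right[of s, OF d1], of x] by (simp add: prim_cmult)
    qed
    moreover have "a x * g x = (- prim f x + prim (\<lambda>t. d0 t * u2 t) x) + s * (1 + prim (\<lambda>t. d0 t * u1 t) x)"
      using ap[OF x] by (simp add: g_def g1_def g2_def field_simps)
    ultimately show "a x * g x = s + prim (\<lambda>t. d0 t * u t - f t) x" by (simp add: algebra_simps)
  qed
  have "is_state H10 a d0 f u"
    unfolding is_state_def
  proof (intro conjI ballI)
    show "u \<in> H10" by (rule H10_rep_imp_in_H10[OF rep])
    show "bilin a d0 u w = L2_inner f w" if "w \<in> H10" for w
      by (rule flux_imp_weak_solution[OF rep f flux in_H10_imp_rep[OF that]])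
  qed
  then show ?thesis by blast
qed

section \<open>The variational inequality\<close>

lemma L2_inner_H10_add:
  assumes "integrable Om f" "integrable Om f'" "w \<in> H10"
  shows "L2_inner (\<lambda>x. f x + f' x) w = L2_inner f w + L2_inner f' w"
    and "L2_inner (\<lambda>x. f x - f' x) w = L2_inner f w - L2_inner f' w"
    and "integrable Om (\<lambda>x. f x * w x)"
proof -
  have i: "integrable Om (\<lambda>x. h x * w x)" if "integrable Om h" for h
    by (rule integrable_mult_bounded[OF that _ H10_rep_AE_bound[OF in_H10_imp_rep[OF assms(3)]]])
      (use in_H10_imp_rep[OF assms(3)] in \<open>simp add: H10_rep_def\<close>)
  show "L2_inner (\<lambda>x. f x + f' x) w = L2_inner f w + L2_inner f' w"
    "L2_inner (\<lambda>x. f x - f' x) w = L2_inner f w - L2_inner f' w"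
    using i[OF assms(1)] i[OF assms(2)] by (simp_all add: L2_inner_def distrib_right left_diff_distrib)
  show "integrable Om (\<lambda>x. f x * w x)" by (rule i[OF assms(1)])
qed

text \<open>Compare \<open>q\<close> with \<open>(1 - t) q + t p\<close>, use the convexity of the total variation, divide by
  \<open>t\<close> and let \<open>t\<close> tend to zero.\<close>

lemma variational_inequality:
  assumes W: "W \<subseteq> H10" "\<And>v w c e. v \<in> W \<Longrightarrow> w \<in> W \<Longrightarrow> (\<lambda>x. c * v x + e * w x) \<in> W"
    and ud: "in_L2 ud" and "\<alpha> > 0"
    and opt: "optimal_control W Q a d0 ud \<alpha> q" and BV: "q \<in> BV" "p \<in> BV"
    and conv: "\<And>t. 0 < t \<Longrightarrow> t \<le> 1 \<Longrightarrow> (\<lambda>x. (1 - t) * q x + t * p x) \<in> Q"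
    and u: "is_state W a d0 q u" and v: "is_state W a d0 p v" and z: "is_adjoint W a d0 ud u z"
  shows "0 \<le> L2_inner (\<lambda>x. p x - q x) z + \<alpha> * (deriv_TV p - deriv_TV q)"
proof -
  have Wm: "(\<lambda>x. v x - w x) \<in> W" if "v \<in> W" "w \<in> W" for v w
    using W(2)[OF that, of 1 "-1"] by simp
  have in_W: "u \<in> W" "v \<in> W" "z \<in> W" using u v z by (auto simp: is_state_def is_adjoint_def)
  then have H: "u \<in> H10" "v \<in> H10" "z \<in> H10" using W(1) by auto
  have uL2: "in_L2 u" "in_L2 v" using in_H10_imp_rep H10_rep_in_L2 H by blast+
  have int: "integrable Om q" "integrable Om p" using BV by (auto simp: BV_def)
  define r where "r = (\<lambda>x. u x - ud x)"
  define e where "e = (\<lambda>x. v x - u x)"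
  have r2: "in_L2 r" and e2: "in_L2 e" unfolding r_def e_def by (intro in_L2_minus uL2 ud)+
  define I where "I = L2_inner r e"
  define J where "J = (L2_norm e)\<^sup>2"
  define T where "T = deriv_TV p - deriv_TV q"
  have key: "0 \<le> t * (I + \<alpha> * T) + t\<^sup>2 * (J / 2)" if t: "0 < t" "t \<le> 1" for t
  proof -
    define qt where "qt = (\<lambda>x. (1 - t) * q x + t * p x)"
    define ut where "ut = (\<lambda>x. (1 - t) * u x + t * v x)"
    have ut: "is_state W a d0 qt ut"
      unfolding is_state_def
    proof (intro conjI ballI)
      show "ut \<in> W" unfolding ut_def by (rule W(2)[OF in_W(1,2)])
      fix w assume w: "w \<in> W"
      then have wH: "w \<in> H10" using W(1) by auto
      have "bilin a d0 ut w = (1 - t) * bilin a d0 u w + t * bilin a d0 v w"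
        unfolding ut_def by (simp add: bilin_add_left[OF H10_cmult[OF H(1)] H10_cmult[OF H(2)] wH]
            bilin_cmult_left[OF H(1) wH] bilin_cmult_left[OF H(2) wH])
      also have "\<dots> = (1 - t) * L2_inner q w + t * L2_inner p w"
        using u v w by (simp add: is_state_def)
      also have "\<dots> = L2_inner qt w"
        unfolding qt_def using L2_inner_H10_add(1)[OF integrable_mult_right[of "1 - t", OF int(1)]
            integrable_mult_right[of t, OF int(2)] wH] by (simp add: L2_inner_cmult_left)
      finally show "bilin a d0 ut w = L2_inner qt w" .
    qed
    have sol: "L2_norm (\<lambda>x. solution_op W a d0 f x - ud x) = L2_norm (\<lambda>x. w x - ud x)"
      if w: "is_state W a d0 f w" for f w
    proof (rule L2_norm_cong_AE)
      have s: "is_state W a d0 f (solution_op W a d0 f)"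
        unfolding solution_op_def using w by (rule someI[of "is_state W a d0 f"])
      have "AE x in Om. solution_op W a d0 f x = w x"
        by (rule state_unique[OF W(1) _ s w]) (rule Wm)
      then show "AE x in Om. solution_op W a d0 f x - ud x = w x - ud x"
        by eventually_elim simp
      have "solution_op W a d0 f \<in> H10" "w \<in> H10" using s w W(1) by (auto simp: is_state_def)
      then have [measurable]: "solution_op W a d0 f \<in> borel_measurable Om" "w \<in> borel_measurable Om"
        using in_H10_imp_rep by (auto simp: H10_rep_def)
      note [measurable] = in_L2_measurable[OF ud]
      show "(\<lambda>x. solution_op W a d0 f x - ud x) \<in> borel_measurable Om"
        "(\<lambda>x. w x - ud x) \<in> borel_measurable Om" by measurable
    qed
    have "cost W a d0 ud \<alpha> q \<le> cost W a d0 ud \<alpha> qt"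
      using opt conv[OF t] unfolding optimal_control_def qt_def by blast
    then have "1 / 2 * (L2_norm r)\<^sup>2 + \<alpha> * deriv_TV q
        \<le> 1 / 2 * (L2_norm (\<lambda>x. ut x - ud x))\<^sup>2 + \<alpha> * deriv_TV qt"
      unfolding cost_def sol[OF u] sol[OF ut] r_def .
    moreover have "\<alpha> * deriv_TV qt \<le> \<alpha> * ((1 - t) * deriv_TV q + t * deriv_TV p)"
      unfolding qt_def using deriv_TV_convex(2)[OF BV] t \<open>\<alpha> > 0\<close> by (intro mult_left_mono) auto
    moreover have "(L2_norm (\<lambda>x. ut x - ud x))\<^sup>2 = (L2_norm r)\<^sup>2 + 2 * t * I + t\<^sup>2 * J"
    proof -
      have "(\<lambda>x. (ut x - ud x)\<^sup>2) = (\<lambda>x. r x * r x + 2 * t * (r x * e x) + t\<^sup>2 * (e x * e x))"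
        by (simp add: ut_def r_def e_def fun_eq_iff power2_eq_square algebra_simps)
      then show ?thesis
        unfolding I_def J_def L2_norm_sq L2_inner_self[of "\<lambda>x. ut x - ud x"]
        using in_L2_mult_integrable[OF r2 r2] in_L2_mult_integrable[OF r2 e2] in_L2_mult_integrable[OF e2 e2]
        by (simp add: L2_inner_def)
    qed
    ultimately show ?thesis by (simp add: T_def algebra_simps)
  qed
  have "0 \<le> I + \<alpha> * T"
  proof (rule tendsto_lowerbound)
    show "((\<lambda>t. (I + \<alpha> * T) + t * (J / 2)) \<longlongrightarrow> I + \<alpha> * T) (at_right 0)"
      by (auto intro!: tendsto_eq_intros)
    have "\<forall>\<^sub>F t in at_right (0::real). t < 1" by (rule order_tendstoD(2)[OF tendsto_ident_at]) simp
    moreover have "\<forall>\<^sub>F t in at_right (0::real). 0 < t" by (simp add: eventually_at_filter)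
    ultimately show "\<forall>\<^sub>F t in at_right 0. 0 \<le> (I + \<alpha> * T) + t * (J / 2)"
    proof eventually_elim
      case (elim t)
      have "t * ((I + \<alpha> * T) + t * (J / 2)) = t * (I + \<alpha> * T) + t\<^sup>2 * (J / 2)"
        by (simp add: power2_eq_square algebra_simps)
      then have "0 \<le> t * ((I + \<alpha> * T) + t * (J / 2))" using key[of t] elim by simp
      then show ?case using elim by (simp add: zero_le_mult_iff)
    qed
  qed simp
  moreover have "I = L2_inner (\<lambda>x. p x - q x) z"
  proof -
    have eW: "e \<in> W" unfolding e_def by (rule Wm[OF in_W(2,1)])
    have "I = L2_inner e r" unfolding I_def by (rule L2_inner_commute)
    also have "\<dots> = bilin a d0 e z" using z eW by (simp add: is_adjoint_def r_def)
    also have "\<dots> = L2_inner p z - L2_inner q z"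
      unfolding e_def bilin_minus_left[OF H(2,1,3)] using u v in_W(3) by (simp add: is_state_def)
    also have "\<dots> = L2_inner (\<lambda>x. p x - q x) z" by (rule L2_inner_H10_add(2)[OF int(2,1) H(3), symmetric])
    finally show ?thesis .
  qed
  ultimately show ?thesis by (simp add: T_def)
qed

end

section \<open>Step functions and piecewise affine functions on a grid\<close>

locale mesh =
  fixes X :: "nat \<Rightarrow> real" and l :: nat
  assumes grid: "grid X l"
begin

abbreviation cell :: "nat \<Rightarrow> real set" where
  "cell i \<equiv> {X i<..<X (Suc i)}"

definition len :: "nat \<Rightarrow> real" where
  "len i = X (Suc i) - X i"

abbreviation h :: real where
  "h \<equiv> mesh_width X l"

lemma X_0: "X 0 = 0" and X_l: "X l = 1" and l_gt_1: "l > 1" and X_Suc: "i < l \<Longrightarrow> X i < X (Suc i)"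
  using grid by (auto simp: grid_def)

lemma X_mono: "i \<le> j \<Longrightarrow> j \<le> l \<Longrightarrow> X i \<le> X j"
proof (induction j rule: dec_induct)
  case (step n)
  then show ?case using X_Suc[of n] by simp
qed simp

lemma X_strict_mono: "i < j \<Longrightarrow> j \<le> l \<Longrightarrow> X i < X j"
  using X_Suc[of i] X_mono[of "Suc i" j] by simp

lemma X_bounds: "i \<le> l \<Longrightarrow> 0 \<le> X i" "i \<le> l \<Longrightarrow> X i \<le> 1"
  using X_mono[of 0 i] X_mono[of i l] X_0 X_l by auto

lemma cell_subset: "i < l \<Longrightarrow> cell i \<subseteq> Omega"
  using X_bounds[of i] X_bounds[of "Suc i"] by auto

lemma len_pos: "i < l \<Longrightarrow> 0 < len i"
  using X_Suc by (simp add: len_def)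

lemma len_le_h:
  assumes "i < l"
  shows "len i \<le> h"
proof -
  have "len i \<in> (\<lambda>i. X i - X (i - 1)) ` {1..l}"
    using assms by (intro image_eqI[of _ _ "Suc i"]) (auto simp: len_def)
  then show ?thesis unfolding mesh_width_def by (intro Max_ge) auto
qed

lemma h_pos: "0 < h"
  using len_pos[of 0] len_le_h[of 0] l_gt_1 by linarith

lemma cell_cover:
  assumes "t \<in> Omega" "t \<notin> X ` {..l}"
  obtains i where "i < l" "t \<in> cell i"
proof -
  have "n \<le> l \<Longrightarrow> t < X n \<Longrightarrow> \<exists>i<n. t \<in> cell i" for n
  proof (induction n)
    case 0
    then show ?case using assms X_0 by simp
  next
    case (Suc n)
    have "X n \<noteq> t" using assms(2) Suc.prems(1) by auto
    then consider "t < X n" | "X n < t" by linarith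
    then show ?case
    proof cases
      case 1
      then show ?thesis using Suc by (auto intro: less_SucI)
    next
      case 2
      then show ?thesis using Suc.prems by auto
    qed
  qed
  from this[of l] assms(1) X_l show ?thesis using that by auto
qed

lemma AE_cell: "AE t in Om. \<exists>i<l. t \<in> cell i"
proof (rule AE_mp[OF AE_Om_not_finite[of "X ` {..l}"]])
  show "AE t in Om. t \<notin> X ` {..l} \<longrightarrow> (\<exists>i<l. t \<in> cell i)"
    by (rule AE_I2) (use cell_cover in \<open>metis space_lebesgue_on\<close>)
qed simp

lemma cell_disjoint:
  assumes "i < l" "j < l" "t \<in> cell i" "t \<in> cell j"
  shows "i = j"
proof (rule ccontr)
  assume "i \<noteq> j"
  then consider "i < j" | "j < i" by linarith
  then show False
  proof cases
    case 1
    then have "X (Suc i) \<le> X j" using assms by (intro X_mono) auto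
    then show ?thesis using assms by auto
  next
    case 2
    then have "X (Suc j) \<le> X i" using assms by (intro X_mono) auto
    then show ?thesis using assms by auto
  qed
qed

text \<open>Nodes belong to no cell and are mapped to \<open>0\<close>; they form a null set.\<close>

definition step :: "(nat \<Rightarrow> real) \<Rightarrow> real \<Rightarrow> real" where
  "step c t = (\<Sum>i<l. c i * indicat_real (cell i) t)"

lemma step_cell:
  assumes "i < l" "t \<in> cell i"
  shows "step c t = c i"
proof -
  have "step c t = (\<Sum>j<l. if j = i then c i else 0)"
    unfolding step_def
  proof (rule sum.cong)
    fix j assume j: "j \<in> {..<l}"
    show "c j * indicat_real (cell j) t = (if j = i then c i else 0)"
    proof (cases "j = i")
      case False
      then have "t \<notin> cell j" using cell_disjoint[OF assms(1) _ assms(2), of j] j by auto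
      then show ?thesis using False by simp
    qed (use assms in simp)
  qed simp
  then show ?thesis using assms by simp
qed

lemma indicator_cell_measurable: "indicat_real (cell i) \<in> borel_measurable Om"
  by (rule borel_Om) simp

lemma step_measurable [measurable]: "step c \<in> borel_measurable Om"
  unfolding step_def by (intro borel_measurable_sum borel_measurable_times
      borel_measurable_const indicator_cell_measurable)

lemma step_AE_bound:
  assumes "\<And>i. i < l \<Longrightarrow> \<bar>c i\<bar> \<le> B"
  shows "AE t in Om. \<bar>step c t\<bar> \<le> B"
  using AE_cell by eventually_elim (use assms step_cell in auto)

lemma step_AE_bounded: "\<exists>B. AE t in Om. \<bar>step c t\<bar> \<le> B"
proof -
  have "\<bar>c i\<bar> \<le> (\<Sum>i<l. \<bar>c i\<bar>)" if "i < l" for i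
    using that by (intro member_le_sum[of i "{..<l}" "\<lambda>i. \<bar>c i\<bar>"]) auto
  then show ?thesis using step_AE_bound by blast
qed

lemma step_in_L2: "in_L2 (step c)"
  using step_AE_bounded bounded_in_L2[OF step_measurable] by blast

lemma step_integrable: "integrable Om (step c)"
  by (rule in_L2_integrable[OF step_in_L2])

lemma step_lincomb: "step (\<lambda>i. c i + e * d i) t = step c t + e * step d t"
  by (simp only: step_def sum.distrib sum_distrib_left distrib_right mult.assoc)

definition cell_int :: "(real \<Rightarrow> real) \<Rightarrow> nat \<Rightarrow> real" where
  "cell_int f i = (\<integral>t. indicat_real (cell i) t * f t \<partial>Om)"

lemma integrable_cell: "integrable Om f \<Longrightarrow> integrable Om (\<lambda>t. indicat_real (cell i) t * f t)"
  using integrable_mult_bounded[of Om f "indicat_real (cell i)" 1] indicator_cell_measurable[of i]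
  by (simp add: mult.commute indicator_def)

lemma integral_mult_step:
  assumes "integrable Om f"
  shows "(\<integral>t. f t * step c t \<partial>Om) = (\<Sum>i<l. c i * cell_int f i)"
proof -
  have "(\<lambda>t. f t * step c t) = (\<lambda>t. \<Sum>i<l. c i * (indicat_real (cell i) t * f t))"
    by (rule ext) (simp only: step_def sum_distrib_left mult_ac)
  then show ?thesis
    by (simp add: cell_int_def integrable_cell[OF assms])
qed

lemma cell_int_1:
  assumes "i < l"
  shows "cell_int (\<lambda>_. 1) i = len i"
proof -
  have "AE t in Om. indicat_real (cell i) t = indicat_real {X i<..X (Suc i)} t"
    using AE_Om_not_singleton[of "X (Suc i)"] by eventually_elim (auto simp: indicator_def)
  then have "(\<integral>t. indicat_real (cell i) t \<partial>Om) = (\<integral>t. indicat_real {X i<..X (Suc i)} t \<partial>Om)"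
    by (intro integral_cong_AE indicator_cell_measurable indicator_Ioc_measurable)
  also have "\<dots> = len i"
    using assms X_bounds[of i] X_bounds[of "Suc i"] X_Suc[of i]
    by (subst integral_Ioc_Om) (auto simp: len_def)
  finally show ?thesis by (simp add: cell_int_def)
qed

lemma integral_step: "(\<integral>t. step c t \<partial>Om) = (\<Sum>i<l. c i * len i)"
  using integral_mult_step[of "\<lambda>_. 1" c] cell_int_1 by simp

lemma cell_int_step:
  assumes "i < l"
  shows "cell_int (step c) i = c i * len i"
proof -
  have "(\<lambda>t. indicat_real (cell i) t * step c t) = (\<lambda>t. c i * (indicat_real (cell i) t * 1))"
    using step_cell[OF assms] by (auto simp: indicator_def fun_eq_iff)
  then show ?thesis using cell_int_1[OF assms] by (simp add: cell_int_def)
qed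

lemma cell_int_cong_AE:
  assumes "AE t in Om. f t = g t" "f \<in> borel_measurable Om" "g \<in> borel_measurable Om"
  shows "cell_int f i = cell_int g i"
  unfolding cell_int_def
proof (rule integral_cong_AE)
  show "AE t in Om. indicat_real (cell i) t * f t = indicat_real (cell i) t * g t"
    using assms(1) by eventually_elim simp
qed (use assms indicator_cell_measurable[of i] in simp_all)

text \<open>The \<open>L2\<close> projection of \<open>f\<close> onto the step functions is \<open>step (avg f)\<close>.\<close>

definition avg :: "(real \<Rightarrow> real) \<Rightarrow> nat \<Rightarrow> real" where
  "avg f i = cell_int f i / len i"

lemma integral_avg_mult_step:
  assumes "integrable Om f"
  shows "(\<integral>t. step (avg f) t * step c t \<partial>Om) = (\<integral>t. f t * step c t \<partial>Om)"
  unfolding integral_mult_step[OF assms] integral_mult_step[OF step_integrable]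
proof (rule sum.cong)
  fix i assume "i \<in> {..<l}"
  then show "c i * cell_int (step (avg f)) i = c i * cell_int f i"
    using len_pos[of i] by (simp add: cell_int_step) (simp add: avg_def)
qed simp

lemma step_avg_orthogonal:
  assumes "integrable Om f"
  shows "(\<integral>t. (step (avg f) t - f t) * step c t \<partial>Om) = 0"
proof -
  obtain B where B: "AE t in Om. \<bar>step c t\<bar> \<le> B" using step_AE_bounded by blast
  have "integrable Om (\<lambda>t. f t * step c t)" "integrable Om (\<lambda>t. step (avg f) t * step c t)"
    by (rule integrable_mult_bounded[OF _ step_measurable B]; use assms step_integrable in simp)+
  then show ?thesis by (simp add: left_diff_distrib integral_avg_mult_step[OF assms])
qed

lemma avg_oscillation:
  assumes f: "integrable Om f" and i: "i < l" "t \<in> cell i"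
    and osc: "\<And>s. s \<in> cell i \<Longrightarrow> \<bar>f t - f s\<bar> \<le> w"
  shows "\<bar>f t - avg f i\<bar> \<le> w"
proof -
  note lp = len_pos[OF i(1)]
  have "f t * len i - cell_int f i = (\<integral>s. indicat_real (cell i) s * f t - indicat_real (cell i) s * f s \<partial>Om)"
    using integrable_cell[OF f, of i] integrable_cell[of "\<lambda>_. f t" i] cell_int_1[OF i(1)]
    by (simp add: cell_int_def)
  also have "\<bar>\<dots>\<bar> \<le> (\<integral>s. \<bar>indicat_real (cell i) s * f t - indicat_real (cell i) s * f s\<bar> \<partial>Om)"
    by (rule integral_abs_bound)
  also have "\<dots> \<le> (\<integral>s. w * (indicat_real (cell i) s * 1) \<partial>Om)"
  proof (rule integral_mono)
    show "integrable Om (\<lambda>s. \<bar>indicat_real (cell i) s * f t - indicat_real (cell i) s * f s\<bar>)"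
      using integrable_cell[OF f, of i] integrable_cell[of "\<lambda>_. f t" i] by simp
    show "integrable Om (\<lambda>s. w * (indicat_real (cell i) s * 1))"
      using integrable_cell[of "\<lambda>_. 1" i] by simp
    show "\<bar>indicat_real (cell i) s * f t - indicat_real (cell i) s * f s\<bar> \<le> w * (indicat_real (cell i) s * 1)" for s
      using osc[of s] by (auto simp: indicator_def)
  qed
  also have "\<dots> = w * len i" using cell_int_1[OF i(1)] by (simp add: cell_int_def)
  finally have "\<bar>f t * len i - cell_int f i\<bar> \<le> w * len i" .
  moreover have "f t * len i - cell_int f i = (f t - avg f i) * len i"
    using lp by (simp add: avg_def field_simps)
  ultimately have "\<bar>f t - avg f i\<bar> * len i \<le> w * len i" using lp by (simp add: abs_mult)
  then show ?thesis using lp by simp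
qed

lemma avg_Lipschitz:
  assumes f: "integrable Om f" and M: "\<And>s t. s \<in> Omega \<Longrightarrow> t \<in> Omega \<Longrightarrow> \<bar>f s - f t\<bar> \<le> M * \<bar>s - t\<bar>"
    and i: "i < l" "t \<in> cell i"
  shows "\<bar>f t - avg f i\<bar> \<le> M * h"
proof (rule avg_oscillation[OF f i])
  fix s assume s: "s \<in> cell i"
  have sub: "s \<in> Omega" "t \<in> Omega" using cell_subset[OF i(1)] s i(2) by auto
  have "0 \<le> M * \<bar>1/4 - 1/2\<bar>" by (rule order_trans[OF abs_ge_zero M]) auto
  then have M0: "M \<ge> 0" by simp
  have "\<bar>t - s\<bar> \<le> h" using s i(2) len_le_h[OF i(1)] by (auto simp: len_def)
  then show "\<bar>f t - f s\<bar> \<le> M * h" using M[OF sub(2,1)] M0 mult_left_mono[of "\<bar>t - s\<bar>" h M] by linarith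
qed

lemma prim_node:
  assumes "integrable Om f" "j \<le> l"
  shows "prim f (X j) = (\<Sum>i<j. cell_int f i)"
proof -
  have "AE t in Om. indicat_real {..X j} t * f t = f t * step (\<lambda>i. if i < j then 1 else 0) t"
    using AE_cell
  proof eventually_elim
    case (elim t)
    then obtain i where i: "i < l" "t \<in> cell i" by blast
    have "X (Suc i) \<le> X j" if "i < j" using that assms by (intro X_mono) auto
    moreover have "X j \<le> X i" if "\<not> i < j" using that i by (intro X_mono) auto
    ultimately show ?case using i step_cell[OF i, of "\<lambda>i. if i < j then 1 else 0"]
      by (fastforce simp: indicator_def)
  qed
  then have "prim f (X j) = (\<integral>t. f t * step (\<lambda>i. if i < j then 1 else 0) t \<partial>Om)"
    unfolding prim_def using borel_measurable_integrable[OF assms(1)] by (intro integral_cong_AE) auto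
  also have "\<dots> = (\<Sum>i<l. if i < j then cell_int f i else 0)"
    unfolding integral_mult_step[OF assms(1)] by (intro sum.cong) auto
  also have "\<dots> = (\<Sum>i\<in>{..<l} \<inter> {i. i < j}. cell_int f i)" by (subst sum.inter_restrict) auto
  also have "{..<l} \<inter> {i. i < j} = {..<j}" using assms by auto
  finally show ?thesis .
qed

text \<open>Consequently the primitive of the cell averages of a derivative is the nodal interpolant.\<close>

lemma prim_avg_node:
  assumes "integrable Om f" "j \<le> l"
  shows "prim (step (avg f)) (X j) = prim f (X j)"
  unfolding prim_node[OF assms] prim_node[OF step_integrable assms(2)]
proof (rule sum.cong)
  fix i assume "i \<in> {..<j}"
  then show "cell_int (step (avg f)) i = cell_int f i"
    using assms(2) len_pos[of i] by (simp add: cell_int_step) (simp add: avg_def)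
qed simp

lemma prim_avg_error:
  assumes f: "integrable Om f" and E: "AE t in Om. \<bar>f t - step (avg f) t\<bar> \<le> E" and t: "t \<in> Omega" "t \<notin> X ` {..l}"
  shows "\<bar>prim f t - prim (step (avg f)) t\<bar> \<le> E * h"
proof -
  obtain i where i: "i < l" "t \<in> cell i" using cell_cover t by metis
  have fi: "integrable Om (\<lambda>t. f t - step (avg f) t)" using f step_integrable by simp
  have "prim (\<lambda>t. f t - step (avg f) t) (X i) = 0"
    using prim_avg_node[OF f, of i] i by (simp add: prim_minus[OF f step_integrable])
  moreover have "\<bar>prim (\<lambda>t. f t - step (avg f) t) t - prim (\<lambda>t. f t - step (avg f) t) (X i)\<bar> \<le> E * (t - X i)"
    using i X_bounds[of i] t by (intro prim_Lipschitz[OF fi E]) auto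
  moreover have "E * (t - X i) \<le> E * h"
    using i len_le_h[OF i(1)] AE_Om_ex[OF E] by (intro mult_left_mono) (auto simp: len_def)
  ultimately show ?thesis by (simp add: prim_minus[OF f step_integrable])
qed

lemma Qh_step:
  assumes "s \<in> Qh_space X l"
  shows "\<exists>c. \<forall>i<l. \<forall>t\<in>cell i. s t = c i"
proof -
  have "\<forall>i<l. \<exists>c. \<forall>t\<in>cell i. s t = c"
  proof (intro allI impI)
    fix i assume "i < l"
    then have "Suc i \<in> {1..l}" by auto
    then have "\<exists>c. \<forall>t\<in>{X (Suc i - 1)<..<X (Suc i)}. s t = c" using assms unfolding Qh_space_def by blast
    then show "\<exists>c. \<forall>t\<in>cell i. s t = c" by simp
  qed
  then show ?thesis by metis
qed

lemma Qh_intro: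
  assumes "\<And>i. i < l \<Longrightarrow> \<exists>c. \<forall>t\<in>cell i. s t = c"
  shows "s \<in> Qh_space X l"
  unfolding Qh_space_def
proof (intro CollectI ballI)
  fix i assume "i \<in> {1..l}"
  then obtain j where "i = Suc j" "j < l" by (cases i) auto
  then show "\<exists>c. \<forall>t\<in>{X (i - 1)<..<X i}. s t = c" using assms[of j] by simp
qed

lemma step_in_Qh: "step c \<in> Qh_space X l"
  using step_cell by (intro Qh_intro) blast

lemma Qh_lincomb:
  assumes "s \<in> Qh_space X l" "s' \<in> Qh_space X l"
  shows "(\<lambda>t. c * s t + e * s' t) \<in> Qh_space X l"
proof -
  obtain d where d: "\<forall>i<l. \<forall>t\<in>cell i. s t = d i" using Qh_step[OF assms(1)] by blast
  obtain d' where d': "\<forall>i<l. \<forall>t\<in>cell i. s' t = d' i" using Qh_step[OF assms(2)] by blast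
  show ?thesis
  proof (rule Qh_intro)
    fix i assume "i < l"
    then have "\<forall>t\<in>cell i. c * s t + e * s' t = c * d i + e * d' i" using d d' by simp
    then show "\<exists>k. \<forall>t\<in>cell i. c * s t + e * s' t = k" by blast
  qed
qed

lemma Qh_measurable:
  assumes "s \<in> Qh_space X l"
  shows "s \<in> borel_measurable Om"
proof -
  obtain c where c: "\<forall>i<l. \<forall>t\<in>cell i. s t = c i" using Qh_step[OF assms] by blast
  have "s t = step c t" if "t \<in> Omega" "t \<notin> X ` {..l}" for t
    using cell_cover[OF that] c step_cell by metis
  then show ?thesis
    by (intro measurable_discrete_difference[OF step_measurable, where X = "X ` {..l} \<inter> Omega"])
      (auto simp: sets_restrict_space_iff intro!: countable_finite)
qed

lemma step_AE_eq:
  assumes "\<forall>i<l. \<forall>t\<in>cell i. s t = c i"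
  shows "AE t in Om. s t = step c t"
  using AE_cell by eventually_elim (use assms step_cell in metis)

lemma Vh_lincomb:
  assumes "v \<in> Vh_space X l" "w \<in> Vh_space X l"
  shows "(\<lambda>t. c * v t + e * w t) \<in> Vh_space X l"
  unfolding Vh_space_def
proof (intro CollectI conjI ballI)
  show "continuous_on {0..1} (\<lambda>t. c * v t + e * w t)"
    using assms by (intro continuous_intros) (auto simp: Vh_space_def)
  fix i assume i: "i \<in> {1..l}"
  obtain m b where 1: "\<forall>t\<in>{X (i - 1)<..<X i}. v t = m * t + b" using assms(1) i unfolding Vh_space_def by blast
  obtain m' b' where 2: "\<forall>t\<in>{X (i - 1)<..<X i}. w t = m' * t + b'" using assms(2) i unfolding Vh_space_def by blast
  show "\<exists>k d. \<forall>t\<in>{X (i - 1)<..<X i}. c * v t + e * w t = k * t + d"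
    by (rule exI[of _ "c * m + e * m'"], rule exI[of _ "c * b + e * b'"])
      (use 1 2 in \<open>simp add: algebra_simps\<close>)
qed (use assms in \<open>auto simp: Vh_space_def\<close>)

lemma Vh_rep:
  assumes v: "v \<in> Vh_space X l"
  shows "\<exists>c. (\<forall>t\<in>{0..1}. v t = prim (step c) t) \<and> H10_rep v (step c)"
proof -
  have cont: "continuous_on {0..1} v" and 0: "v 0 = 0" "v 1 = 0" using v by (auto simp: Vh_space_def)
  have "\<forall>i<l. \<exists>m b. \<forall>t\<in>cell i. v t = m * t + b"
  proof (intro allI impI)
    fix i assume "i < l"
    then have "Suc i \<in> {1..l}" by auto
    then have "\<exists>m b. \<forall>t\<in>{X (Suc i - 1)<..<X (Suc i)}. v t = m * t + b"
      using v unfolding Vh_space_def by blast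
    then show "\<exists>m b. \<forall>t\<in>cell i. v t = m * t + b" by simp
  qed
  then obtain c b where c: "\<forall>i<l. \<forall>t\<in>cell i. v t = c i * t + b i" by metis
  have eq: "v t = prim (step c) t" if t: "t \<in> {0..1}" for t
  proof -
    have "prim (step c) t = v t - v 0"
    proof (rule prim_fundamental)
      show "finite (X ` {..l})" by simp
      show "continuous_on {0..t} v" by (rule continuous_on_subset[OF cont]) (use t in auto)
      fix s assume s: "s \<in> {0<..<t} - X ` {..l}"
      then obtain i where i: "i < l" "s \<in> cell i" using cell_cover[of s] t by auto
      have "((\<lambda>y. c i * y + b i) has_real_derivative c i) (at s)" by (auto intro!: derivative_eq_intros)
      then have "(v has_real_derivative c i) (at s)"
        by (rule has_field_derivative_transform_within_open[of _ _ _ "cell i"]) (use i c in auto)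
      then show "(v has_real_derivative step c s) (at s)" using step_cell[OF i] by simp
    qed (use t step_integrable in auto)
    then show ?thesis using 0 by simp
  qed
  have "v \<in> borel_measurable Om"
    by (intro continuous_imp_measurable_on_sets_lebesgue continuous_on_subset[OF cont]) auto
  moreover have "(\<integral>t. step c t \<partial>Om) = 0" using eq[of 1] 0 by (simp add: prim_ge_1)
  ultimately have "H10_rep v (step c)"
    using eq step_in_L2 by (auto simp: H10_rep_def intro!: AE_I2)
  then show ?thesis using eq by blast
qed

lemma prim_step_in_Vh:
  assumes "(\<integral>t. step c t \<partial>Om) = 0"
  shows "prim (step c) \<in> Vh_space X l" "H10_rep (prim (step c)) (step c)"
proof -
  obtain B where B: "AE t in Om. \<bar>step c t\<bar> \<le> B" using step_AE_bounded by blast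
  show "prim (step c) \<in> Vh_space X l"
    unfolding Vh_space_def
  proof (intro CollectI conjI ballI)
    have "B \<ge> 0" using AE_Om_ex[OF B] by force
    then have "B-lipschitz_on {0..1} (prim (step c))"
      by (intro lipschitz_onI) (simp_all add: dist_real_def prim_Lipschitz_abs[OF step_integrable B])
    then show "continuous_on {0..1} (prim (step c))" by (rule lipschitz_on_continuous_on)
    show "prim (step c) 0 = 0" by (simp add: prim_nonpos)
    show "prim (step c) 1 = 0" using assms by (simp add: prim_ge_1)
    fix j assume "j \<in> {1..l}"
    then obtain i where i: "i < l" "j = Suc i" by (cases j) auto
    have "prim (step c) t = c i * t + (prim (step c) (X i) - c i * X i)" if t: "t \<in> cell i" for t
    proof -
      have "prim (step c) t - prim (step c) (X i) = (\<integral>s. indicat_real {X i<..t} s * step c s \<partial>Om)"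
        using t by (intro prim_diff step_integrable) auto
      also have "(\<lambda>s. indicat_real {X i<..t} s * step c s) = (\<lambda>s. c i * indicat_real {X i<..t} s)"
        using step_cell[OF i(1)] t by (auto simp: indicator_def fun_eq_iff)
      also have "(\<integral>s. c i * indicat_real {X i<..t} s \<partial>Om) = c i * (t - X i)"
        using integral_Ioc_Om[of "X i" t] t X_bounds[of i] X_bounds[of "Suc i"] i by simp
      finally show ?thesis by (simp add: algebra_simps)
    qed
    then show "\<exists>m b. \<forall>t\<in>{X (j - 1)<..<X j}. prim (step c) t = m * t + b" using i by auto
  qed
  show "H10_rep (prim (step c)) (step c)"
    using assms step_in_L2 by (simp add: H10_rep_def)
qed

lemma Vh_subset_H10: "Vh_space X l \<subseteq> H10"
  using Vh_rep H10_rep_imp_in_H10 by blast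

end

section \<open>Solvability of the discrete state equation\<close>

text \<open>Galerkin solutions are built by adding one basis function at a time: the new direction is
  made orthogonal to the old space with respect to the bilinear form.\<close>

locale galerkin = coefficients + mesh
begin

text \<open>The slopes of the functions in \<open>Vh_space X l\<close> that vanish from the node \<open>X k\<close> on.\<close>

definition mean_free :: "nat \<Rightarrow> (nat \<Rightarrow> real) set" where
  "mean_free k = {c. (\<forall>i\<ge>k. c i = 0) \<and> (\<integral>t. step c t \<partial>Om) = 0}"

text \<open>The class of right hand sides contains both \<open>L2_inner f\<close> and the functionals \<open>bilin a d0 b\<close> that
  occur when a new direction \<open>b\<close> is made orthogonal to the old space. Boundedness makes a functional
  vanish on functions of zero energy.\<close>

definition bounded_functional :: "((real \<Rightarrow> real) \<Rightarrow> real) \<Rightarrow> bool" where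
  "bounded_functional F \<longleftrightarrow>
     (\<forall>v\<in>H10. \<forall>w\<in>H10. \<forall>e. F (\<lambda>x. v x + e * w x) = F v + e * F w) \<and>
     (\<exists>C. \<forall>v g. H10_rep v g \<longrightarrow> \<bar>F v\<bar> \<le> C * L2_norm g)"

lemma bounded_functional_bilin:
  assumes "b \<in> H10"
  shows "bounded_functional (bilin a d0 b)"
  unfolding bounded_functional_def
proof (intro conjI ballI allI exI impI)
  fix v w e assume vw: "v \<in> H10" "w \<in> H10"
  show "bilin a d0 b (\<lambda>x. v x + e * w x) = bilin a d0 b v + e * bilin a d0 b w"
    unfolding bilin_commute[of b]
    by (simp add: bilin_add_left[OF vw(1) H10_cmult[OF vw(2)] assms] bilin_cmult_left[OF vw(2) assms])
next
  fix v g assume "H10_rep v g"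
  then show "\<bar>bilin a d0 b v\<bar> \<le> ((A + D) * L2_norm (weak_deriv b)) * L2_norm g"
    by (rule bilin_bound[OF in_H10_imp_rep[OF assms]])
qed

lemma prim_step_lincomb: "prim (step (\<lambda>i. c i + e * d i)) = (\<lambda>x. prim (step c) x + e * prim (step d) x)"
proof
  fix x
  have "prim (step (\<lambda>i. c i + e * d i)) x = prim (\<lambda>t. step c t + e * step d t) x"
    by (simp add: step_lincomb[abs_def])
  also have "\<dots> = prim (step c) x + e * prim (step d) x"
    using prim_add[OF step_integrable integrable_mult_right[of e, OF step_integrable], of c d x]
    by (simp add: prim_cmult)
  finally show "prim (step (\<lambda>i. c i + e * d i)) x = prim (step c) x + e * prim (step d) x" .
qed

lemma mean_free_lincomb: "c \<in> mean_free k \<Longrightarrow> d \<in> mean_free k \<Longrightarrow> (\<lambda>i. c i + e * d i) \<in> mean_free k"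
  unfolding mean_free_def by (simp add: step_lincomb[abs_def] step_integrable)

lemma mean_free_rep: "c \<in> mean_free k \<Longrightarrow> H10_rep (prim (step c)) (step c)"
  unfolding mean_free_def by (simp add: prim_step_in_Vh(2))

lemma galerkin_exists:
  assumes "k \<le> l" "bounded_functional F"
  shows "\<exists>c\<in>mean_free k. \<forall>d\<in>mean_free k. bilin a d0 (prim (step c)) (prim (step d)) = F (prim (step d))"
  using assms
proof (induction k arbitrary: F)
  case 0
  have z: "c = (\<lambda>_. 0)" if "c \<in> mean_free 0" for c using that by (auto simp: mean_free_def)
  have s0: "step (\<lambda>_. 0) = (\<lambda>_. 0)" by (simp add: step_def fun_eq_iff)
  have z0: "(\<lambda>_. 0) \<in> mean_free 0" by (simp add: mean_free_def s0)
  obtain C where C: "\<forall>v g. H10_rep v g \<longrightarrow> \<bar>F v\<bar> \<le> C * L2_norm g"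
    using 0 unfolding bounded_functional_def by blast
  have "\<bar>F (prim (step (\<lambda>_. 0)))\<bar> \<le> C * L2_norm (step (\<lambda>_. 0))" using C mean_free_rep[OF z0] by blast
  then have "F (prim (step (\<lambda>_. 0))) = 0" by (simp add: s0 L2_norm_def L2_inner_def)
  moreover have "bilin a d0 (prim (step (\<lambda>_. 0))) (prim (step (\<lambda>_. 0))) = 0"
    unfolding bilin_rep[OF mean_free_rep[OF z0] mean_free_rep[OF z0]]
    by (simp add: s0 L2_inner_def prim_def)
  ultimately show ?case using z z0 by metis
next
  case (Suc k)
  have sub: "mean_free k \<subseteq> mean_free (Suc k)" by (auto simp: mean_free_def)
  show ?case
  proof (cases "k = 0")
    case True
    have "mean_free (Suc k) = mean_free k"
    proof
      show "mean_free (Suc k) \<subseteq> mean_free k"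
      proof
        fix c assume c: "c \<in> mean_free (Suc k)"
        then have z: "\<forall>i\<ge>1. c i = 0" and m: "(\<Sum>i<l. c i * len i) = 0"
          using True by (auto simp: mean_free_def integral_step)
        have "(\<Sum>i<l. c i * len i) = (\<Sum>i\<in>{0}. c i * len i)"
          using z l_gt_1 by (intro sum.mono_neutral_right) auto
        then have "c 0 = 0" using m len_pos[of 0] l_gt_1 by auto
        then have "c i = 0" for i using z by (cases i) auto
        then show "c \<in> mean_free k" using c by (auto simp: mean_free_def)
      qed
    qed (rule sub)
    then show ?thesis using Suc by simp
  next
    case False
    have kl: "k < l" using Suc.prems by simp
    \<comment> \<open>The new direction has slope one on the cell \<open>k\<close>, compensated on the cell \<open>0\<close>.\<close>
    define e0 where "e0 = (\<lambda>i::nat. if i = k then 1 else if i = 0 then - len k / len 0 else 0)"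
    have e0: "e0 \<in> mean_free (Suc k)"
    proof -
      have "(\<Sum>i<l. e0 i * len i) = (\<Sum>i\<in>{0, k}. e0 i * len i)"
        using kl l_gt_1 by (intro sum.mono_neutral_right) (auto simp: e0_def)
      also have "\<dots> = 0" using False len_pos[of 0] l_gt_1 by (simp add: e0_def)
      finally show ?thesis by (auto simp: mean_free_def integral_step e0_def)
    qed
    note e0H = H10_rep_imp_in_H10[OF mean_free_rep[OF e0]]
    obtain p where p: "p \<in> mean_free k"
      "\<forall>d\<in>mean_free k. bilin a d0 (prim (step p)) (prim (step d)) = bilin a d0 (prim (step e0)) (prim (step d))"
      using Suc.IH[OF _ bounded_functional_bilin[OF e0H]] Suc.prems by auto
    define e where "e = (\<lambda>i. e0 i + (- 1) * p i)"
    have e: "e \<in> mean_free (Suc k)" unfolding e_def by (rule mean_free_lincomb[OF e0]) (use p sub in blast)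
    have ek: "e k = 1" using p(1) by (simp add: e_def e0_def mean_free_def)
    define E where "E = prim (step e)"
    have E_eq: "E = (\<lambda>x. prim (step e0) x + (- 1) * prim (step p) x)"
      unfolding E_def e_def by (rule prim_step_lincomb)
    note Erep = mean_free_rep[OF e, folded E_def]
    note EH = H10_rep_imp_in_H10[OF Erep]
    have pH: "prim (step p) \<in> H10" by (rule H10_rep_imp_in_H10[OF mean_free_rep[OF p(1)]])
    have orth: "bilin a d0 E (prim (step d)) = 0" if d: "d \<in> mean_free k" for d
    proof -
      have dH: "prim (step d) \<in> H10" by (rule H10_rep_imp_in_H10[OF mean_free_rep[OF d]])
      show ?thesis
        unfolding E_eq using p(2) d
        by (simp only: bilin_add_left[OF e0H H10_cmult[OF pH] dH] bilin_cmult_left[OF pH dH])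
    qed
    obtain u where u: "u \<in> mean_free k"
      "\<forall>d\<in>mean_free k. bilin a d0 (prim (step u)) (prim (step d)) = F (prim (step d))"
      using Suc.IH[OF _ Suc.prems(2)] Suc.prems by auto
    define U where "U = prim (step u)"
    have UH: "U \<in> H10" unfolding U_def by (rule H10_rep_imp_in_H10[OF mean_free_rep[OF u(1)]])
    define s where "s = F E / bilin a d0 E E"
    have sE: "s * bilin a d0 E E = F E"
    proof (cases "bilin a d0 E E = 0")
      case True
      then have "\<nu> * (L2_norm (step e))\<^sup>2 \<le> 0" using bilin_coercive[OF Erep] by simp
      then have "L2_norm (step e) = 0" using \<nu>_pos by (simp add: mult_le_0_iff)
      moreover obtain C where "\<forall>v g. H10_rep v g \<longrightarrow> \<bar>F v\<bar> \<le> C * L2_norm g"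
        using Suc.prems unfolding bounded_functional_def by blast
      ultimately have "F E = 0" using Erep by force
      then show ?thesis using True by simp
    qed (simp add: s_def)
    define r where "r = (\<lambda>i. u i + s * e i)"
    have r: "r \<in> mean_free (Suc k)" unfolding r_def by (rule mean_free_lincomb[OF _ e]) (use u sub in blast)
    have R_eq: "prim (step r) = (\<lambda>x. U x + s * E x)" unfolding r_def U_def E_def by (rule prim_step_lincomb)
    show ?thesis
    proof (rule bexI[OF _ r], rule ballI)
      fix d assume d: "d \<in> mean_free (Suc k)"
      define d' where "d' = (\<lambda>i. d i + (- d k) * e i)"
      have d'S: "d' \<in> mean_free (Suc k)" unfolding d'_def by (rule mean_free_lincomb[OF d e])
      have "d' i = 0" if "k \<le> i" for i
      proof (cases "i = k")
        case False
        then show ?thesis using d'S that by (simp add: mean_free_def)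
      qed (simp add: d'_def ek)
      then have d': "d' \<in> mean_free k" using d'S by (simp add: mean_free_def)
      define W where "W = prim (step d')"
      have WH: "W \<in> H10" unfolding W_def by (rule H10_rep_imp_in_H10[OF mean_free_rep[OF d']])
      have "d = (\<lambda>i. d' i + d k * e i)" by (simp add: d'_def)
      then have D_eq: "prim (step d) = (\<lambda>x. W x + d k * E x)"
        unfolding W_def E_def using prim_step_lincomb by metis
      have UE: "bilin a d0 U E = 0"
        using orth[OF u(1)] by (simp add: U_def bilin_commute)
      have "bilin a d0 (prim (step r)) (prim (step d))
          = bilin a d0 U (prim (step d)) + s * bilin a d0 E (prim (step d))"
        unfolding R_eq D_eq using H10_add[OF WH H10_cmult[OF EH, of "d k"]]
        by (simp add: bilin_add_left[OF UH H10_cmult[OF EH]] bilin_cmult_left[OF EH])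
      also have "bilin a d0 U (prim (step d)) = bilin a d0 U W + d k * bilin a d0 U E"
        using bounded_functional_bilin[OF UH] WH EH unfolding D_eq bounded_functional_def by blast
      also have "bilin a d0 E (prim (step d)) = bilin a d0 E W + d k * bilin a d0 E E"
        using bounded_functional_bilin[OF EH] WH EH unfolding D_eq bounded_functional_def by blast
      also have "bilin a d0 U W = F W" using u(2) d' by (simp add: U_def W_def)
      also have "bilin a d0 E W = 0" using orth[OF d'] by (simp add: W_def)
      also have "bilin a d0 U E = 0" by (rule UE)
      finally have "bilin a d0 (prim (step r)) (prim (step d)) = F W + d k * F E"
        using sE by (simp add: algebra_simps)
      also have "\<dots> = F (prim (step d))"
        using Suc.prems(2) WH EH unfolding D_eq bounded_functional_def by metis
      finally show "bilin a d0 (prim (step r)) (prim (step d)) = F (prim (step d))" .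
    qed
  qed
qed

lemma discrete_state_exists:
  assumes f: "integrable Om f"
  shows "\<exists>u. is_state (Vh_space X l) a d0 f u"
proof -
  have "bounded_functional (L2_inner f)"
    unfolding bounded_functional_def
  proof (intro conjI ballI allI exI impI)
    fix v w e assume vw: "v \<in> H10" "w \<in> H10"
    have "integrable Om (\<lambda>x. f x * v x)" "integrable Om (\<lambda>x. f x * w x)"
      using L2_inner_H10_add(3)[OF f f] vw by auto
    then show "L2_inner f (\<lambda>x. v x + e * w x) = L2_inner f v + e * L2_inner f w"
      by (simp add: L2_inner_def distrib_left mult.left_commute[of _ e])
  next
    fix v g assume v: "H10_rep v g"
    then have "v \<in> borel_measurable Om" by (simp add: H10_rep_def)
    from integral_mult_bound[OF f this H10_rep_AE_bound[OF v]]
    show "\<bar>L2_inner f v\<bar> \<le> (\<integral>x. \<bar>f x\<bar> \<partial>Om) * L2_norm g" by (simp add: L2_inner_def mult.commute)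
  qed
  then obtain c where c: "c \<in> mean_free l"
    "\<forall>d\<in>mean_free l. bilin a d0 (prim (step c)) (prim (step d)) = L2_inner f (prim (step d))"
    using galerkin_exists[of l] by blast
  have "is_state (Vh_space X l) a d0 f (prim (step c))"
    unfolding is_state_def
  proof (intro conjI ballI)
    show "prim (step c) \<in> Vh_space X l" using c(1) prim_step_in_Vh(1) by (simp add: mean_free_def)
    fix w assume "w \<in> Vh_space X l"
    then obtain d where wd: "\<forall>t\<in>{0..1}. w t = prim (step d) t" and w: "H10_rep w (step d)"
      using Vh_rep by blast
    define d' where "d' i = (if i < l then d i else 0)" for i
    have sd: "step d' = step d" by (simp add: step_def d'_def fun_eq_iff)
    have d': "d' \<in> mean_free l" using w by (auto simp: mean_free_def sd H10_rep_def) (simp add: d'_def)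
    have eq: "L2_inner g w = L2_inner g (prim (step d))" for g
      unfolding L2_inner_def using wd by (intro Bochner_Integration.integral_cong) auto
    have "bilin a d0 (prim (step c)) w = bilin a d0 (prim (step c)) (prim (step d'))"
      unfolding bilin_rep[OF mean_free_rep[OF c(1)] w] bilin_rep[OF mean_free_rep[OF c(1)] mean_free_rep[OF d']]
      by (simp add: sd eq)
    also have "\<dots> = L2_inner f (prim (step d'))" using c(2) d' by blast
    finally show "bilin a d0 (prim (step c)) w = L2_inner f w" by (simp add: sd eq)
  qed
  then show ?thesis by blast
qed

end

section \<open>Total variation of step functions and of cell averages\<close>

lemma point_signed_measure: "signed_measure (\<lambda>A. indicat_real A y)"
  unfolding signed_measure_def
  by (auto intro!: indicator_sums simp: disjoint_family_on_def)

lemma integral_Om_lborel: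
  assumes "f \<in> borel_measurable borel"
  shows "(\<integral>x. f x \<partial>Om) = (\<integral>x. indicat_real Omega x * f x \<partial>lborel)"
proof -
  have "(\<integral>x. f x \<partial>Om) = (\<integral>x. indicat_real Omega x * f x \<partial>lebesgue)"
    by (subst integral_restrict_space) simp_all
  also have "\<dots> = (\<integral>x. indicat_real Omega x * f x \<partial>lborel)"
    by (rule integral_completion) (use assms in simp)
  finally show ?thesis .
qed

context mesh
begin

text \<open>The derivative of a step function is the sum of its jumps times point masses at the
  interior nodes.\<close>

lemma step_BV:
  assumes s: "\<forall>i<l. \<forall>t\<in>cell i. s t = c i" and m: "s \<in> borel_measurable Om"
  shows "s \<in> BV" and "deriv_TV s \<le> (\<Sum>i<l - 1. \<bar>c (Suc i) - c i\<bar>)"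
proof -
  define J where "J i = c (Suc i) - c i" for i
  define y where "y i = X (Suc i)" for i
  have y: "y i \<in> Omega" if "i < l - 1" for i
    using X_strict_mono[of 0 "Suc i"] X_strict_mono[of "Suc i" l] X_0 X_l that by (simp add: y_def)
  define \<mu> where "\<mu> A = (\<Sum>i<l - 1. J i * indicat_real A (y i))" for A
  have "\<exists>P N. measure_difference \<mu> P N"
  proof (rule measure_difference_exists)
    show "signed_measure (\<lambda>A. \<Sum>i<l - 1. max (J i) 0 * indicat_real A (y i))"
      "signed_measure (\<lambda>A. \<Sum>i<l - 1. max (- J i) 0 * indicat_real A (y i))"
      by (intro signed_measure_sum signed_measure_cmult point_signed_measure; simp)+
    show "\<mu> A = (\<Sum>i<l - 1. max (J i) 0 * indicat_real A (y i)) - (\<Sum>i<l - 1. max (- J i) 0 * indicat_real A (y i))" for A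
      unfolding \<mu>_def sum_subtractf[symmetric] left_diff_distrib[symmetric]
      by (intro sum.cong) auto
  qed (auto intro!: sum_nonneg)
  then obtain P N where d: "measure_difference \<mu> P N" by blast
  have cdf: "cdf \<mu> t = c k - c 0" if k: "k < l" "t \<in> cell k" for k t
  proof -
    have "cdf \<mu> t = (\<Sum>i<l - 1. if i < k then J i else 0)"
      unfolding cdf_def \<mu>_def
    proof (rule sum.cong)
      fix i assume i: "i \<in> {..<l - 1}"
      have "X (Suc i) \<le> X k" if "i < k" using that k by (intro X_mono) auto
      moreover have "X (Suc k) \<le> X (Suc i)" if "\<not> i < k" using that i by (intro X_mono) auto
      ultimately have "y i < t \<longleftrightarrow> i < k" using k(2) unfolding y_def by fastforce
      then show "J i * indicat_real ({..<t} \<inter> Omega) (y i) = (if i < k then J i else 0)"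
        using y[of i] i by (simp add: indicator_def)
    qed simp
    also have "\<dots> = (\<Sum>i\<in>{..<l - 1} \<inter> {i. i < k}. J i)" by (subst sum.inter_restrict) auto
    also have "{..<l - 1} \<inter> {i. i < k} = {..<k}" using k by auto
    also have "(\<Sum>i<k. J i) = c k - c 0" unfolding J_def by (rule sum_lessThan_telescope)
    finally show ?thesis .
  qed
  have "AE t in Om. s t = c 0 + cdf \<mu> t"
    using AE_cell by eventually_elim (use s cdf in auto)
  then have \<mu>: "is_measure_deriv s \<mu>" by (rule rep_is_measure_deriv[OF d m])
  have "AE t in Om. step c t = s t" using step_AE_eq[OF s] by eventually_elim simp
  then have "integrable Om s"
    using integrable_cong_AE[OF m step_measurable, of c] step_integrable[of c] step_AE_eq[OF s] by simp
  then show "s \<in> BV" using \<mu> by (auto simp: BV_def)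
  have "total_variation \<mu> \<le> (\<Sum>i<l - 1. \<bar>J i\<bar>)"
  proof (rule total_variation_least)
    fix \<A> assume \<A>: "finite \<A>" "\<A> \<subseteq> Borel_Omega" "partition_on Omega \<A>"
    have "(\<Sum>A\<in>\<A>. \<bar>\<mu> A\<bar>) \<le> (\<Sum>A\<in>\<A>. \<Sum>i<l - 1. \<bar>J i\<bar> * indicat_real A (y i))"
      unfolding \<mu>_def by (intro sum_mono order_trans[OF sum_abs]) (simp add: abs_mult)
    also have "\<dots> = (\<Sum>i<l - 1. \<Sum>A\<in>\<A>. \<bar>J i\<bar> * indicat_real A (y i))" by (rule sum.swap)
    also have "\<dots> = (\<Sum>i<l - 1. \<bar>J i\<bar>)"
    proof (rule sum.cong)
      fix i assume i: "i \<in> {..<l - 1}"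
      then have "y i \<in> \<Union>\<A>" using y \<A>(3) by (simp add: partition_on_def)
      then obtain B where B: "B \<in> \<A>" "y i \<in> B" by blast
      have "(\<Sum>A\<in>\<A>. \<bar>J i\<bar> * indicat_real A (y i)) = (\<Sum>A\<in>{B}. \<bar>J i\<bar> * indicat_real A (y i))"
      proof (rule sum.mono_neutral_right[OF \<A>(1)])
        show "\<forall>A\<in>\<A> - {B}. \<bar>J i\<bar> * indicat_real A (y i) = 0"
        proof
          fix A assume "A \<in> \<A> - {B}"
          then have "A \<inter> B = {}" using B \<A>(3) by (auto simp: partition_on_def disjoint_def)
          then show "\<bar>J i\<bar> * indicat_real A (y i) = 0" using B by (auto simp: indicator_def)
        qed
      qed (use B in auto)
      then show "(\<Sum>A\<in>\<A>. \<bar>J i\<bar> * indicat_real A (y i)) = \<bar>J i\<bar>" using B by simp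
    qed simp
    finally show "(\<Sum>A\<in>\<A>. \<bar>\<mu> A\<bar>) \<le> (\<Sum>i<l - 1. \<bar>J i\<bar>)" .
  qed
  then show "deriv_TV s \<le> (\<Sum>i<l - 1. \<bar>c (Suc i) - c i\<bar>)"
    unfolding deriv_TV_eq[OF \<mu>] J_def .
qed

lemma Qh_subset_BV: "Qh_space X l \<subseteq> BV"
  using step_BV(1) Qh_step Qh_measurable by blast

lemma cell_int_substitution:
  assumes f: "f \<in> borel_measurable borel" and i: "i < l"
  shows "cell_int f i = len i * (\<integral>s. f (X i + len i * s) \<partial>Om)"
proof -
  note lp = len_pos[OF i]
  have "cell_int f i = (\<integral>t. indicat_real Omega t * (indicat_real (cell i) t * f t) \<partial>lborel)"
    unfolding cell_int_def by (rule integral_Om_lborel) (use f in simp)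
  also have "\<dots> = (\<integral>t. indicat_real (cell i) t * f t \<partial>lborel)"
    using cell_subset[OF i] by (intro Bochner_Integration.integral_cong) (auto simp: indicator_def)
  also have "\<dots> = \<bar>len i\<bar> *\<^sub>R (\<integral>s. indicat_real (cell i) (X i + len i * s) * f (X i + len i * s) \<partial>lborel)"
    by (rule lborel_integral_real_affine) (use lp in simp)
  also have "(\<lambda>s. indicat_real (cell i) (X i + len i * s) * f (X i + len i * s))
      = (\<lambda>s. indicat_real Omega s * f (X i + len i * s))"
  proof
    fix s
    have "X i + len i * s \<in> cell i \<longleftrightarrow> s \<in> Omega"
    proof -
      have "X (Suc i) = X i + len i" by (simp add: len_def)
      then have "X i + len i * s < X (Suc i) \<longleftrightarrow> len i * s < len i * 1" by simp
      then show ?thesis using lp by (simp add: zero_less_mult_iff)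
    qed
    then show "indicat_real (cell i) (X i + len i * s) * f (X i + len i * s)
      = indicat_real Omega s * f (X i + len i * s)" by (simp add: indicator_def)
  qed
  also have "(\<integral>s. indicat_real Omega s * f (X i + len i * s) \<partial>lborel) = (\<integral>s. f (X i + len i * s) \<partial>Om)"
    by (rule integral_Om_lborel[symmetric]) (use f in measurable)
  finally show ?thesis using lp by simp
qed

text \<open>All averages are integrals over the same parameter \<open>s\<close> of point values in the respective
  cells, and for each \<open>s\<close> the sum of the differences of these point values is bounded by the
  total variation.\<close>

lemma TV_avg:
  assumes q: "q \<in> BV"
  shows "(\<Sum>i<l - 1. \<bar>avg q (Suc i) - avg q i\<bar>) \<le> deriv_TV q"
proof -
  obtain \<mu> where iq: "integrable Om q" and \<mu>: "is_measure_deriv q \<mu>" using q by (auto simp: BV_def)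
  obtain P N where d: "measure_difference \<mu> P N" using \<mu> is_measure_deriv_iff by blast
  obtain c where c: "AE x in Om. q x = c + cdf \<mu> x" using is_measure_deriv_rep[OF iq \<mu>] by blast
  define Q where "Q x = c + cdf \<mu> x" for x
  have Qm [measurable]: "Q \<in> borel_measurable borel"
    unfolding Q_def using cdf_difference_measurable[OF d] by simp
  define y where "y i s = X i + len i * s" for i s
  have av: "avg q i = (\<integral>s. Q (y i s) \<partial>Om)" if "i < l" for i
  proof -
    have "cell_int q i = cell_int Q i"
      by (rule cell_int_cong_AE) (use c borel_measurable_integrable[OF iq] borel_Om[OF Qm] in \<open>simp_all add: Q_def\<close>)
    then show ?thesis
      using cell_int_substitution[OF Qm that] len_pos[OF that] by (simp add: avg_def y_def)
  qed
  have Qi: "integrable Om (\<lambda>s. Q (y i s))" for i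
  proof (rule integrable_const_bound_Om)
    show "(\<lambda>s. Q (y i s)) \<in> borel_measurable Om" unfolding y_def by (rule borel_Om) measurable
    show "AE s in Om. \<bar>Q (y i s)\<bar> \<le> \<bar>c\<bar> + (measure P Omega + measure N Omega)"
      unfolding Q_def by (intro AE_I2 order_trans[OF abs_triangle_ineq] add_left_mono cdf_difference_bound[OF d])
  qed
  have y_cell: "y i s \<in> cell i" if "i < l" "s \<in> Omega" for i s
  proof -
    have "0 < len i * s" "len i * s < len i * 1" using len_pos[OF that(1)] that(2) by simp_all
    then show ?thesis by (simp add: y_def len_def)
  qed
  have pt: "(\<Sum>i<l - 1. \<bar>Q (y (Suc i) s) - Q (y i s)\<bar>) \<le> total_variation \<mu>" if s: "s \<in> Omega" for s
  proof -
    define A where "A i = {y i s..<y (Suc i) s} \<inter> Omega" for i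
    have y_mono: "y i s < y j s" if "i < j" "j < l" for i j
    proof -
      have "X (Suc i) \<le> X j" using that by (intro X_mono) auto
      then show ?thesis using y_cell[of i s] y_cell[of j s] that s by auto
    qed
    have "(\<Sum>i<l - 1. \<bar>\<mu> (A i)\<bar>) \<le> total_variation \<mu>"
    proof (rule total_variation_upper[OF d])
      show "A i \<in> Borel_Omega" for i by (simp add: A_def Borel_Omega_iff)
      show "A i \<noteq> {}" if "i \<in> {..<l - 1}" for i
      proof -
        have i: "i < l" "Suc i < l" using that by auto
        have "y i s \<in> A i" unfolding A_def
          using y_mono[of i "Suc i"] y_cell[OF i(1) s] cell_subset[OF i(1)] i by auto
        then show ?thesis by blast
      qed
      show "disjoint_family_on A {..<l - 1}"
      proof -
        have "A i \<inter> A j = {}" if "i < j" "j < l - 1" for i j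
        proof -
          have "y (Suc i) s \<le> y j s"
          proof (cases "Suc i = j")
            case False
            then have "y (Suc i) s < y j s" using that by (intro y_mono) auto
            then show ?thesis by simp
          qed simp
          then show ?thesis by (auto simp: A_def)
        qed
        then show ?thesis unfolding disjoint_family_on_def
          by (metis Int_commute lessThan_iff linorder_neqE_nat)
      qed
    qed simp
    moreover have "\<mu> (A i) = Q (y (Suc i) s) - Q (y i s)" if "i \<in> {..<l - 1}" for i
    proof -
      have "y i s \<le> y (Suc i) s" using that by (intro less_imp_le y_mono) auto
      then show ?thesis unfolding A_def Q_def by (simp add: cdf_diff_eq[OF d, symmetric])
    qed
    ultimately show ?thesis by simp
  qed
  have "(\<Sum>i<l - 1. \<bar>avg q (Suc i) - avg q i\<bar>) \<le> (\<Sum>i<l - 1. \<integral>s. \<bar>Q (y (Suc i) s) - Q (y i s)\<bar> \<partial>Om)"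
  proof (rule sum_mono)
    fix i assume "i \<in> {..<l - 1}"
    then have "avg q (Suc i) - avg q i = (\<integral>s. Q (y (Suc i) s) - Q (y i s) \<partial>Om)"
      using Qi by (simp add: av)
    then show "\<bar>avg q (Suc i) - avg q i\<bar> \<le> (\<integral>s. \<bar>Q (y (Suc i) s) - Q (y i s)\<bar> \<partial>Om)"
      by (simp only: integral_abs_bound)
  qed
  also have "\<dots> = (\<integral>s. (\<Sum>i<l - 1. \<bar>Q (y (Suc i) s) - Q (y i s)\<bar>) \<partial>Om)"
    by (rule Bochner_Integration.integral_sum[symmetric]) (use Qi in simp)
  also have "\<dots> \<le> (\<integral>s. total_variation \<mu> \<partial>Om)"
    by (rule integral_mono) (use Qi pt in auto)
  also have "\<dots> = deriv_TV q" by (simp add: deriv_TV_eq[OF \<mu>])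
  finally show ?thesis .
qed

lemma deriv_TV_step_avg: "q \<in> BV \<Longrightarrow> deriv_TV (step (avg q)) \<le> deriv_TV q"
  using step_BV(2)[OF _ step_measurable, of "avg q" "avg q"] step_cell TV_avg[of q] by (meson order_trans)

text \<open>On each cell a function of bounded variation differs from its average by at most the
  growth of a fixed monotone function.\<close>

lemma avg_L1_error:
  assumes iq: "integrable Om q" and d: "measure_difference \<mu> P N" and c: "AE x in Om. q x = c + cdf \<mu> x"
  shows "(\<integral>t. \<bar>step (avg q) t - q t\<bar> \<partial>Om) \<le> h * (measure P Omega + measure N Omega)"
proof -
  have P: "finite_measure P" "sets P = Borel_Omega" and N: "finite_measure N" "sets N = Borel_Omega"
    using d by (auto simp: measure_difference_def)
  define Q where "Q x = c + cdf \<mu> x" for x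
  have Qm: "Q \<in> borel_measurable Om"
    unfolding Q_def using borel_Om[OF cdf_difference_measurable[OF d]] by simp
  have Qi: "integrable Om Q" unfolding Q_def using cdf_difference_integrable[OF d] by simp
  have avq: "avg q i = avg Q i" for i
  proof -
    have "cell_int q i = cell_int Q i"
      by (rule cell_int_cong_AE) (use c borel_measurable_integrable[OF iq] Qm in \<open>simp_all add: Q_def\<close>)
    then show ?thesis by (simp add: avg_def)
  qed
  define G where "G t = cdf (measure P) t + cdf (measure N) t" for t
  have Gmono: "G s \<le> G t" if "s \<le> t" for s t
    unfolding G_def using cdf_mono[OF P that] cdf_mono[OF N that] by simp
  have QG: "\<bar>Q t - Q s\<bar> \<le> G (X (Suc i)) - G (X i)" if "s \<in> cell i" "t \<in> cell i" for s t i
  proof -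
    have "\<bar>cdf (measure M) t - cdf (measure M) s\<bar> \<le> cdf (measure M) (X (Suc i)) - cdf (measure M) (X i)"
      if M: "finite_measure M" "sets M = Borel_Omega" for M
    proof -
      have le: "X i \<le> s" "s \<le> X (Suc i)" "X i \<le> t" "t \<le> X (Suc i)"
        using \<open>s \<in> cell i\<close> \<open>t \<in> cell i\<close> by auto
      show ?thesis using le[THEN cdf_mono[OF M]] by linarith
    qed
    from this[OF P] this[OF N] show ?thesis
      unfolding Q_def G_def cdf_difference[OF d] by linarith
  qed
  define w where "w i = G (X (Suc i)) - G (X i)" for i
  have "AE t in Om. \<bar>step (avg q) t - q t\<bar> \<le> step w t"
    using c AE_cell
  proof eventually_elim
    case (elim t)
    then obtain i where i: "i < l" "t \<in> cell i" by blast
    have "\<bar>Q t - avg Q i\<bar> \<le> w i"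
      unfolding w_def by (rule avg_oscillation[OF Qi i QG[OF _ i(2)]])
    then show ?case
      using elim(1) avq by (simp add: step_cell[OF i] Q_def abs_minus_commute)
  qed
  then have "(\<integral>t. \<bar>step (avg q) t - q t\<bar> \<partial>Om) \<le> (\<integral>t. step w t \<partial>Om)"
    by (intro integral_mono_AE) (use iq step_integrable in auto)
  also have "\<dots> = (\<Sum>i<l. w i * len i)" by (rule integral_step)
  also have "\<dots> \<le> (\<Sum>i<l. w i * h)"
    using len_le_h X_Suc Gmono by (intro sum_mono mult_left_mono) (auto simp: w_def less_imp_le)
  also have "\<dots> = h * (G (X l) - G (X 0))"
    unfolding sum_distrib_right[symmetric] w_def
    using sum_lessThan_telescope[of "\<lambda>n. G (X n)" l] by simp
  also have "\<dots> \<le> h * (measure P Omega + measure N Omega)"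
    using h_pos cdf_bounds[OF P, of "X l"] cdf_bounds[OF P, of "X 0"]
      cdf_bounds[OF N, of "X l"] cdf_bounds[OF N, of "X 0"]
    by (intro mult_left_mono) (auto simp: G_def)
  finally show ?thesis .
qed

end

section \<open>Interpolation\<close>

context mesh
begin

text \<open>In one dimension the derivative of the nodal interpolant is the cell average of the
  derivative.\<close>

definition interpolant :: "(real \<Rightarrow> real) \<Rightarrow> real \<Rightarrow> real" where
  "interpolant k = prim (step (avg k))"

lemma interpolation:
  assumes v: "H10_rep v k" and k: "\<And>s t. s \<in> {0..1} \<Longrightarrow> t \<in> {0..1} \<Longrightarrow> \<bar>k s - k t\<bar> \<le> M * \<bar>s - t\<bar>"
  shows "interpolant k \<in> Vh_space X l" and "H10_rep (interpolant k) (step (avg k))"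
    and "AE t in Om. \<bar>k t - step (avg k) t\<bar> \<le> M * h"
    and "AE t in Om. \<bar>v t - interpolant k t\<bar> \<le> M * h\<^sup>2"
    and "L2_norm (\<lambda>t. k t - step (avg k) t) \<le> M * h"
    and "H10_rep (\<lambda>t. v t - interpolant k t) (\<lambda>t. k t - step (avg k) t)"
proof -
  have kL2: "in_L2 k" and k0: "(\<integral>t. k t \<partial>Om) = 0" and vp: "AE t in Om. v t = prim k t"
    using v by (auto simp: H10_rep_def)
  have ki: "integrable Om k" by (rule in_L2_integrable[OF kL2])
  have "(\<integral>t. step (avg k) t \<partial>Om) = 0"
    using prim_avg_node[OF ki, of l] k0 X_l by (simp add: prim_ge_1)
  from prim_step_in_Vh[OF this]
  show 1: "interpolant k \<in> Vh_space X l" and 2: "H10_rep (interpolant k) (step (avg k))"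
    by (simp_all add: interpolant_def)
  show 3: "AE t in Om. \<bar>k t - step (avg k) t\<bar> \<le> M * h"
    using AE_cell
  proof eventually_elim
    case (elim t)
    then obtain i where i: "i < l" "t \<in> cell i" by blast
    have "\<bar>k t - avg k i\<bar> \<le> M * h"
      by (rule avg_Lipschitz[OF ki _ i]) (rule k; auto)
    then show ?case using step_cell[OF i] by simp
  qed
  show "AE t in Om. \<bar>v t - interpolant k t\<bar> \<le> M * h\<^sup>2"
  proof -
    have "AE t in Om. t \<notin> X ` {..l}" by (rule AE_Om_not_finite) simp
    then have "AE t in Om. \<bar>prim k t - interpolant k t\<bar> \<le> M * h * h"
      by (rule AE_mp)
        (use prim_avg_error[OF ki 3] in \<open>auto simp: interpolant_def intro!: AE_I2\<close>)
    with vp show ?thesis by eventually_elim (simp add: power2_eq_square mult.assoc)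
  qed
  show "L2_norm (\<lambda>t. k t - step (avg k) t) \<le> M * h"
    by (rule L2_norm_le[OF 3]) (use in_L2_measurable[OF kL2] in simp)
  show "H10_rep (\<lambda>t. v t - interpolant k t) (\<lambda>t. k t - step (avg k) t)"
    by (rule H10_rep_minus[OF v 2])
qed

lemma avg_bound:
  assumes f: "integrable Om f" "AE t in Om. \<bar>f t\<bar> \<le> B" and i: "i < l"
  shows "\<bar>avg f i\<bar> \<le> B"
proof -
  have "\<bar>\<integral>t. indicat_real (cell i) t * f t \<partial>Om\<bar> \<le> B * (\<integral>t. \<bar>indicat_real (cell i) t\<bar> \<partial>Om)"
    by (rule integral_mult_bound[OF _ borel_measurable_integrable[OF f(1)] f(2)])
      (use integrable_cell[of "\<lambda>_. 1" i] in simp)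
  then have "\<bar>cell_int f i\<bar> \<le> B * len i" using cell_int_1[OF i] by (simp add: cell_int_def)
  then show ?thesis using len_pos[OF i] by (simp add: avg_def abs_divide divide_le_eq)
qed

lemma avg_add:
  assumes "integrable Om f" "integrable Om g"
  shows "avg (\<lambda>t. f t + g t) i = avg f i + avg g i"
  using integrable_cell[OF assms(1), of i] integrable_cell[OF assms(2), of i]
  by (simp add: avg_def cell_int_def distrib_left add_divide_distrib)

lemma avg_mult_step:
  assumes "i < l"
  shows "avg (\<lambda>t. f t * step c t) i = c i * avg f i"
proof -
  have "(\<lambda>t. indicat_real (cell i) t * (f t * step c t)) = (\<lambda>t. c i * (indicat_real (cell i) t * f t))"
    using step_cell[OF assms] by (auto simp: indicator_def fun_eq_iff)
  then show ?thesis by (simp add: avg_def cell_int_def)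
qed

lemma avg_constant:
  assumes f: "integrable Om f"
    and orth: "\<And>c. (\<integral>t. step c t \<partial>Om) = 0 \<Longrightarrow> (\<integral>t. f t * step c t \<partial>Om) = 0" and i: "i < l"
  shows "avg f i = (\<integral>t. f t \<partial>Om)"
proof -
  have sum1: "(\<Sum>j<l. len j) = 1"
    unfolding len_def using sum_lessThan_telescope[of X l] X_0 X_l by simp
  \<comment> \<open>The indicator of the cell \<open>i\<close>, divided by its length, minus one: it has mean zero because the
    lengths add up to one.\<close>
  define c where "c j = (if j = i then 1 / len i else 0) - 1" for j
  have s: "(\<Sum>j<l. (if j = i then 1 / len i else 0) * b j) = b i / len i" for b
    using i by (simp add: if_distrib[of "\<lambda>x. x * _"] cong: if_cong)
  have "(\<integral>t. step c t \<partial>Om) = 0"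
    using s[of len] sum1 len_pos[OF i] by (simp add: integral_step c_def left_diff_distrib sum_subtractf)
  from orth[OF this] have "(\<Sum>j<l. c j * cell_int f j) = 0" by (simp add: integral_mult_step[OF f])
  then have "avg f i = (\<Sum>j<l. cell_int f j)"
    using s[of "cell_int f"] by (simp add: c_def left_diff_distrib sum_subtractf avg_def)
  also have "\<dots> = (\<integral>t. f t \<partial>Om)" using prim_node[OF f, of l] X_l by (simp add: prim_ge_1)
  finally show ?thesis .
qed

end

section \<open>Error estimates\<close>

locale optimality = galerkin +
  fixes \<alpha> :: real and ud u q z ku kz uh qh zh :: "real \<Rightarrow> real" and \<mu> P N c M K C0
  assumes \<alpha>_pos: "\<alpha> > 0" and ud: "in_L2 ud"
    and opt: "optimal_triple H10 BV a d0 ud \<alpha> u q z"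
    and opth: "optimal_triple (Vh_space X l) (Qh_space X l) a d0 ud \<alpha> uh qh zh"
    and ku: "H10_rep u ku" and kz: "H10_rep z kz"
    and ku_Lip: "\<And>s t. s \<in> {0..1} \<Longrightarrow> t \<in> {0..1} \<Longrightarrow> \<bar>ku s - ku t\<bar> \<le> M * \<bar>s - t\<bar>"
    and kz_Lip: "\<And>s t. s \<in> {0..1} \<Longrightarrow> t \<in> {0..1} \<Longrightarrow> \<bar>kz s - kz t\<bar> \<le> M * \<bar>s - t\<bar>"
    and kz_bound: "\<And>t. t \<in> {0..1} \<Longrightarrow> \<bar>kz t\<bar> \<le> K"
    and \<mu>: "measure_difference \<mu> P N" and q_rep: "AE x in Om. q x = c + cdf \<mu> x"
    and C0: "L1_norm qh \<le> C0"
begin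

definition V :: real where "V = measure P Omega + measure N Omega"

definition iu where "iu = interpolant ku"
definition iz where "iz = interpolant kz"
definition gz where "gz = step (avg kz)"
definition E where "E = L2_norm (\<lambda>x. u x - uh x)"

lemma M_nonneg: "0 \<le> M"
  using ku_Lip[of 0 1] by simp

lemma K_nonneg: "0 \<le> K"
  using kz_bound[of 0] by simp

lemma V_nonneg: "0 \<le> V"
  by (simp add: V_def)

lemma C0_nonneg: "0 \<le> C0"
  using C0 by (rule order_trans[rotated]) (simp add: L1_norm_def)

lemma E_nonneg: "0 \<le> E"
  by (simp add: E_def L2_norm_nonneg)

lemma states: "is_state H10 a d0 q u" "is_state (Vh_space X l) a d0 qh uh"
  and adjoints: "is_adjoint H10 a d0 ud u z" "is_adjoint (Vh_space X l) a d0 ud uh zh"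
  using opt opth by (auto simp: optimal_triple_def)

lemma in_Vh: "uh \<in> Vh_space X l" "zh \<in> Vh_space X l" "iu \<in> Vh_space X l" "iz \<in> Vh_space X l"
  using states adjoints interpolation(1)[OF ku ku_Lip] interpolation(1)[OF kz kz_Lip]
  by (auto simp: is_state_def is_adjoint_def iu_def iz_def)

lemma in_H10: "u \<in> H10" "z \<in> H10" "uh \<in> H10" "zh \<in> H10" "iu \<in> H10" "iz \<in> H10"
  using states adjoints in_Vh Vh_subset_H10 by (auto simp: is_state_def is_adjoint_def)

lemma in_L2: "in_L2 u" "in_L2 z" "in_L2 uh" "in_L2 zh" "in_L2 iu" "in_L2 iz"
  using in_H10 in_H10_imp_rep H10_rep_in_L2 by blast+

lemma q_in_BV: "q \<in> BV" and qh_in_Qh: "qh \<in> Qh_space X l" and qh_in_BV: "qh \<in> BV"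
  using opt opth Qh_subset_BV by (auto simp: optimal_triple_def optimal_control_def)

lemma q_int: "integrable Om q" "integrable Om qh"
  using q_in_BV qh_in_BV by (auto simp: BV_def)

text \<open>The slopes of the discrete state and of the discrete adjoint state on the cells.\<close>

definition cu where "cu = (SOME c. H10_rep uh (step c))"
definition cz where "cz = (SOME c. H10_rep zh (step c))"

lemma uh_rep: "H10_rep uh (step cu)" and zh_rep: "H10_rep zh (step cz)"
  unfolding cu_def cz_def using Vh_rep in_Vh someI_ex[of "\<lambda>c. H10_rep uh (step c)"]
    someI_ex[of "\<lambda>c. H10_rep zh (step c)"] by blast+

lemma iz_rep: "H10_rep iz gz"
  using interpolation(2)[OF kz kz_Lip] by (simp add: iz_def gz_def)

definition De where "De t = kz t - step cz t"

lemma e_rep: "H10_rep (\<lambda>x. z x - zh x) De"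
  unfolding De_def by (rule H10_rep_minus[OF kz zh_rep])

text \<open>The constants \<open>c1\<close> to \<open>c7\<close> are explicit in the data and the solution of the continuous problem
  and in \<open>C0\<close>; the grid does not occur in them.\<close>

definition c1 where "c1 = M + ((A + D) * M + 1) / \<nu>"

lemma c1_nonneg: "0 \<le> c1"
  using M_nonneg A_pos D_nonneg \<nu>_pos by (simp add: c1_def)

text \<open>Galerkin's argument for the adjoint equation, whose right hand side is perturbed by the
  error of the state.\<close>

lemma adjoint_energy_error: "L2_norm De \<le> c1 * (h + E)"
proof -
  define e where "e = (\<lambda>x. iz x - zh x)"
  define s where "s = (\<lambda>x. gz x - step cz x)"
  have e_rep': "H10_rep e s" unfolding e_def s_def by (rule H10_rep_minus[OF iz_rep zh_rep])
  have eVh: "e \<in> Vh_space X l" unfolding e_def using Vh_lincomb[OF in_Vh(4,2), of 1 "-1"] by simp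
  have eH: "e \<in> H10" using eVh Vh_subset_H10 by blast
  note e2 = H10_rep_in_L2[OF e_rep']
  have S: "L2_norm s \<ge> 0" by (rule L2_norm_nonneg)
  have "bilin a d0 e z = L2_inner e (\<lambda>x. u x - ud x)" using adjoints(1) eH by (simp add: is_adjoint_def)
  moreover have "bilin a d0 e zh = L2_inner e (\<lambda>x. uh x - ud x)"
    using adjoints(2) eVh by (simp add: is_adjoint_def)
  moreover have "L2_inner e (\<lambda>x. u x - ud x) - L2_inner e (\<lambda>x. uh x - ud x) = L2_inner e (\<lambda>x. u x - uh x)"
    using L2_inner_minus_left[OF in_L2_minus[OF in_L2(1) ud] in_L2_minus[OF in_L2(3) ud] e2]
    by (simp add: L2_inner_commute[of e])
  moreover have "bilin a d0 e e = bilin a d0 e iz - bilin a d0 e zh"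
    using bilin_minus_right[OF eH in_H10(6,4)] by (simp add: e_def)
  moreover have "bilin a d0 e (\<lambda>x. z x - iz x) = bilin a d0 e z - bilin a d0 e iz"
    by (rule bilin_minus_right[OF eH in_H10(2,6)])
  ultimately have eq: "bilin a d0 e e = L2_inner e (\<lambda>x. u x - uh x) - bilin a d0 e (\<lambda>x. z x - iz x)" by simp
  have "\<bar>L2_inner e (\<lambda>x. u x - uh x)\<bar> \<le> L2_norm e * E"
    unfolding E_def by (rule Cauchy_Schwarz[OF e2 in_L2_minus[OF in_L2(1,3)]])
  also have "\<dots> \<le> L2_norm s * E"
    by (rule mult_right_mono[OF H10_rep_L2_bound[OF e_rep'] E_nonneg])
  finally have 1: "\<bar>L2_inner e (\<lambda>x. u x - uh x)\<bar> \<le> L2_norm s * E" .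
  have "\<bar>bilin a d0 e (\<lambda>x. z x - iz x)\<bar> \<le> (A + D) * L2_norm s * L2_norm (\<lambda>t. kz t - gz t)"
    using bilin_bound[OF e_rep' interpolation(6)[OF kz kz_Lip]] by (simp add: iz_def gz_def)
  also have "\<dots> \<le> (A + D) * L2_norm s * (M * h)"
    using interpolation(5)[OF kz kz_Lip] A_pos D_nonneg S
    by (intro mult_left_mono) (auto simp: gz_def)
  finally have 2: "\<bar>bilin a d0 e (\<lambda>x. z x - iz x)\<bar> \<le> (A + D) * L2_norm s * (M * h)" .
  have "\<nu> * (L2_norm s)\<^sup>2 \<le> L2_norm s * E + (A + D) * L2_norm s * (M * h)"
    using bilin_coercive[OF e_rep'] 1 2 eq by linarith
  then have "L2_norm s * (\<nu> * L2_norm s) \<le> L2_norm s * (E + (A + D) * M * h)"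
    by (simp add: power2_eq_square algebra_simps)
  then have "\<nu> * L2_norm s \<le> E + (A + D) * M * h"
    using S E_nonneg A_pos D_nonneg M_nonneg h_pos
    by (cases "L2_norm s = 0") (auto simp: mult_le_cancel_left)
  then have s_le: "L2_norm s \<le> (E + (A + D) * M * h) / \<nu>"
    using \<nu>_pos by (simp add: pos_le_divide_eq mult.commute)
  have L2': "in_L2 kz" "in_L2 gz" "in_L2 (step cz)"
    using kz iz_rep zh_rep by (auto simp: H10_rep_def)
  have "De = (\<lambda>t. (kz t - gz t) + s t)" by (simp add: De_def s_def fun_eq_iff)
  then have "L2_norm De \<le> L2_norm (\<lambda>t. kz t - gz t) + L2_norm s"
    using L2_norm_triangle[OF in_L2_minus[OF L2'(1,2)], of s] L2' by (simp add: s_def in_L2_minus)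
  also have "\<dots> \<le> M * h + (E + (A + D) * M * h) / \<nu>"
    using interpolation(5)[OF kz kz_Lip] s_le by (intro add_mono) (auto simp: gz_def)
  also have "\<dots> \<le> c1 * (h + E)"
  proof -
    have "c1 * (h + E) - (M * h + (E + (A + D) * M * h) / \<nu>) = h / \<nu> + (M + (A + D) * M / \<nu>) * E"
      by (simp add: c1_def algebra_simps add_divide_distrib)
    moreover have "0 \<le> h / \<nu> + (M + (A + D) * M / \<nu>) * E"
      using h_pos \<nu>_pos M_nonneg A_pos D_nonneg E_nonneg by simp
    ultimately show ?thesis by linarith
  qed
  finally show ?thesis .
qed

text \<open>Testing with the state itself; in one dimension the supremum norm of the state is bounded by the
  energy norm, so the control enters through its \<open>L1\<close> norm.\<close>

lemma state_energy_bound: "L2_norm (step cu) \<le> C0 / \<nu>"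
proof -
  have G: "L2_norm (step cu) \<ge> 0" by (rule L2_norm_nonneg)
  have "\<nu> * (L2_norm (step cu))\<^sup>2 \<le> bilin a d0 uh uh" by (rule bilin_coercive[OF uh_rep])
  also have "\<dots> = L2_inner qh uh" using states(2) in_Vh(1) by (simp add: is_state_def)
  also have "\<dots> \<le> L2_norm (step cu) * L1_norm qh"
    using integral_mult_bound[OF q_int(2) in_L2_measurable[OF in_L2(3)] H10_rep_AE_bound[OF uh_rep]]
    by (simp add: L2_inner_def L1_norm_def)
  also have "\<dots> \<le> L2_norm (step cu) * C0" by (rule mult_left_mono[OF C0 G])
  finally have "L2_norm (step cu) * (\<nu> * L2_norm (step cu)) \<le> L2_norm (step cu) * C0"
    by (simp add: power2_eq_square mult_ac)
  then have "\<nu> * L2_norm (step cu) \<le> C0"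
    using G C0_nonneg by (cases "L2_norm (step cu) = 0") (auto simp: mult_le_cancel_left)
  then show ?thesis using \<nu>_pos by (simp add: pos_le_divide_eq mult.commute)
qed

definition Pq where "Pq = step (avg q)"

lemma Pq_int: "integrable Om Pq"
  unfolding Pq_def by (rule step_integrable)

lemma Pq_error: "(\<integral>t. \<bar>Pq t - q t\<bar> \<partial>Om) \<le> h * V"
  unfolding Pq_def V_def by (rule avg_L1_error[OF q_int(1) \<mu> q_rep])

text \<open>The sum of the variational inequalities of both problems, tested with the discrete control
  and with the cell averages of the continuous control; the latter do not increase the total
  variation.\<close>

lemma summed_inequalities: "0 \<le> L2_inner qh z - L2_inner q z + L2_inner Pq zh - L2_inner qh zh"
proof -
  obtain v where v: "is_state H10 a d0 qh v" using state_exists[OF q_int(2)] by blast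
  have "0 \<le> L2_inner (\<lambda>x. qh x - q x) z + \<alpha> * (deriv_TV qh - deriv_TV q)"
  proof (rule variational_inequality[OF _ _ ud \<alpha>_pos _ q_in_BV qh_in_BV _ states(1) v adjoints(1)])
    show "optimal_control H10 BV a d0 ud \<alpha> q" using opt by (simp add: optimal_triple_def)
    show "(\<lambda>x. (1 - t) * q x + t * qh x) \<in> BV" if "0 < t" "t \<le> 1" for t
      using deriv_TV_convex(1)[OF q_in_BV qh_in_BV] that by simp
    show "(\<lambda>x. c * v x + e * w x) \<in> H10" if "v \<in> H10" "w \<in> H10" for v w c e
      by (intro H10_add H10_cmult that)
  qed simp
  moreover
  obtain w where w: "is_state (Vh_space X l) a d0 Pq w" using discrete_state_exists[OF Pq_int] by blast
  have PqQ: "Pq \<in> Qh_space X l" unfolding Pq_def by (rule step_in_Qh)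
  have "0 \<le> L2_inner (\<lambda>x. Pq x - qh x) zh + \<alpha> * (deriv_TV Pq - deriv_TV qh)"
  proof (rule variational_inequality[OF Vh_subset_H10 _ ud \<alpha>_pos _ qh_in_BV _ _ states(2) w adjoints(2)])
    show "optimal_control (Vh_space X l) (Qh_space X l) a d0 ud \<alpha> qh" using opth by (simp add: optimal_triple_def)
    show "(\<lambda>x. (1 - t) * qh x + t * Pq x) \<in> Qh_space X l" for t by (rule Qh_lincomb[OF qh_in_Qh PqQ])
    show "Pq \<in> BV" using PqQ Qh_subset_BV by blast
  qed (rule Vh_lincomb)
  moreover have "\<alpha> * deriv_TV Pq \<le> \<alpha> * deriv_TV q"
    unfolding Pq_def using deriv_TV_step_avg[OF q_in_BV] \<alpha>_pos by (intro mult_left_mono) auto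
  moreover have "L2_inner (\<lambda>x. qh x - q x) z = L2_inner qh z - L2_inner q z"
    by (rule L2_inner_H10_add(2)[OF q_int(2,1) in_H10(2)])
  moreover have "L2_inner (\<lambda>x. Pq x - qh x) zh = L2_inner Pq zh - L2_inner qh zh"
    by (rule L2_inner_H10_add(2)[OF Pq_int q_int(2) in_H10(4)])
  ultimately show ?thesis by (simp add: right_diff_distrib)
qed

text \<open>The residual of the discrete state on the interpolation error of the adjoint state is of
  second order: on each cell the derivative of the discrete state is constant, so that \<open>a\<close>
  may be replaced by its deviation from its cell average.\<close>

lemma residual_1:
  "\<bar>L2_inner qh (\<lambda>x. z x - iz x) - bilin a d0 uh (\<lambda>x. z x - iz x)\<bar> \<le> M * C0 * (1 + (L + D) / \<nu>) * h\<^sup>2"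
proof -
  note I = interpolation[OF kz kz_Lip, folded iz_def gz_def]
  define ez where "ez = (\<lambda>x. z x - iz x)"
  define k where "k = (\<lambda>t. kz t - gz t)"
  have rep: "H10_rep ez k" unfolding ez_def k_def by (rule I(6))
  have kB: "AE t in Om. \<bar>k t\<bar> \<le> M * h" unfolding k_def by (rule I(3))
  have eB: "AE t in Om. \<bar>ez t\<bar> \<le> M * h\<^sup>2" unfolding ez_def by (rule I(4))
  have k2: "in_L2 k" using rep by (simp add: H10_rep_def)
  note e2 = H10_rep_in_L2[OF rep]
  note [measurable] = in_L2_measurable[OF k2] in_L2_measurable[OF e2]
  have Mh: "0 \<le> M * h\<^sup>2" using M_nonneg by simp
  have "\<bar>L2_inner qh ez\<bar> \<le> M * h\<^sup>2 * L1_norm qh"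
    unfolding L2_inner_def L1_norm_def by (rule integral_mult_bound[OF q_int(2) _ eB]) measurable
  also have "\<dots> \<le> M * h\<^sup>2 * C0" by (rule mult_left_mono[OF C0 Mh])
  finally have 1: "\<bar>L2_inner qh ez\<bar> \<le> M * h\<^sup>2 * C0" .
  have "\<bar>L2_inner (\<lambda>x. d0 x * uh x) ez\<bar> \<le> L2_norm (\<lambda>x. d0 x * uh x) * L2_norm ez"
    by (rule Cauchy_Schwarz[OF in_L2_d0[OF in_L2(3)] e2])
  also have "\<dots> \<le> (D * (C0 / \<nu>)) * (M * h\<^sup>2)"
  proof (rule mult_mono)
    have "L2_norm (\<lambda>x. d0 x * uh x) \<le> D * L2_norm uh" by (rule L2_norm_d0[OF in_L2(3)])
    also have "\<dots> \<le> D * (C0 / \<nu>)"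
      using H10_rep_L2_bound[OF uh_rep] state_energy_bound D_nonneg by (intro mult_left_mono) auto
    finally show "L2_norm (\<lambda>x. d0 x * uh x) \<le> D * (C0 / \<nu>)" .
    show "L2_norm ez \<le> M * h\<^sup>2" by (rule L2_norm_le[OF eB]) measurable
    show "0 \<le> D * (C0 / \<nu>)" using D_nonneg C0_nonneg \<nu>_pos by simp
  qed (rule L2_norm_nonneg)
  finally have 2: "\<bar>L2_inner (\<lambda>x. d0 x * uh x) ez\<bar> \<le> (D * (C0 / \<nu>)) * (M * h\<^sup>2)" .
  have ai: "integrable Om a" by (rule integrable_const_bound_Om[OF a_measurable a_AE_bound])
  have kzi: "integrable Om kz" using kz by (auto simp: H10_rep_def intro: in_L2_integrable)
  define b where "b = (\<lambda>i. avg a i * cu i)"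
  have sb: "AE t in Om. step b t = step (avg a) t * step cu t"
    using AE_cell by eventually_elim (auto simp: step_cell b_def)
  have "(\<integral>t. (gz t - kz t) * step b t \<partial>Om) = 0"
    unfolding gz_def by (rule step_avg_orthogonal[OF kzi])
  moreover have "L2_inner (\<lambda>x. a x * step cu x) k
      = (\<integral>t. step cu t * ((a t - step (avg a) t) * k t) - (gz t - kz t) * step b t \<partial>Om)"
    unfolding L2_inner_def
  proof (rule integral_cong_AE)
    show "AE t in Om. a t * step cu t * k t
        = step cu t * ((a t - step (avg a) t) * k t) - (gz t - kz t) * step b t"
      using sb by eventually_elim (simp add: k_def algebra_simps)
    show "(\<lambda>t. step cu t * ((a t - step (avg a) t) * k t) - (gz t - kz t) * step b t) \<in> borel_measurable Om"
      using borel_measurable_integrable[OF kzi] unfolding gz_def by simp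
  qed measurable
  moreover have aB: "AE t in Om. \<bar>(a t - step (avg a) t) * k t\<bar> \<le> L * h * (M * h)"
  proof -
    have "AE t in Om. \<bar>a t - step (avg a) t\<bar> \<le> L * h"
      using AE_cell
    proof eventually_elim
      case (elim t)
      then obtain i where i: "i < l" "t \<in> cell i" by blast
      have "\<bar>a t - avg a i\<bar> \<le> L * h"
        by (rule avg_Lipschitz[OF ai _ i]) (rule a_diff; auto)
      then show ?case using step_cell[OF i] by simp
    qed
    with kB show ?thesis
    proof eventually_elim
      case (elim t)
      have "0 \<le> L * h" using L_nonneg h_pos by simp
      then show ?case unfolding abs_mult using elim by (intro mult_mono) auto
    qed
  qed
  have i1: "integrable Om (\<lambda>t. step cu t * ((a t - step (avg a) t) * k t))"
    by (rule integrable_mult_bounded[OF step_integrable _ aB]) measurable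
  have "\<bar>\<integral>t. step cu t * ((a t - step (avg a) t) * k t) \<partial>Om\<bar> \<le> L * h * (M * h) * (C0 / \<nu>)"
  proof -
    have "\<bar>\<integral>t. step cu t * ((a t - step (avg a) t) * k t) \<partial>Om\<bar> \<le> L * h * (M * h) * (\<integral>t. \<bar>step cu t\<bar> \<partial>Om)"
      by (rule integral_mult_bound[OF step_integrable _ aB]) measurable
    also have "\<dots> \<le> L * h * (M * h) * (C0 / \<nu>)"
      using L1_le_L2[OF step_in_L2, of cu] state_energy_bound L_nonneg h_pos M_nonneg
      by (intro mult_left_mono) auto
    finally show ?thesis .
  qed
  moreover have "integrable Om (\<lambda>t. (gz t - kz t) * step b t)"
  proof -
    obtain B where "AE t in Om. \<bar>step b t\<bar> \<le> B" using step_AE_bounded by blast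
    then show ?thesis using kzi step_integrable unfolding gz_def
      by (intro integrable_mult_bounded[OF _ step_measurable]) auto
  qed
  ultimately have 3: "\<bar>L2_inner (\<lambda>x. a x * step cu x) k\<bar> \<le> L * h * (M * h) * (C0 / \<nu>)"
    using i1 by simp
  have "bilin a d0 uh ez = L2_inner (\<lambda>x. a x * step cu x) k + L2_inner (\<lambda>x. d0 x * uh x) ez"
    by (rule bilin_rep[OF uh_rep rep])
  then have "\<bar>L2_inner qh ez - bilin a d0 uh ez\<bar>
      \<le> M * h\<^sup>2 * C0 + (D * (C0 / \<nu>)) * (M * h\<^sup>2) + L * h * (M * h) * (C0 / \<nu>)"
    using 1 2 3 by linarith
  also have "\<dots> = M * C0 * (1 + (L + D) / \<nu>) * h\<^sup>2"
    by (simp add: power2_eq_square algebra_simps add_divide_distrib)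
  finally show ?thesis by (simp add: ez_def)
qed

text \<open>The interpolation error of the state solves no equation, but it is tested against the adjoint
  equations, whose difference only contains the errors of the adjoint state and of the state.\<close>

lemma residual_2:
  "\<bar>bilin a d0 (\<lambda>x. u x - iu x) zh - L2_inner (\<lambda>x. u x - iu x) (\<lambda>x. uh x - ud x)\<bar>
    \<le> (A + D) * M * c1 * h * (h + E) + M * h * E"
proof -
  note I = interpolation[OF ku ku_Lip, folded iu_def]
  define e where "e = (\<lambda>x. u x - iu x)"
  have rep: "H10_rep e (\<lambda>t. ku t - step (avg ku) t)" unfolding e_def by (rule I(6))
  have eH: "e \<in> H10" by (rule H10_rep_imp_in_H10[OF rep])
  note e2 = H10_rep_in_L2[OF rep]
  have "bilin a d0 e z = L2_inner e (\<lambda>x. u x - ud x)" using adjoints(1) eH by (simp add: is_adjoint_def)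
  moreover have "bilin a d0 e (\<lambda>x. z x - zh x) = bilin a d0 e z - bilin a d0 e zh"
    by (rule bilin_minus_right[OF eH in_H10(2,4)])
  moreover have "L2_inner e (\<lambda>x. u x - ud x) - L2_inner e (\<lambda>x. uh x - ud x) = L2_inner e (\<lambda>x. u x - uh x)"
    using L2_inner_minus_left[OF in_L2_minus[OF in_L2(1) ud] in_L2_minus[OF in_L2(3) ud] e2]
    by (simp add: L2_inner_commute[of e])
  ultimately have eq: "bilin a d0 e zh - L2_inner e (\<lambda>x. uh x - ud x)
      = L2_inner e (\<lambda>x. u x - uh x) - bilin a d0 e (\<lambda>x. z x - zh x)" by linarith
  have "\<bar>bilin a d0 e (\<lambda>x. z x - zh x)\<bar> \<le> (A + D) * L2_norm (\<lambda>t. ku t - step (avg ku) t) * L2_norm De"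
    by (rule bilin_bound[OF rep e_rep])
  also have "\<dots> \<le> (A + D) * (M * h) * (c1 * (h + E))"
    using I(5) adjoint_energy_error A_pos D_nonneg M_nonneg h_pos
    by (intro mult_mono mult_left_mono mult_nonneg_nonneg L2_norm_nonneg) auto
  finally have 1: "\<bar>bilin a d0 e (\<lambda>x. z x - zh x)\<bar> \<le> (A + D) * (M * h) * (c1 * (h + E))" .
  have "\<bar>L2_inner e (\<lambda>x. u x - uh x)\<bar> \<le> L2_norm e * E"
    unfolding E_def by (rule Cauchy_Schwarz[OF e2 in_L2_minus[OF in_L2(1,3)]])
  also have "\<dots> \<le> M * h * E"
    using H10_rep_L2_bound[OF rep] I(5) E_nonneg by (intro mult_right_mono) auto
  finally have 2: "\<bar>L2_inner e (\<lambda>x. u x - uh x)\<bar> \<le> M * h * E" .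
  show ?thesis unfolding e_def[symmetric] eq using 1 2 by (simp add: mult_ac)
qed

text \<open>The averages differ from the control by a function that is orthogonal to all step functions and
  of order \<open>h\<close> in \<open>L1\<close>. Subtracting the cell averages of the adjoint state, which is Lipschitz
  continuous, gains the second factor \<open>h\<close>.\<close>

lemma residual_3: "\<bar>L2_inner (\<lambda>x. Pq x - q x) zh\<bar> \<le> V * K * h\<^sup>2 + V * c1 * h * (h + E)"
proof -
  define p where "p = (\<lambda>x. Pq x - q x)"
  have pint: "integrable Om p" unfolding p_def using Pq_int q_int by simp
  have pL1: "(\<integral>t. \<bar>p t\<bar> \<partial>Om) \<le> h * V" unfolding p_def by (rule Pq_error)
  have kzi: "integrable Om kz" using kz by (auto simp: H10_rep_def intro: in_L2_integrable)
  have kzB: "AE t in Om. \<bar>kz t\<bar> \<le> K" by (rule AE_I2) (simp add: kz_bound)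
  define zp where "zp = prim kz"
  have zz: "AE t in Om. z t = zp t" using kz by (simp add: H10_rep_def zp_def)
  have zpm [measurable]: "zp \<in> borel_measurable Om"
    unfolding zp_def using borel_measurable_integrable[OF kzi] by simp
  have zpi: "integrable Om zp" unfolding zp_def by (rule prim_integrable[OF kzi])
  have dB: "AE t in Om. \<bar>zp t - step (avg zp) t\<bar> \<le> K * h"
    using AE_cell
  proof eventually_elim
    case (elim t)
    then obtain i where i: "i < l" "t \<in> cell i" by blast
    have "\<bar>zp t - avg zp i\<bar> \<le> K * h"
      by (rule avg_Lipschitz[OF zpi _ i]) (unfold zp_def, rule prim_Lipschitz_abs[OF kzi kzB]; auto)
    then show ?case using step_cell[OF i] by simp
  qed
  have KhV: "0 \<le> K * h" using K_nonneg h_pos by simp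
  obtain B where B: "AE t in Om. \<bar>step (avg zp) t\<bar> \<le> B" using step_AE_bounded by blast
  have pm: "p \<in> borel_measurable Om" using pint by simp
  have "L2_inner p z = (\<integral>t. p t * (zp t - step (avg zp) t) + p t * step (avg zp) t \<partial>Om)"
    unfolding L2_inner_def
  proof (rule integral_cong_AE)
    show "AE t in Om. p t * z t = p t * (zp t - step (avg zp) t) + p t * step (avg zp) t"
      using zz by eventually_elim (simp add: algebra_simps)
  qed (use pm in_L2_measurable[OF in_L2(2)] in simp_all)
  also have "\<dots> = (\<integral>t. p t * (zp t - step (avg zp) t) \<partial>Om) + (\<integral>t. p t * step (avg zp) t \<partial>Om)"
    by (intro Bochner_Integration.integral_add integrable_mult_bounded[OF pint _ dB]
        integrable_mult_bounded[OF pint _ B]) measurable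
  also have "(\<integral>t. p t * step (avg zp) t \<partial>Om) = 0"
    unfolding p_def Pq_def by (rule step_avg_orthogonal[OF q_int(1)])
  finally have "\<bar>L2_inner p z\<bar> \<le> K * h * (\<integral>t. \<bar>p t\<bar> \<partial>Om)"
    using integral_mult_bound[OF pint _ dB] by simp
  also have "\<dots> \<le> K * h * (h * V)" by (rule mult_left_mono[OF pL1 KhV])
  finally have 1: "\<bar>L2_inner p z\<bar> \<le> K * h * (h * V)" .
  have "\<bar>L2_inner p (\<lambda>x. z x - zh x)\<bar> \<le> L2_norm De * (\<integral>t. \<bar>p t\<bar> \<partial>Om)"
    unfolding L2_inner_def
    by (rule integral_mult_bound[OF pint in_L2_measurable[OF H10_rep_in_L2[OF e_rep]] H10_rep_AE_bound[OF e_rep]])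
  also have "\<dots> \<le> c1 * (h + E) * (h * V)"
    using adjoint_energy_error pL1 c1_nonneg h_pos E_nonneg by (intro mult_mono) auto
  finally have 2: "\<bar>L2_inner p (\<lambda>x. z x - zh x)\<bar> \<le> c1 * (h + E) * (h * V)" .
  have "L2_inner p (\<lambda>x. z x - zh x) = L2_inner p z - L2_inner p zh"
    using L2_inner_H10_add(3)[OF pint pint in_H10(2)] L2_inner_H10_add(3)[OF pint pint in_H10(4)]
    by (simp add: L2_inner_def right_diff_distrib)
  then have "\<bar>L2_inner p zh\<bar> \<le> K * h * (h * V) + c1 * (h + E) * (h * V)" using 1 2 by linarith
  also have "\<dots> = V * K * h\<^sup>2 + V * c1 * h * (h + E)" by (simp add: power2_eq_square algebra_simps)
  finally show ?thesis by (simp add: p_def)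
qed

definition c2 where "c2 = M * C0 * (1 + (L + D) / \<nu>) + (A + D) * M * c1 + V * K + V * c1"
definition c3 where "c3 = (A + D) * M * c1 + M + V * c1"
definition c4 where "c4 = 1 + c2 + c3"

lemma c2_nonneg: "0 \<le> c2" and c3_nonneg: "0 \<le> c3" and c4_ge_1: "1 \<le> c4"
proof -
  note nn = M_nonneg C0_nonneg L_nonneg D_nonneg \<nu>_pos A_pos c1_nonneg V_nonneg K_nonneg
  show "0 \<le> c2" using nn by (simp add: c2_def)
  moreover show "0 \<le> c3" using nn by (simp add: c3_def)
  ultimately show "1 \<le> c4" by (simp add: c4_def)
qed

text \<open>Up to the three residuals the summed inequalities say that the squared error is not
  positive.\<close>

lemma state_error: "E \<le> c4 * h"
proof -
  define R1 where "R1 = L2_inner qh (\<lambda>x. z x - iz x) - bilin a d0 uh (\<lambda>x. z x - iz x)"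
  define R2 where "R2 = bilin a d0 (\<lambda>x. u x - iu x) zh - L2_inner (\<lambda>x. u x - iu x) (\<lambda>x. uh x - ud x)"
  define R3 where "R3 = L2_inner (\<lambda>x. Pq x - q x) zh"
  note L2 = in_L2_minus[OF in_L2(1) ud] in_L2_minus[OF in_L2(3) ud]
  have "L2_inner qh (\<lambda>x. z x - iz x) = L2_inner qh z - L2_inner qh iz"
    using L2_inner_H10_add(3)[OF q_int(2,2) in_H10(2)] L2_inner_H10_add(3)[OF q_int(2,2) in_H10(6)]
    by (simp add: L2_inner_def right_diff_distrib)
  moreover have "L2_inner qh iz = bilin a d0 uh iz" using states(2) in_Vh(4) by (simp add: is_state_def)
  moreover have "bilin a d0 uh (\<lambda>x. z x - iz x) = bilin a d0 uh z - bilin a d0 uh iz"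
    by (rule bilin_minus_right[OF in_H10(3,2,6)])
  moreover have "bilin a d0 uh z = L2_inner uh (\<lambda>x. u x - ud x)"
    using adjoints(1) in_H10(3) by (simp add: is_adjoint_def)
  ultimately have e1: "L2_inner qh z = L2_inner uh (\<lambda>x. u x - ud x) + R1" by (simp add: R1_def)
  have e2: "L2_inner q z = L2_inner u (\<lambda>x. u x - ud x)"
    using states(1) adjoints(1) in_H10 unfolding is_state_def is_adjoint_def by metis
  have e3: "L2_inner qh zh = L2_inner uh (\<lambda>x. uh x - ud x)"
    using states(2) adjoints(2) in_Vh unfolding is_state_def is_adjoint_def by metis
  have "L2_inner q zh = bilin a d0 u zh" using states(1) in_H10 by (simp add: is_state_def)
  moreover have "bilin a d0 (\<lambda>x. u x - iu x) zh = bilin a d0 u zh - bilin a d0 iu zh"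
    by (rule bilin_minus_left[OF in_H10(1,5,4)])
  moreover have "bilin a d0 iu zh = L2_inner iu (\<lambda>x. uh x - ud x)"
    using adjoints(2) in_Vh by (simp add: is_adjoint_def)
  moreover have "L2_inner (\<lambda>x. u x - iu x) (\<lambda>x. uh x - ud x)
      = L2_inner u (\<lambda>x. uh x - ud x) - L2_inner iu (\<lambda>x. uh x - ud x)"
    by (rule L2_inner_minus_left[OF in_L2(1,5) L2(2)])
  moreover have "R3 = L2_inner Pq zh - L2_inner q zh"
    unfolding R3_def by (rule L2_inner_H10_add(2)[OF Pq_int q_int(1) in_H10(4)])
  ultimately have e4: "L2_inner Pq zh = L2_inner u (\<lambda>x. uh x - ud x) + R2 + R3" by (simp add: R2_def)
  have "E\<^sup>2 = L2_inner (\<lambda>x. u x - uh x) (\<lambda>x. (u x - ud x) - (uh x - ud x))"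
    unfolding E_def L2_norm_sq by simp
  also have "\<dots> = L2_inner (\<lambda>x. u x - uh x) (\<lambda>x. u x - ud x) - L2_inner (\<lambda>x. u x - uh x) (\<lambda>x. uh x - ud x)"
    unfolding L2_inner_commute[of "\<lambda>x. u x - uh x"]
    by (rule L2_inner_minus_left[OF L2 in_L2_minus[OF in_L2(1,3)]])
  also have "\<dots> = (L2_inner u (\<lambda>x. u x - ud x) - L2_inner uh (\<lambda>x. u x - ud x))
      - (L2_inner u (\<lambda>x. uh x - ud x) - L2_inner uh (\<lambda>x. uh x - ud x))"
    unfolding L2_inner_minus_left[OF in_L2(1,3) L2(1)] L2_inner_minus_left[OF in_L2(1,3) L2(2)] ..
  finally have "E\<^sup>2 \<le> R1 + R2 + R3" using summed_inequalities e1 e2 e3 e4 by linarith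
  also have "\<dots> \<le> c2 * h\<^sup>2 + c3 * h * E"
  proof -
    have "R1 + R2 + R3 \<le> M * C0 * (1 + (L + D) / \<nu>) * h\<^sup>2
        + ((A + D) * M * c1 * h * (h + E) + M * h * E) + (V * K * h\<^sup>2 + V * c1 * h * (h + E))"
      using residual_1 residual_2 residual_3 unfolding R1_def R2_def R3_def by linarith
    also have "\<dots> = c2 * h\<^sup>2 + c3 * h * E"
      by (simp add: c2_def c3_def power2_eq_square algebra_simps)
    finally show ?thesis .
  qed
  finally have key: "E\<^sup>2 \<le> c2 * h\<^sup>2 + c3 * h * E" .
  show ?thesis
  proof (rule ccontr)
    \<comment> \<open>Otherwise \<open>h \<le> E\<close>, and the quadratic inequality can be divided by \<open>E\<close>.\<close>
    assume "\<not> ?thesis"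
    then have lt: "c4 * h < E" by simp
    have "h \<le> c4 * h" using c4_ge_1 h_pos by simp
    then have hE: "h \<le> E" using lt by linarith
    have "c2 * h\<^sup>2 \<le> c2 * h * E"
      unfolding power2_eq_square mult.assoc using hE c2_nonneg h_pos by (intro mult_left_mono) auto
    then have "E * E \<le> (c2 + c3) * h * E" using key by (simp add: power2_eq_square algebra_simps)
    then have "E \<le> (c2 + c3) * h" using hE h_pos by simp
    also have "\<dots> \<le> c4 * h" using h_pos by (intro mult_right_mono) (auto simp: c4_def)
    finally show False using lt by simp
  qed
qed

definition c5 where "c5 = c1 * (1 + c4)"

lemma c5_nonneg: "0 \<le> c5"
  using c1_nonneg c4_ge_1 by (simp add: c5_def)

lemma De_L2: "L2_norm De \<le> c5 * h"
proof -
  have "c1 * (h + E) \<le> c1 * (h + c4 * h)"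
    using state_error c1_nonneg by (intro mult_left_mono) auto
  then show ?thesis using adjoint_energy_error by (simp add: c5_def algebra_simps)
qed

lemma adjoint_sup_error: "AE x in Om. \<bar>z x - zh x\<bar> \<le> c5 * h"
  using H10_rep_AE_bound[OF e_rep] by eventually_elim (use De_L2 in linarith)

definition c6 where "c6 = c4 + D * c5"
definition c7 where "c7 = M + (A * c5 + 2 * c6 + A * M) / \<nu>"

lemma c6_nonneg: "0 \<le> c6"
  using c4_ge_1 D_nonneg c5_nonneg by (simp add: c6_def)

text \<open>The discrete error equation makes the function \<open>a e' + R\<close>, with a primitive \<open>R\<close> of the
  right hand side, orthogonal to all mean-free step functions. Its averages therefore agree on
  all cells, which carries the energy estimate over to each single cell.\<close>

lemma adjoint_derivative_sup_error: "AE x in Om. \<bar>De x\<bar> \<le> c7 * h"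
proof -
  define e where "e = (\<lambda>x. z x - zh x)"
  note e2 = H10_rep_in_L2[OF e_rep, folded e_def]
  have kz2: "in_L2 kz" and De2: "in_L2 De" using kz e_rep by (auto simp: H10_rep_def)
  define r where "r = (\<lambda>x. (u x - uh x) - d0 x * e x)"
  have du: "in_L2 (\<lambda>x. u x - uh x)" by (rule in_L2_minus[OF in_L2(1,3)])
  have r2: "in_L2 r" unfolding r_def by (intro in_L2_minus du in_L2_d0 e2)
  have ri: "integrable Om r" by (rule in_L2_integrable[OF r2])
  have rL1: "(\<integral>t. \<bar>r t\<bar> \<partial>Om) \<le> c6 * h"
  proof -
    have "(\<integral>t. \<bar>r t\<bar> \<partial>Om) \<le> L2_norm r" by (rule L1_le_L2[OF r2])
    also have "\<dots> \<le> E + L2_norm (\<lambda>x. (-1) * (d0 x * e x))"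
      using L2_norm_triangle[OF du in_L2_cmult[OF in_L2_d0[OF e2], of "-1"]] by (simp add: r_def E_def)
    also have "\<dots> \<le> E + D * L2_norm e"
      unfolding L2_norm_cmult using L2_norm_d0[OF e2] by simp
    also have "\<dots> \<le> c4 * h + D * (c5 * h)"
      using state_error H10_rep_L2_bound[OF e_rep] De_L2 D_nonneg
      by (intro add_mono mult_left_mono) (auto simp: e_def)
    finally show ?thesis by (simp add: c6_def algebra_simps)
  qed
  have pr: "\<bar>prim r t\<bar> \<le> c6 * h" for t using prim_bound[OF ri, of t] rL1 by linarith
  have pri: "integrable Om (prim r)" by (rule prim_integrable[OF ri])
  have aDe: "integrable Om (\<lambda>t. a t * De t)" by (intro in_L2_integrable in_L2_a De2)
  define \<kappa> where "\<kappa> = (\<lambda>t. a t * De t + prim r t)"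
  have \<kappa>i: "integrable Om \<kappa>" unfolding \<kappa>_def using aDe pri by simp
  have orth: "(\<integral>t. \<kappa> t * step b t \<partial>Om) = 0" if b: "(\<integral>t. step b t \<partial>Om) = 0" for b
  proof -
    define w where "w = prim (step b)"
    have wVh: "w \<in> Vh_space X l" and w_rep: "H10_rep w (step b)"
      unfolding w_def using prim_step_in_Vh[OF b] by auto
    have wH: "w \<in> H10" by (rule H10_rep_imp_in_H10[OF w_rep])
    note w2 = H10_rep_in_L2[OF w_rep]
    have "bilin a d0 w e = bilin a d0 w z - bilin a d0 w zh"
      unfolding e_def by (rule bilin_minus_right[OF wH in_H10(2,4)])
    also have "\<dots> = L2_inner w (\<lambda>x. u x - ud x) - L2_inner w (\<lambda>x. uh x - ud x)"
      using adjoints wH wVh by (simp add: is_adjoint_def)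
    also have "\<dots> = L2_inner (\<lambda>x. u x - uh x) w"
      using L2_inner_minus_left[OF in_L2_minus[OF in_L2(1) ud] in_L2_minus[OF in_L2(3) ud] w2]
      by (simp add: L2_inner_commute[of w])
    finally have "bilin a d0 e w = L2_inner (\<lambda>x. u x - uh x) w" by (simp add: bilin_commute)
    moreover have "bilin a d0 e w = L2_inner (\<lambda>x. a x * De x) (step b) + L2_inner (\<lambda>x. d0 x * e x) w"
      by (rule bilin_rep[OF e_rep[folded e_def] w_rep])
    moreover have "L2_inner r w = L2_inner (\<lambda>x. u x - uh x) w - L2_inner (\<lambda>x. d0 x * e x) w"
      unfolding r_def by (rule L2_inner_minus_left[OF du in_L2_d0[OF e2] w2])
    ultimately have "L2_inner (\<lambda>x. a x * De x) (step b) = L2_inner r w" by simp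
    also have "L2_inner r w = - (\<integral>t. step b t * prim r t \<partial>Om)"
      unfolding L2_inner_def w_def by (simp add: prim_by_parts[OF ri step_integrable] b)
    finally have "(\<integral>t. a t * De t * step b t \<partial>Om) + (\<integral>t. prim r t * step b t \<partial>Om) = 0"
      by (simp add: L2_inner_def mult.commute)
    moreover obtain B where B: "AE t in Om. \<bar>step b t\<bar> \<le> B" using step_AE_bounded by blast
    ultimately show ?thesis
      using integrable_mult_bounded[OF aDe step_measurable B] integrable_mult_bounded[OF pri step_measurable B]
      by (simp add: \<kappa>_def distrib_right)
  qed
  have total: "\<bar>\<integral>t. \<kappa> t \<partial>Om\<bar> \<le> A * c5 * h + c6 * h"
  proof -
    have "\<bar>\<integral>t. De t * a t \<partial>Om\<bar> \<le> A * (\<integral>t. \<bar>De t\<bar> \<partial>Om)"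
      by (rule integral_mult_bound[OF in_L2_integrable[OF De2] a_measurable a_AE_bound])
    also have "\<dots> \<le> A * (c5 * h)"
      using L1_le_L2[OF De2] De_L2 A_pos by (intro mult_left_mono) auto
    finally have 1: "\<bar>\<integral>t. a t * De t \<partial>Om\<bar> \<le> A * c5 * h" by (simp add: mult_ac)
    have "\<bar>\<integral>t. prim r t \<partial>Om\<bar> \<le> (\<integral>t. \<bar>prim r t\<bar> \<partial>Om)" by (rule integral_abs_bound)
    also have "\<dots> \<le> (\<integral>t. c6 * h \<partial>Om)" by (rule integral_mono) (use pri pr in auto)
    finally have 2: "\<bar>\<integral>t. prim r t \<partial>Om\<bar> \<le> c6 * h" by simp
    have "(\<integral>t. \<kappa> t \<partial>Om) = (\<integral>t. a t * De t \<partial>Om) + (\<integral>t. prim r t \<partial>Om)"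
      unfolding \<kappa>_def using aDe pri by simp
    then show ?thesis using 1 2 by linarith
  qed
  have kg: "AE t in Om. \<bar>kz t - gz t\<bar> \<le> M * h"
    unfolding gz_def by (rule interpolation(3)[OF kz kz_Lip])
  define \<sigma> where "\<sigma> = (\<lambda>i. avg kz i - cz i)"
  have split: "De t = (kz t - gz t) + step \<sigma> t" for t
    using step_lincomb[of "avg kz" "-1" cz t] by (simp add: De_def gz_def \<sigma>_def)
  have ai: "integrable Om a" by (rule integrable_const_bound_Om[OF a_measurable a_AE_bound])
  have \<sigma>: "\<bar>\<sigma> i\<bar> \<le> (A * c5 + 2 * c6 + A * M) * h / \<nu>" if i: "i < l" for i
  proof -
    have k2: "in_L2 (\<lambda>t. kz t - gz t)" unfolding gz_def by (intro in_L2_minus kz2 step_in_L2)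
    have i1: "integrable Om (\<lambda>t. a t * (kz t - gz t))" and i2: "integrable Om (\<lambda>t. a t * step \<sigma> t)"
      by (intro in_L2_integrable in_L2_a k2 step_in_L2)+
    have "avg \<kappa> i = (\<integral>t. \<kappa> t \<partial>Om)" by (rule avg_constant[OF \<kappa>i orth i])
    moreover have "avg \<kappa> i = avg (\<lambda>t. a t * De t) i + avg (prim r) i"
      unfolding \<kappa>_def by (rule avg_add[OF aDe pri])
    moreover have "avg (\<lambda>t. a t * De t) i = avg (\<lambda>t. a t * (kz t - gz t)) i + \<sigma> i * avg a i"
      unfolding split distrib_left using avg_add[OF i1 i2, of i] by (simp add: avg_mult_step[OF i])
    moreover have "\<bar>avg (prim r) i\<bar> \<le> c6 * h" by (rule avg_bound[OF pri AE_I2[OF pr] i])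
    moreover have "\<bar>avg (\<lambda>t. a t * (kz t - gz t)) i\<bar> \<le> A * (M * h)"
    proof (rule avg_bound[OF i1 _ i])
      show "AE t in Om. \<bar>a t * (kz t - gz t)\<bar> \<le> A * (M * h)"
        using a_AE_bound kg by eventually_elim (use A_pos in \<open>auto simp: abs_mult intro!: mult_mono\<close>)
    qed
    ultimately have "\<bar>\<sigma> i * avg a i\<bar> \<le> A * c5 * h + c6 * h + c6 * h + A * (M * h)" using total by linarith
    moreover have "\<nu> \<le> avg a i"
    proof -
      have "(\<integral>t. \<nu> * (indicat_real (cell i) t * 1) \<partial>Om) \<le> cell_int a i"
        unfolding cell_int_def
      proof (rule integral_mono)
        show "integrable Om (\<lambda>t. \<nu> * (indicat_real (cell i) t * 1))" using integrable_cell[of "\<lambda>_. 1" i] by simp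
        show "integrable Om (\<lambda>t. indicat_real (cell i) t * a t)" by (rule integrable_cell[OF ai])
        show "\<nu> * (indicat_real (cell i) t * 1) \<le> indicat_real (cell i) t * a t" if "t \<in> space Om" for t
          using a_lower[of t] that by (simp add: indicator_def)
      qed
      then have "\<nu> * len i \<le> cell_int a i" using cell_int_1[OF i] by (simp add: cell_int_def)
      then show ?thesis using len_pos[OF i] by (simp add: avg_def pos_le_divide_eq)
    qed
    then have "\<bar>\<sigma> i\<bar> * \<nu> \<le> \<bar>\<sigma> i * avg a i\<bar>"
      unfolding abs_mult using \<nu>_pos by (intro mult_left_mono) auto
    ultimately have "\<bar>\<sigma> i\<bar> * \<nu> \<le> (A * c5 + 2 * c6 + A * M) * h" by (simp add: algebra_simps)
    then show ?thesis using \<nu>_pos by (simp add: pos_le_divide_eq)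
  qed
  have "AE t in Om. \<bar>step \<sigma> t\<bar> \<le> (A * c5 + 2 * c6 + A * M) * h / \<nu>"
    by (rule step_AE_bound) (rule \<sigma>)
  with kg show ?thesis
  proof eventually_elim
    case (elim t)
    then have "\<bar>De t\<bar> \<le> M * h + (A * c5 + 2 * c6 + A * M) * h / \<nu>" unfolding split[of t] by linarith
    then show ?case by (simp add: c7_def algebra_simps add_divide_distrib)
  qed
qed

lemma W1inf_error: "W1inf_norm (\<lambda>t. z t - zh t) \<le> ereal ((c5 + c7) * h)"
proof -
  note wd = H10_rep_weak_deriv[OF e_rep] and wd' = H10_rep_weak_deriv_AE[OF e_rep]
  have c7: "0 \<le> c7"
    using M_nonneg A_pos c5_nonneg c6_nonneg \<nu>_pos by (simp add: c7_def)
  have le: "c5 * h \<le> (c5 + c7) * h" "c7 * h \<le> (c5 + c7) * h"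
    using c5_nonneg c7 h_pos by (auto intro!: mult_right_mono)
  have [measurable]: "(\<lambda>t. z t - zh t) \<in> borel_measurable Om"
    by (rule in_L2_measurable[OF H10_rep_in_L2[OF e_rep]])
  note [measurable] = wd'(2)
  have "Linf_norm (\<lambda>t. z t - zh t) \<le> ereal ((c5 + c7) * h)"
    unfolding Linf_norm_def
  proof (rule esssup_I)
    show "AE x in Om. ereal \<bar>z x - zh x\<bar> \<le> ereal ((c5 + c7) * h)"
      using adjoint_sup_error by eventually_elim (use le in simp)
  qed measurable
  moreover have "Linf_norm (weak_deriv (\<lambda>t. z t - zh t)) \<le> ereal ((c5 + c7) * h)"
    unfolding Linf_norm_def
  proof (rule esssup_I)
    show "AE x in Om. ereal \<bar>weak_deriv (\<lambda>t. z t - zh t) x\<bar> \<le> ereal ((c5 + c7) * h)"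
      using adjoint_derivative_sup_error wd'(1) by eventually_elim (use le in simp)
  qed measurable
  ultimately show ?thesis using wd unfolding W1inf_norm_def by auto
qed

end

lemma in_Linf_AE_bound:
  assumes "in_Linf f"
  shows "\<exists>B. AE x in Om. \<bar>f x\<bar> \<le> B"
proof -
  have AE: "AE x in Om. ereal \<bar>f x\<bar> \<le> Linf_norm f" unfolding Linf_norm_def by (rule esssup_AE)
  have fin: "Linf_norm f < \<infinity>" using assms by (simp add: in_Linf_def)
  have "AE x in Om. \<bar>f x\<bar> \<le> real_of_ereal (Linf_norm f)"
    using AE by eventually_elim (use fin in \<open>cases "Linf_norm f"; simp\<close>)
  then show ?thesis by blast
qed

theorem corollary6:
  fixes \<alpha> \<nu> h0 :: real
    and a d0 ud :: "real \<Rightarrow> real"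
    and u q z :: "real \<Rightarrow> real"
  assumes "\<alpha> > 0"
    and "in_Linf ud"
    and "\<exists>L. L-lipschitz_on {0..1} a"
    and "\<nu> > 0" and "\<forall>x\<in>{0..1}. a x \<ge> \<nu>"
    and "in_Linf d0" and "AE x in Om. d0 x \<ge> 0"
    and "h0 > 0"
    and "\<exists>C0>0. \<forall>x l qh. grid x l \<and> mesh_width x l \<le> h0 \<and>
           optimal_control (Vh_space x l) (Qh_space x l) a d0 ud \<alpha> qh \<longrightarrow> BV_norm qh \<le> C0"
    and "optimal_triple H10 BV a d0 ud \<alpha> u q z"
  shows "\<exists>C>0. \<forall>x l uh qh zh. grid x l \<and> mesh_width x l \<le> h0 \<and>
           optimal_triple (Vh_space x l) (Qh_space x l) a d0 ud \<alpha> uh qh zh \<longrightarrow>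
             W1inf_norm (\<lambda>t. z t - zh t) \<le> ereal (C * mesh_width x l)"
proof -
  obtain L where L: "L-lipschitz_on {0..1} a" using assms(3) by blast
  obtain D where D: "AE x in Om. \<bar>d0 x\<bar> \<le> D" using in_Linf_AE_bound[OF assms(6)] by blast
  obtain U where U: "AE x in Om. \<bar>ud x\<bar> \<le> U" using in_Linf_AE_bound[OF assms(2)] by blast
  have udm: "ud \<in> borel_measurable Om" and d0m: "d0 \<in> borel_measurable Om"
    using assms(2,6) by (auto simp: in_Linf_def)
  interpret coefficients a d0 \<nu> L D
    by unfold_locales (use assms(4,5,7) L D d0m in auto)
  have ud2: "in_L2 ud" by (rule bounded_in_L2[OF udm U])
  have st: "is_state H10 a d0 q u" and ad: "is_adjoint H10 a d0 ud u z" and qBV: "q \<in> BV"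
    using assms(10) by (auto simp: optimal_triple_def optimal_control_def)
  then have uH: "u \<in> H10" and zH: "z \<in> H10" by (auto simp: is_state_def is_adjoint_def)
  note u_rep = in_H10_imp_rep[OF uH] and z_rep = in_H10_imp_rep[OF zH]
  obtain \<mu> where qi: "integrable Om q" and \<mu>: "is_measure_deriv q \<mu>" using qBV by (auto simp: BV_def)
  obtain P N where d: "measure_difference \<mu> P N" using \<mu> is_measure_deriv_iff by blast
  obtain c where c: "AE x in Om. q x = c + cdf \<mu> x" using is_measure_deriv_rep[OF qi \<mu>] by blast
  have qB: "AE x in Om. \<bar>q x\<bar> \<le> \<bar>c\<bar> + (measure P Omega + measure N Omega)"
    using c
  proof eventually_elim
    case (elim x)
    then show ?case using cdf_difference_bound[OF d, of x] abs_triangle_ineq[of c "cdf \<mu> x"] by linarith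
  qed
  have test_H10: "\<phi> \<in> H10" if "test_function \<phi>" for \<phi>
    by (rule H10_rep_imp_in_H10[OF H10_rep_test[OF that]])
  have "\<exists>k K M. H10_rep u k \<and> (\<forall>x\<in>{0..1}. \<bar>k x\<bar> \<le> K) \<and>
      (\<forall>x\<in>{0..1}. \<forall>y\<in>{0..1}. \<bar>k x - k y\<bar> \<le> M * \<bar>x - y\<bar>)"
  proof (rule solution_regularity[OF u_rep borel_measurable_integrable[OF qi] qB])
    show "bilin a d0 u \<phi> = L2_inner q \<phi>" if "test_function \<phi>" for \<phi>
      using st test_H10[OF that] by (simp add: is_state_def)
  qed
  then obtain ku M1 where ku: "H10_rep u ku"
    and ku_Lip: "\<forall>x\<in>{0..1}. \<forall>y\<in>{0..1}. \<bar>ku x - ku y\<bar> \<le> M1 * \<bar>x - y\<bar>" by blast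
  have "\<exists>k K M. H10_rep z k \<and> (\<forall>x\<in>{0..1}. \<bar>k x\<bar> \<le> K) \<and>
      (\<forall>x\<in>{0..1}. \<forall>y\<in>{0..1}. \<bar>k x - k y\<bar> \<le> M * \<bar>x - y\<bar>)"
  proof (rule solution_regularity[OF z_rep])
    show "(\<lambda>x. u x - ud x) \<in> borel_measurable Om"
      using udm in_L2_measurable[OF H10_rep_in_L2[OF u_rep]] by simp
    show "AE x in Om. \<bar>u x - ud x\<bar> \<le> L2_norm (weak_deriv u) + U"
      using U H10_rep_AE_bound[OF u_rep] by eventually_elim linarith
    show "bilin a d0 z \<phi> = L2_inner (\<lambda>x. u x - ud x) \<phi>" if "test_function \<phi>" for \<phi>
      using ad test_H10[OF that] by (simp add: is_adjoint_def bilin_commute[of z] L2_inner_commute[of \<phi>])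
  qed
  then obtain kz K M2 where kz: "H10_rep z kz" and kz_bound: "\<forall>x\<in>{0..1}. \<bar>kz x\<bar> \<le> K"
    and kz_Lip: "\<forall>x\<in>{0..1}. \<forall>y\<in>{0..1}. \<bar>kz x - kz y\<bar> \<le> M2 * \<bar>x - y\<bar>" by blast
  define M where "M = max M1 M2"
  have M: "M1 * r \<le> M * r" "M2 * r \<le> M * r" if "0 \<le> r" for r
    using that by (auto simp: M_def intro: mult_right_mono)
  obtain C0 where C0: "\<And>x l qh. grid x l \<Longrightarrow> mesh_width x l \<le> h0 \<Longrightarrow>
      optimal_control (Vh_space x l) (Qh_space x l) a d0 ud \<alpha> qh \<Longrightarrow> BV_norm qh \<le> C0"
    using assms(9) by blast
  define C where "C = optimality.c5 a \<nu> L D P N M K C0 + optimality.c7 a \<nu> L D P N M K C0"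
  have est: "W1inf_norm (\<lambda>t. z t - zh t) \<le> ereal (C * mesh_width x l)"
    if g: "grid x l" "mesh_width x l \<le> h0"
      and t: "optimal_triple (Vh_space x l) (Qh_space x l) a d0 ud \<alpha> uh qh zh" for x l uh qh zh
  proof -
    interpret g: galerkin a d0 \<nu> L D x l by unfold_locales (rule g(1))
    have oc: "optimal_control (Vh_space x l) (Qh_space x l) a d0 ud \<alpha> qh"
      using t by (simp add: optimal_triple_def)
    then have "qh \<in> BV" using g.Qh_subset_BV by (auto simp: optimal_control_def)
    then have "L1_norm qh \<le> BV_norm qh" using deriv_TV_nonneg by (simp add: BV_norm_def)
    also have "\<dots> \<le> C0" by (rule C0[OF g oc])
    finally have L1: "L1_norm qh \<le> C0" .
    interpret o: optimality a d0 \<nu> L D x l \<alpha> ud u q z ku kz uh qh zh \<mu> P N c M K C0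
    proof unfold_locales
      fix s t :: real assume st: "s \<in> {0..1}" "t \<in> {0..1}"
      show "\<bar>ku s - ku t\<bar> \<le> M * \<bar>s - t\<bar>" using ku_Lip st M(1)[of "\<bar>s - t\<bar>"] by fastforce
      show "\<bar>kz s - kz t\<bar> \<le> M * \<bar>s - t\<bar>" using kz_Lip st M(2)[of "\<bar>s - t\<bar>"] by fastforce
    qed (use assms(1,10) ud2 t ku kz kz_bound d c L1 in auto)
    show ?thesis using o.W1inf_error by (simp add: C_def)
  qed
  have "W1inf_norm (\<lambda>t. z t - zh t) \<le> ereal ((\<bar>C\<bar> + 1) * mesh_width x l)"
    if g: "grid x l" "mesh_width x l \<le> h0"
      and t: "optimal_triple (Vh_space x l) (Qh_space x l) a d0 ud \<alpha> uh qh zh" for x l uh qh zh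
  proof -
    interpret mesh x l by unfold_locales (rule g(1))
    have "C * h \<le> (\<bar>C\<bar> + 1) * h" using h_pos by (intro mult_right_mono) auto
    then show ?thesis using est[OF that] by (meson ereal_less_eq(3) order_trans)
  qed
  moreover have "\<bar>C\<bar> + 1 > 0" by simp
  ultimately show ?thesis by blast
qed

end
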